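(* Let $G$ be a type definable group in a strongly$^2$ dependent theory $T$. (1) Given a family of uniformly type definable subgroups $\{p(x,a_i)\mid i<\omega\}$ of $G$ (i.e. $p(x,y)$ is a type and $p(\mathfrak{C},a_i)$ is a subgroup of $G$ for each $i<\omega$) such that $\langle a_i\mid i<\omega\rangle$ is an indiscernible sequence, there is some $n<\omega$ such that $\bigcap_{j<\omega}p(\mathfrak{C},a_j)=\bigcap_{j<n}p(\mathfrak{C},a_j)$. In particular, $T$ has Property A, which is the following property of a theory: whenever $G$ is a type definable group, $p(x,y)$ is a type and $\langle a_i\mid i<\omega\rangle$ is an indiscernible sequence such that $G_i=p(\mathfrak{C},a_i)$ is a subgroup of $G$ for each $i<\omega$, there is some $n$ such that for all finite sets $v\subseteq\omega$, the intersection $\bigcap_{i\in v}G_i$ is equal to a sub-intersection of size $n$ (that is, to $\bigcap_{i\in v'}G_i$ for some $v'\subseteq v$ with $|v'|\le n$). (2) Given a family of uniformly definable subgroups $\{\varphi(x,c)\mid c\in C\}$ of $G$ (i.e. $\varphi(x,y)$ is a formula and $\varphi(\mathfrak{C},c)$ is a subgroup of $G$ for every $c\in C$), the intersection $\bigcap_{c\in C}\varphi(\mathfrak{C},c)$ is already a finite one, i.e. it equals $\bigcap_{c\in C_0}\varphi(\mathfrak{C},c)$ for some finite $C_0\subseteq C$.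
   Context: $T$ is a complete first order theory and $\mathfrak{C}$ is its monster model (a very big saturated model containing all small models). Finite tuples and singletons are not distinguished. Type definable group: given by a type, i.e. a collection $\Sigma(x)$ of formulas (maybe over parameters), with $x$ a finite tuple, and a formula $\nu(x,y,z)$ such that $\langle \Sigma(\mathfrak{C}),\nu\rangle$ is a group with $\nu$ defining the group operation. Indiscernible array: $\langle a_{i,j}\mid i,j<\omega\rangle$ (elements or tuples) is an indiscernible array over $A$ if for each $i_0<\omega$ the row $\langle a_{i_0,j}\mid j<\omega\rangle$ is indiscernible over $A\cup\{a_{i,j}\mid i\ne i_0,\ i,j<\omega\}$. Strongly$^2$ dependent: $T$ is not strongly$^2$ dependent if there are formulas $\langle\varphi_i(x,y_i,z_i)\mid i<\omega\rangle$ ($x,y_i,z_i$ can be tuples, and the lengths of $y_i,z_i$ may depend on $i$), an array $\langle a_{i,j}\mid i,j<\omega\rangle$ which is an indiscernible array over $\emptyset$, and tuples $b_k$ from $\{a_{i,j}\mid i<k,\ j<\omega\}$ ($k<\omega$) such that the set $\{\varphi_i(x,a_{i,0},b_i)\wedge\neg\varphi_i(x,a_{i,1},b_i)\mid i<\omega\}$ is consistent. $T$ is strongly$^2$ dependent if no such configuration exists. *)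

theory Defs
  imports "HOL-Algebra.Group" "HOL-Library.Equipollence"
begin

section \<open>First-order logic\<close>

text \<open>A symbol is a name together with its arity; constants are function symbols of arity 0.\<close>

record ('f, 'r) language =
  Funs :: "('f \<times> nat) set"
  Rels :: "('r \<times> nat) set"

datatype 'f fo_term = Var nat | Fun 'f "'f fo_term list"

datatype ('f, 'r) fo_formula =
    Equal "'f fo_term" "'f fo_term"
  | Rel 'r "'f fo_term list"
  | Neg "('f, 'r) fo_formula"
  | Conj "('f, 'r) fo_formula" "('f, 'r) fo_formula"
  | Exists nat "('f, 'r) fo_formula"

primrec term_of :: "('f, 'r) language \<Rightarrow> 'f fo_term \<Rightarrow> bool" where
  "term_of L (Var i) \<longleftrightarrow> True"
| "term_of L (Fun f ts) \<longleftrightarrow> (f, length ts) \<in> Funs L \<and> (\<forall>b\<in>set (map (term_of L) ts). b)"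

primrec formula_of :: "('f, 'r) language \<Rightarrow> ('f, 'r) fo_formula \<Rightarrow> bool" where
  "formula_of L (Equal s t) \<longleftrightarrow> term_of L s \<and> term_of L t"
| "formula_of L (Rel r ts) \<longleftrightarrow> (r, length ts) \<in> Rels L \<and> (\<forall>t\<in>set ts. term_of L t)"
| "formula_of L (Neg \<phi>) \<longleftrightarrow> formula_of L \<phi>"
| "formula_of L (Conj \<phi> \<psi>) \<longleftrightarrow> formula_of L \<phi> \<and> formula_of L \<psi>"
| "formula_of L (Exists i \<phi>) \<longleftrightarrow> formula_of L \<phi>"

primrec term_vars :: "'f fo_term \<Rightarrow> nat set" where
  "term_vars (Var i) = {i}"
| "term_vars (Fun f ts) = \<Union> (set (map term_vars ts))"

primrec free_vars :: "('f, 'r) fo_formula \<Rightarrow> nat set" where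
  "free_vars (Equal s t) = term_vars s \<union> term_vars t"
| "free_vars (Rel r ts) = \<Union> (set (map term_vars ts))"
| "free_vars (Neg \<phi>) = free_vars \<phi>"
| "free_vars (Conj \<phi> \<psi>) = free_vars \<phi> \<union> free_vars \<psi>"
| "free_vars (Exists i \<phi>) = free_vars \<phi> - {i}"

definition sentence_of :: "('f, 'r) language \<Rightarrow> ('f, 'r) fo_formula \<Rightarrow> bool" where
  "sentence_of L \<phi> \<longleftrightarrow> formula_of L \<phi> \<and> free_vars \<phi> = {}"

text \<open>The universe of a structure is the whole type \<open>'m\<close>.\<close>

record ('f, 'r, 'm) fo_struct =
  FunI :: "'f \<Rightarrow> 'm list \<Rightarrow> 'm"
  RelI :: "'r \<Rightarrow> 'm list \<Rightarrow> bool"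

primrec term_val :: "('f, 'r, 'm) fo_struct \<Rightarrow> (nat \<Rightarrow> 'm) \<Rightarrow> 'f fo_term \<Rightarrow> 'm" where
  "term_val M e (Var i) = e i"
| "term_val M e (Fun f ts) = FunI M f (map (term_val M e) ts)"

primrec sat :: "('f, 'r, 'm) fo_struct \<Rightarrow> (nat \<Rightarrow> 'm) \<Rightarrow> ('f, 'r) fo_formula \<Rightarrow> bool" where
  "sat M e (Equal s t) \<longleftrightarrow> term_val M e s = term_val M e t"
| "sat M e (Rel r ts) \<longleftrightarrow> RelI M r (map (term_val M e) ts)"
| "sat M e (Neg \<phi>) \<longleftrightarrow> \<not> sat M e \<phi>"
| "sat M e (Conj \<phi> \<psi>) \<longleftrightarrow> sat M e \<phi> \<and> sat M e \<psi>"
| "sat M e (Exists i \<phi>) \<longleftrightarrow> (\<exists>m. sat M (e(i := m)) \<phi>)"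

text \<open>
  Tuples are lists: \<open>holds M \<phi> xs\<close> interprets the variable \<open>i\<close> by the \<open>i\<close>-th entry of \<open>xs\<close>, so
  \<open>\<phi>(x, y, z)\<close> is evaluated at the concatenation \<open>x @ y @ z\<close>. It is only used when the free
  variables of \<open>\<phi>\<close> are below the length of \<open>xs\<close>.
\<close>

definition holds :: "('f, 'r, 'm) fo_struct \<Rightarrow> ('f, 'r) fo_formula \<Rightarrow> 'm list \<Rightarrow> bool" where
  "holds M \<phi> xs \<longleftrightarrow> sat M (\<lambda>i. xs ! i) \<phi>"

definition models :: "('f, 'r, 'm) fo_struct \<Rightarrow> ('f, 'r) fo_formula set \<Rightarrow> bool" where
  "models M T \<longleftrightarrow> (\<forall>\<phi>\<in>T. \<forall>e. sat M e \<phi>)"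

text \<open>Theories are taken to be deductively closed, so completeness is decidedness by membership.\<close>

definition complete_theory :: "('f, 'r) language \<Rightarrow> ('f, 'r) fo_formula set \<Rightarrow> bool" where
  "complete_theory L T \<longleftrightarrow>
     (\<forall>\<phi>\<in>T. sentence_of L \<phi>) \<and>
     (\<forall>\<phi>. sentence_of L \<phi> \<longrightarrow> (\<phi> \<in> T \<longleftrightarrow> Neg \<phi> \<notin> T))"

section \<open>Formulas with parameters and types\<close>

text \<open>
  The pair \<open>(\<phi>, d)\<close> stands for the formula \<open>\<phi>(x, d)\<close> in which the variables after those of the
  tuple \<open>x\<close> have been replaced by the parameters \<open>d\<close>.
\<close>

type_synonym ('f, 'r, 'm) pformula = "('f, 'r) fo_formula \<times> 'm list"

definition pformula_over ::
    "('f, 'r) language \<Rightarrow> nat \<Rightarrow> 'm set \<Rightarrow> ('f, 'r, 'm) pformula \<Rightarrow> bool" where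
  "pformula_over L n A \<psi> \<longleftrightarrow>
     formula_of L (fst \<psi>) \<and> free_vars (fst \<psi>) \<subseteq> {..<n + length (snd \<psi>)} \<and> set (snd \<psi>) \<subseteq> A"

definition type_over ::
    "('f, 'r) language \<Rightarrow> nat \<Rightarrow> 'm set \<Rightarrow> ('f, 'r, 'm) pformula set \<Rightarrow> bool" where
  "type_over L n A p \<longleftrightarrow> (\<forall>\<psi>\<in>p. pformula_over L n A \<psi>)"

definition solutions ::
    "('f, 'r, 'm) fo_struct \<Rightarrow> nat \<Rightarrow> ('f, 'r, 'm) pformula set \<Rightarrow> 'm list set" where
  "solutions M n p = {xs. length xs = n \<and> (\<forall>(\<phi>, d)\<in>p. holds M \<phi> (xs @ d))}"

text \<open>\<open>plug a \<psi>\<close> turns \<open>\<psi>(x, y)\<close> into \<open>\<psi>(x, a)\<close>; the own parameters of \<open>\<psi>\<close> come last.\<close>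

definition plug :: "'m list \<Rightarrow> ('f, 'r, 'm) pformula \<Rightarrow> ('f, 'r, 'm) pformula" where
  "plug a \<psi> = (fst \<psi>, a @ snd \<psi>)"

text \<open>Consistency with the elementary diagram of \<open>M\<close>.\<close>

definition consistent ::
    "('f, 'r, 'm) fo_struct \<Rightarrow> nat \<Rightarrow> ('f, 'r, 'm) pformula set \<Rightarrow> bool" where
  "consistent M n p \<longleftrightarrow> (\<forall>q\<subseteq>p. finite q \<longrightarrow> solutions M n q \<noteq> {})"

section \<open>The monster model\<close>

definition small :: "'m set \<Rightarrow> bool" where
  "small A \<longleftrightarrow> A \<prec> (UNIV :: 'm set)"

definition saturated :: "('f, 'r) language \<Rightarrow> ('f, 'r, 'm) fo_struct \<Rightarrow> bool" where
  "saturated L M \<longleftrightarrow>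
     (\<forall>A p. small A \<longrightarrow> type_over L 1 A p \<longrightarrow> consistent M 1 p \<longrightarrow> solutions M 1 p \<noteq> {})"

text \<open>
  The set of formulas is infinite, so the second clause makes the universe uncountable and larger
  than the language. Small models embed elementarily into \<open>M\<close> by saturation.
\<close>

definition monster_model ::
    "('f, 'r) language \<Rightarrow> ('f, 'r) fo_formula set \<Rightarrow> ('f, 'r, 'm) fo_struct \<Rightarrow> bool" where
  "monster_model L T M \<longleftrightarrow>
     models M T \<and> {\<phi>. formula_of L \<phi>} \<prec> (UNIV :: 'm set) \<and> saturated L M"

section \<open>Indiscernibility and strongly$^2$ dependent theories\<close>

definition indiscernible ::
    "('f, 'r) language \<Rightarrow> ('f, 'r, 'm) fo_struct \<Rightarrow> 'm set \<Rightarrow> (nat \<Rightarrow> 'm list) \<Rightarrow> bool" where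
  "indiscernible L M A a \<longleftrightarrow>
     (\<exists>m. \<forall>i. length (a i) = m) \<and>
     (\<forall>\<phi> d is js.
        formula_of L \<phi> \<and> set d \<subseteq> A \<and>
        sorted_wrt (<) is \<and> sorted_wrt (<) js \<and> length is = length js \<and>
        free_vars \<phi> \<subseteq> {..<length (concat (map a is) @ d)} \<longrightarrow>
        (holds M \<phi> (concat (map a is) @ d) \<longleftrightarrow> holds M \<phi> (concat (map a js) @ d)))"

definition indiscernible_array ::
    "('f, 'r) language \<Rightarrow> ('f, 'r, 'm) fo_struct \<Rightarrow> 'm set \<Rightarrow> (nat \<Rightarrow> nat \<Rightarrow> 'm list) \<Rightarrow> bool" where
  "indiscernible_array L M A a \<longleftrightarrow>
     (\<forall>i\<^sub>0. indiscernible L M (A \<union> (\<Union>i\<in>- {i\<^sub>0}. \<Union>j. set (a i j))) (a i\<^sub>0))"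

text \<open>
  A property of a complete theory, evaluated in its monster model \<open>M\<close>. Here \<open>n\<close> is the length of
  the tuple \<open>x\<close>, and the conjunction of \<open>\<phi>\<^sub>i(x, a\<^sub>i\<^sub>,\<^sub>0, b\<^sub>i)\<close> and the negation of
  \<open>\<phi>\<^sub>i(x, a\<^sub>i\<^sub>,\<^sub>1, b\<^sub>i)\<close> enters the set as its two conjuncts.
\<close>

definition strongly2_dependent ::
    "('f, 'r) language \<Rightarrow> ('f, 'r, 'm) fo_struct \<Rightarrow> bool" where
  "strongly2_dependent L M \<longleftrightarrow>
     \<not> (\<exists>n (\<phi> :: nat \<Rightarrow> ('f, 'r) fo_formula) a b.
          indiscernible_array L M {} a \<and>
          (\<forall>k. set (b k) \<subseteq> (\<Union>i<k. \<Union>j. set (a i j))) \<and>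
          (\<forall>i. formula_of L (\<phi> i) \<and>
               free_vars (\<phi> i) \<subseteq> {..<n + length (a i 0) + length (b i)}) \<and>
          consistent M n (\<Union>i. {(\<phi> i, a i 0 @ b i), (Neg (\<phi> i), a i 1 @ b i)}))"

section \<open>Type definable groups\<close>

text \<open>The formula \<open>\<nu>\<close> only has to define the graph of the operation on the group itself.\<close>

definition type_definable_group ::
    "('f, 'r) language \<Rightarrow> ('f, 'r, 'm) fo_struct \<Rightarrow> 'm list monoid \<Rightarrow> bool" where
  "type_definable_group L M G \<longleftrightarrow>
     group G \<and>
     (\<exists>n A \<Sigma> \<nu> e.
        small A \<and> type_over L n A \<Sigma> \<and> pformula_over L (n + n + n) A (\<nu>, e) \<and>
        carrier G = solutions M n \<Sigma> \<and>
        (\<forall>x\<in>carrier G. \<forall>y\<in>carrier G. \<forall>z\<in>carrier G.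
           x \<otimes>\<^bsub>G\<^esub> y = z \<longleftrightarrow> holds M \<nu> (x @ y @ z @ e)))"

text \<open>
  Types \<open>p(x, y)\<close> and formulas \<open>\<phi>(x, y)\<close> may have parameters. The parameters \<open>B\<close> of a type have
  to be respected by the indiscernible sequence; for \<open>B = {}\<close> this is plain indiscernibility.
\<close>

definition indiscernible_subgroup_family ::
    "('f, 'r) language \<Rightarrow> ('f, 'r, 'm) fo_struct \<Rightarrow> 'm list monoid \<Rightarrow>
     nat \<Rightarrow> ('f, 'r, 'm) pformula set \<Rightarrow> (nat \<Rightarrow> 'm list) \<Rightarrow> bool" where
  "indiscernible_subgroup_family L M G n p a \<longleftrightarrow>
     (\<exists>B. small B \<and> type_over L (n + length (a 0)) B p \<and> indiscernible L M B a) \<and>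
     (\<forall>i. subgroup (solutions M n (plug (a i) ` p)) G)"

definition definable_subgroup_family ::
    "('f, 'r) language \<Rightarrow> ('f, 'r, 'm) fo_struct \<Rightarrow> 'm list monoid \<Rightarrow>
     nat \<Rightarrow> ('f, 'r, 'm) pformula \<Rightarrow> 'm list set \<Rightarrow> bool" where
  "definable_subgroup_family L M G n \<phi> C \<longleftrightarrow>
     (\<exists>m. pformula_over L (n + m) UNIV \<phi> \<and> (\<forall>c\<in>C. length c = m)) \<and>
     (\<forall>c\<in>C. subgroup (solutions M n {plug c \<phi>}) G)"

definition property_A :: "('f, 'r) language \<Rightarrow> ('f, 'r, 'm) fo_struct \<Rightarrow> bool" where
  "property_A L M \<longleftrightarrow>
     (\<forall>G n p a.
        type_definable_group L M G \<longrightarrow> indiscernible_subgroup_family L M G n p a \<longrightarrow>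
        (\<exists>k. \<forall>v. finite v \<longrightarrow>
           (\<exists>v'\<subseteq>v. card v' \<le> k \<and>
              (\<Inter>i\<in>v. solutions M n (plug (a i) ` p)) = (\<Inter>i\<in>v'. solutions M n (plug (a i) ` p)))))"

end

theory Submission
  imports Defs "HOL-Library.Ramsey" "HOL-Library.Countable_Set"
begin

text \<open>
  Let \<open>H\<^sub>i = p(C, a\<^sub>i)\<close> be subgroups such that \<open>H\<^sub>0 \<inter> \<dots> \<inter> H\<^sub>k\<^sub>-\<^sub>1\<close> is never contained in \<open>H\<^sub>k\<close>. The
  contradiction comes from a product \<open>x = c\<^sub>0 \<cdot> c\<^sub>1 \<cdot> \<dots> \<cdot> c\<^sub>N\<^sub>-\<^sub>1\<close>: if every factor lies in a group that
  absorbs the later factors, then dividing \<open>x\<close> from the left by \<open>v\<^sub>i = c\<^sub>0 \<cdot> \<dots> \<cdot> c\<^sub>i\<^sub>-\<^sub>1\<close> leaves an element of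
  the coset of \<open>c\<^sub>i\<close>. Put the pairs (parameter, factor) into an indiscernible array with rows
  \<open>i\<close>, and take for \<open>c\<^sub>i\<close> the factor in column 1. If a formula \<open>\<chi>\<^sub>i(y, a)\<close> separates this coset at the
  two parameters \<open>a\<^sub>i\<^sub>,\<^sub>0\<close> and \<open>a\<^sub>i\<^sub>,\<^sub>1\<close>, then \<open>\<chi>\<^sub>i(v\<^sub>i\<^sup>-\<^sup>1 \<cdot> x, a\<^sub>i\<^sub>,\<^sub>j)\<close> is a pattern that a strongly$^2$
  dependent theory excludes, because \<open>v\<^sub>i\<close> is a product of entries of earlier rows. This is
  \<open>no_separated_cosets\<close>; two cases lead to such an array.

  If one formula \<open>\<psi>\<close> of \<open>p\<close> witnesses all the non-inclusions, choose \<open>c\<^sub>k\<close> in \<open>H\<^sub>j\<close> for all \<open>j < k\<close> with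
  \<open>\<not> \<psi>(c\<^sub>k, a\<^sub>k)\<close> and extract an indiscernible array: \<open>c\<^sub>i\<^sub>,\<^sub>1\<close> lies in \<open>H\<^sub>i\<^sub>,\<^sub>0\<close>, but not in \<open>H\<^sub>i\<^sub>,\<^sub>1\<close>, and the
  later factors lie in both (\<open>no_strict_chain\<close>).

  Otherwise every formula of \<open>p\<close> at \<open>a\<^sub>k\<close> follows from membership in finitely many of the earlier
  groups, though their number is unbounded as the formula varies. Take \<open>\<psi>\<^sub>i\<close> for which exactly
  \<open>s\<^sub>i + 2\<close> earlier groups are needed, and let \<open>F\<^sub>i\<close> be the intersection of \<open>s\<^sub>i\<close> fixed groups placed
  before all rows. There is \<open>c\<^sub>i\<^sub>,\<^sub>j\<close> in \<open>F\<^sub>i \<inter> H\<^sub>i\<^sub>,\<^sub>j\<close> violating \<open>\<psi>\<^sub>i\<close> at a later parameter; were \<open>c\<^sub>i\<^sub>,\<^sub>1\<close> also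
  in \<open>H\<^sub>i\<^sub>,\<^sub>0\<close>, it would lie in \<open>s\<^sub>i + 2\<close> groups and satisfy \<open>\<psi>\<^sub>i\<close>. If \<open>s\<^sub>i\<^sub>+\<^sub>1\<close> is large, the elements of
  \<open>F\<^sub>i\<^sub>+\<^sub>1\<close> are so close to the identity at every row parameter that they do not disturb this
  (\<open>no_strict_intersections\<close>). This uses that multiplication has the same modulus of continuity
  at all the parameters.

  That uniformity is not free, since the sequence is indiscernible over the parameters of \<open>p\<close> and
  not over those of the group. Two observations repair this in \<open>subgroup_chain_stabilizes\<close>. The
  group may be replaced by \<open>H\<^sub>0\<close>, which needs only the parameters of \<open>p\<close>, the tuple \<open>a\<^sub>0\<close> and the
  finite tuple \<open>e\<close> of the group operation; and in a strongly dependent theory the type of \<open>a\<^sub>k\<close> over a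
  finite tuple is eventually constant in \<open>k\<close> (\<open>eventually_constant_type\<close>).

  Inclusions between intersections only depend on the order type of the indices. So the first part
  and Property A follow at once. In the second part \<open>p\<close> is a single formula and the moduli are
  uniform because the defined subsets are subgroups for all parameters in \<open>C\<close>; hence the first
  case applies to a sequence in \<open>C\<close> whose finite intersections strictly decrease, although this
  sequence need not be indiscernible.
\<close>

section \<open>Formulas and definable relations\<close>

lemma term_val_cong:
  "(\<And>i. i \<in> term_vars t \<Longrightarrow> e i = e' i) \<Longrightarrow> term_val M e t = term_val M e' t"
proof (induction t)
  case (Fun f ts)
  have "map (term_val M e) ts = map (term_val M e') ts"
    using Fun by auto
  then show ?case by (simp del: map_eq_conv)
qed simp

lemma sat_cong:
  "(\<And>i. i \<in> free_vars \<phi> \<Longrightarrow> e i = e' i) \<Longrightarrow> sat M e \<phi> = sat M e' \<phi>"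
proof (induction \<phi> arbitrary: e e')
  case (Equal s t)
  then show ?case by (metis UnCI free_vars.simps(1) sat.simps(1) term_val_cong)
next
  case (Rel r ts)
  have "map (term_val M e) ts = map (term_val M e') ts"
    using Rel by (auto intro!: term_val_cong)
  then show ?case by (simp del: map_eq_conv)
next
  case (Neg \<phi>)
  then show ?case by (metis free_vars.simps(3) sat.simps(3))
next
  case (Conj \<phi> \<psi>)
  then show ?case by (metis UnCI free_vars.simps(4) sat.simps(4))
next
  case (Exists j \<phi>)
  have "sat M (e(j := m)) \<phi> = sat M (e'(j := m)) \<phi>" for m
    using Exists.prems by (intro Exists.IH) auto
  then show ?case by simp
qed

lemma finite_term_vars: "finite (term_vars t)"
  by (induction t) auto

lemma finite_free_vars: "finite (free_vars \<phi>)"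
  by (induction \<phi>) (auto simp: finite_term_vars)

primrec rename_term :: "(nat \<Rightarrow> nat) \<Rightarrow> 'f fo_term \<Rightarrow> 'f fo_term" where
  "rename_term g (Var i) = Var (g i)"
| "rename_term g (Fun f ts) = Fun f (map (rename_term g) ts)"

text \<open>
  Capture is avoided by renaming a bound variable to a number above the images of all free
  variables.
\<close>

primrec rename :: "('f, 'r) fo_formula \<Rightarrow> (nat \<Rightarrow> nat) \<Rightarrow> ('f, 'r) fo_formula" where
  "rename (Equal s t) g = Equal (rename_term g s) (rename_term g t)"
| "rename (Rel r ts) g = Rel r (map (rename_term g) ts)"
| "rename (Neg \<phi>) g = Neg (rename \<phi> g)"
| "rename (Conj \<phi> \<psi>) g = Conj (rename \<phi> g) (rename \<psi> g)"
| "rename (Exists i \<phi>) g =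
     (let j = Suc (Max (insert 0 (g ` free_vars \<phi>))) in Exists j (rename \<phi> (g(i := j))))"

lemma rename_term:
  "term_val M e (rename_term g t) = term_val M (e \<circ> g) t"
  "term_vars (rename_term g t) = g ` term_vars t"
  "term_of L (rename_term g t) = term_of L t"
  by (induction t) (auto simp: o_def image_UN cong: map_cong)

lemma rename:
  "sat M e (rename \<phi> g) = sat M (e \<circ> g) \<phi>" (is ?S)
  "free_vars (rename \<phi> g) = g ` free_vars \<phi>" (is ?F)
  "formula_of L (rename \<phi> g) = formula_of L \<phi>" (is ?O)
proof -
  have "(\<forall>e. sat M e (rename \<phi> g) = sat M (e \<circ> g) \<phi>) \<and> free_vars (rename \<phi> g) = g ` free_vars \<phi> \<and>
    formula_of L (rename \<phi> g) = formula_of L \<phi>"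
  proof (induction \<phi> arbitrary: g)
    case (Exists i \<phi>)
    define j where "j = Suc (Max (insert 0 (g ` free_vars \<phi>)))"
    have fresh: "g v \<noteq> j" if "v \<in> free_vars \<phi>" for v
    proof -
      have "g v \<le> Max (insert 0 (g ` free_vars \<phi>))"
        using that by (intro Max_ge) (auto simp: finite_free_vars)
      then show ?thesis by (simp add: j_def)
    qed
    have "sat M (\<lambda>v. (e(j := m)) ((g(i := j)) v)) \<phi> = sat M ((\<lambda>v. e (g v))(i := m)) \<phi>" for e m
      using fresh by (intro sat_cong) auto
    moreover have "g(i := j) ` free_vars \<phi> - {j} = g ` (free_vars \<phi> - {i})"
      using fresh by auto
    ultimately show ?case
      using Exists.IH[of "g(i := j)"]
      by (simp add: j_def[symmetric] o_def del: fun_upd_apply)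
  qed (auto simp: rename_term image_UN image_Un o_def cong: map_cong)
  then show ?S ?F ?O by blast+
qed

lemma list_as_map: "length x = n \<Longrightarrow> map (\<lambda>l. x ! l) [0..<n] = x"
  by (metis map_nth)

definition depends_on :: "(('v \<Rightarrow> 'm) \<Rightarrow> bool) \<Rightarrow> 'v set \<Rightarrow> bool" where
  "depends_on R V \<longleftrightarrow> (\<forall>s s'. (\<forall>v\<in>V. s v = s' v) \<longrightarrow> R s = R s')"

lemma depends_onD: "depends_on R V \<Longrightarrow> (\<And>v. v \<in> V \<Longrightarrow> s v = s' v) \<Longrightarrow> R s = R s'"
  unfolding depends_on_def by blast

lemma depends_on_mono: "depends_on R V \<Longrightarrow> V \<subseteq> W \<Longrightarrow> depends_on R W"
  unfolding depends_on_def by (meson subsetD)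

definition atoms :: "'m set \<Rightarrow> ('v + 'm) set" where
  "atoms A = range Inl \<union> Inr ` A"

lemma atoms_simps [simp]:
  "Inl v \<in> atoms A" "Inr m \<in> atoms A \<longleftrightarrow> m \<in> A"
  by (auto simp: atoms_def)

lemma atoms_mono: "x \<in> atoms A \<Longrightarrow> A \<subseteq> A' \<Longrightarrow> x \<in> atoms A'"
  by (auto simp: atoms_def)

locale fo_structure =
  fixes L :: "('f, 'r) language" and M :: "('f, 'r, 'm) fo_struct"
begin

text \<open>
  Definability with parameters as a property of predicates on assignments. The variables may come
  from an arbitrary type, so that rows, columns and coordinates of arrays can index them directly and
  no variable ever has to be renumbered; \<open>f\<close> translates the variables of a formula into
  variables of that type and parameters.
\<close>

definition definable :: "'m set \<Rightarrow> (('v \<Rightarrow> 'm) \<Rightarrow> bool) \<Rightarrow> bool" where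
  "definable A R \<longleftrightarrow> (\<exists>\<phi> f. formula_of L \<phi> \<and> f ` free_vars \<phi> \<subseteq> atoms A \<and>
     (\<forall>s. R s \<longleftrightarrow> sat M (\<lambda>i. case_sum s id (f i)) \<phi>))"

lemma definableI:
  assumes "formula_of L \<phi>" "\<And>i. i \<in> free_vars \<phi> \<Longrightarrow> f i \<in> atoms A"
    "\<And>s. R s \<longleftrightarrow> sat M (\<lambda>i. case_sum s id (f i)) \<phi>"
  shows "definable A R"
  unfolding definable_def by (intro exI[of _ \<phi>] exI[of _ f] conjI allI image_subsetI assms)

lemma definableE:
  assumes "definable A R"
  obtains \<phi> f where "formula_of L \<phi>" "\<And>i. i \<in> free_vars \<phi> \<Longrightarrow> f i \<in> atoms A"
    "\<And>s. R s \<longleftrightarrow> sat M (\<lambda>i. case_sum s id (f i)) \<phi>"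
  using assms unfolding definable_def image_subset_iff by metis

lemma definable_mono:
  assumes "definable A R" "A \<subseteq> A'" shows "definable A' R"
proof -
  obtain \<phi> f where 1: "formula_of L \<phi>" "\<And>i. i \<in> free_vars \<phi> \<Longrightarrow> f i \<in> atoms A"
    "\<And>s. R s \<longleftrightarrow> sat M (\<lambda>i. case_sum s id (f i)) \<phi>" using assms(1) by (rule definableE) (rule that)
  show ?thesis
    by (rule definableI[OF 1(1) _ 1(3)]) (use 1(2) assms(2) atoms_mono in blast)
qed

lemma definable_depends_on_finite:
  assumes "definable A R"
  obtains V where "finite V" "depends_on R V"
proof -
  obtain \<phi> f where \<phi>: "\<And>s. R s \<longleftrightarrow> sat M (\<lambda>i. case_sum s id (f i)) \<phi>"
    using assms by (rule definableE) (rule that)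
  have "depends_on R {v. Inl v \<in> f ` free_vars \<phi>}"
    unfolding depends_on_def \<phi>
  proof (intro allI impI sat_cong)
    fix s s' :: "'a \<Rightarrow> 'm" and i
    assume "\<forall>v\<in>{v. Inl v \<in> f ` free_vars \<phi>}. s v = s' v" "i \<in> free_vars \<phi>"
    then show "case_sum s id (f i) = case_sum s' id (f i)"
      by (cases "f i") (auto intro!: image_eqI[of _ f i])
  qed
  moreover have "finite (Inl -` (f ` free_vars \<phi>))"
    by (intro finite_vimageI) (auto simp: finite_free_vars)
  ultimately show ?thesis using that by (auto simp: vimage_def)
qed

lemma definable_Not: "definable A R \<Longrightarrow> definable A (\<lambda>s. \<not> R s)"
  by (elim definableE, rule definableI[of "Neg _"]) auto

text \<open>
  The two formulas use different translations of their variables. Moving their variables to even and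
  odd numbers makes room for both.
\<close>

lemma definable_conj:
  assumes "definable A R" "definable A S"
  shows "definable A (\<lambda>s. R s \<and> S s)"
proof -
  obtain \<phi> f where 1: "formula_of L \<phi>" "\<And>i. i \<in> free_vars \<phi> \<Longrightarrow> f i \<in> atoms A"
    "\<And>s. R s \<longleftrightarrow> sat M (\<lambda>i. case_sum s id (f i)) \<phi>" using assms(1) by (rule definableE) (rule that)
  obtain \<psi> g where 2: "formula_of L \<psi>" "\<And>i. i \<in> free_vars \<psi> \<Longrightarrow> g i \<in> atoms A"
    "\<And>s. S s \<longleftrightarrow> sat M (\<lambda>i. case_sum s id (g i)) \<psi>" using assms(2) by (rule definableE) (rule that)
  show ?thesis
    by (rule definableI[of "Conj (rename \<phi> (\<lambda>i. 2 * i)) (rename \<psi> (\<lambda>i. Suc (2 * i)))"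
          "\<lambda>i. if even i then f (i div 2) else g (i div 2)"])
      (use 1 2 in \<open>auto simp: rename o_def\<close>)
qed

lemma definable_subst_params:
  assumes "definable A R" "\<And>v. h v \<in> atoms A"
  shows "definable A (\<lambda>s. R (\<lambda>v. case_sum s id (h v)))"
proof -
  obtain \<phi> f where 1: "formula_of L \<phi>" "\<And>i. i \<in> free_vars \<phi> \<Longrightarrow> f i \<in> atoms A"
    "\<And>s. R s \<longleftrightarrow> sat M (\<lambda>i. case_sum s id (f i)) \<phi>" using assms(1) by (rule definableE) (rule that)
  show ?thesis
  proof (rule definableI[of \<phi> "\<lambda>i. case_sum h Inr (f i)"])
    show "case_sum h Inr (f i) \<in> atoms A" if "i \<in> free_vars \<phi>" for i
      using 1(2)[OF that] assms(2) by (auto split: sum.splits)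
    show "R (\<lambda>v. case_sum s id (h v)) = sat M (\<lambda>i. case_sum s id (case_sum h Inr (f i))) \<phi>" for s
      unfolding 1(3) by (intro sat_cong) (auto split: sum.splits)
  qed (rule 1)
qed

lemma definable_subst: "definable A R \<Longrightarrow> definable A (\<lambda>s. R (\<lambda>v. s (h v)))"
  using definable_subst_params[of A R "\<lambda>v. Inl (h v)"] by simp

lemma definable_const: "definable A (\<lambda>s. b)"
proof (cases b)
  case True
  then show ?thesis
    by (intro definableI[of "Neg (Exists 0 (Neg (Equal (Var 0) (Var 0))))"]) auto
next
  case False
  then show ?thesis
    by (intro definableI[of "Exists 0 (Neg (Equal (Var 0) (Var 0)))"]) auto
qed

lemma definable_ex1:
  assumes "definable A R"
  shows "definable A (\<lambda>s. \<exists>m. R (s(v := m)))"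
proof -
  obtain \<phi> f where 1: "formula_of L \<phi>" "\<And>i. i \<in> free_vars \<phi> \<Longrightarrow> f i \<in> atoms A"
    "\<And>s. R s \<longleftrightarrow> sat M (\<lambda>i. case_sum s id (f i)) \<phi>" using assms(1) by (rule definableE) (rule that)
  define g where "g i = (if f i = Inl v then 0 else Suc i)" for i
  show ?thesis
  proof (rule definableI[of "Exists 0 (rename \<phi> g)" "\<lambda>i. f (i - 1)"])
    show "f (i - 1) \<in> atoms A" if "i \<in> free_vars (Exists 0 (rename \<phi> g))" for i
      using that 1(2) by (auto simp: rename g_def split: if_splits)
    show "(\<exists>m. R (s(v := m))) = sat M (\<lambda>i. case_sum s id (f (i - 1))) (Exists 0 (rename \<phi> g))" for s
      unfolding 1(3) sat.simps rename
      by (intro ex_cong1 sat_cong) (auto simp: g_def split: sum.splits)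
  qed (use 1 in \<open>auto simp: rename\<close>)
qed

lemma definable_ex_override:
  assumes "finite W" "definable A R"
  shows "definable A (\<lambda>s. \<exists>y. R (override_on s y W))"
  using assms(1)
proof induction
  case empty
  then show ?case using assms(2) by simp
next
  case (insert w W)
  have *: "definable A (\<lambda>s. \<exists>m. \<exists>y. R (override_on (s(w := m)) y W))"
    using definable_ex1[OF insert.IH] .
  have "(\<exists>m. \<exists>y. R (override_on (s(w := m)) y W)) = (\<exists>y. R (override_on s y (insert w W)))" for s
  proof (intro iffI; elim exE)
    fix m y assume "R (override_on (s(w := m)) y W)"
    moreover have "override_on (s(w := m)) y W = override_on s (y(w := m)) (insert w W)"
      using insert.hyps by (auto simp: override_on_def)
    ultimately show "\<exists>y. R (override_on s y (insert w W))" by metis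
  next
    fix y assume "R (override_on s y (insert w W))"
    moreover have "override_on s y (insert w W) = override_on (s(w := y w)) y W"
      by (auto simp: override_on_def)
    ultimately show "\<exists>m. \<exists>y. R (override_on (s(w := m)) y W)" by metis
  qed
  then show ?case using * by simp
qed

text \<open>
  A function on an infinite type is quantified here, but only finitely many of its values matter. It
  serves as the quantifier over tuples.
\<close>

lemma definable_ex:
  fixes R :: "('v \<Rightarrow> 'm) \<Rightarrow> ('w \<Rightarrow> 'm) \<Rightarrow> bool"
  assumes "definable A (\<lambda>z. R (\<lambda>v. z (Inl v)) (\<lambda>w. z (Inr w)))"
  shows "definable A (\<lambda>s. \<exists>y. R s y)"
proof -
  define Q where "Q = (\<lambda>z :: 'v + 'w \<Rightarrow> 'm. R (\<lambda>v. z (Inl v)) (\<lambda>w. z (Inr w)))"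
  obtain V where V: "finite V" "depends_on Q V"
    using assms unfolding Q_def[symmetric] by (elim definable_depends_on_finite)
  define W where "W = V \<inter> range Inr"
  define h :: "'v + 'w \<Rightarrow> 'v" where "h = case_sum id (\<lambda>_. undefined)"
  have *: "definable A (\<lambda>s. \<exists>y. Q (override_on (\<lambda>v. s (h v)) y W))"
    using definable_subst[OF definable_ex_override[of W A Q], of h] assms V
    by (simp add: Q_def W_def)
  have "(\<exists>y. Q (override_on (\<lambda>v. s (h v)) y W)) = (\<exists>y. R s y)" for s
  proof (intro iffI; elim exE)
    fix y assume "Q (override_on (\<lambda>v. s (h v)) y W)"
    moreover have "(\<lambda>v. override_on (\<lambda>v. s (h v)) y W (Inl v)) = s"
      by (auto simp: override_on_def W_def h_def)
    ultimately show "\<exists>y. R s y" unfolding Q_def by auto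
  next
    fix y assume "R s y"
    then have "Q (case_sum s y)" by (simp add: Q_def)
    also have "Q (case_sum s y) = Q (override_on (\<lambda>v. s (h v)) (case_sum s y) W)"
      by (rule depends_onD[OF V(2)]) (auto simp: override_on_def W_def h_def split: sum.splits)
    finally show "\<exists>y. Q (override_on (\<lambda>v. s (h v)) y W)" by blast
  qed
  then show ?thesis using * by simp
qed

lemma definable_imp:
  "definable A R \<Longrightarrow> definable A S \<Longrightarrow> definable A (\<lambda>s. R s \<longrightarrow> S s)"
  using definable_Not[OF definable_conj[OF _ definable_Not, of A R S]] by simp

lemma definable_iff:
  "definable A R \<Longrightarrow> definable A S \<Longrightarrow> definable A (\<lambda>s. R s \<longleftrightarrow> S s)"
  using definable_conj[OF definable_imp[of A R S] definable_imp[of A S R]]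
  by (simp add: iff_conv_conj_imp)

lemma definable_all:
  fixes R :: "('v \<Rightarrow> 'm) \<Rightarrow> ('w \<Rightarrow> 'm) \<Rightarrow> bool"
  assumes "definable A (\<lambda>z. R (\<lambda>v. z (Inl v)) (\<lambda>w. z (Inr w)))"
  shows "definable A (\<lambda>s. \<forall>y. R s y)"
  using definable_Not[OF definable_ex[of A "\<lambda>s y. \<not> R s y"]] definable_Not[OF assms] by simp

lemma definable_ball:
  assumes "finite I" "\<And>i. i \<in> I \<Longrightarrow> definable A (R i)"
  shows "definable A (\<lambda>s. \<forall>i\<in>I. R i s)"
  using assms by (induction) (auto intro: definable_conj definable_const)

lemma definable_all_less:
  "(\<And>i. i < k \<Longrightarrow> definable A (R i)) \<Longrightarrow> definable A (\<lambda>s. \<forall>i<k::nat. R i s)"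
  using definable_ball[of "{..<k}" A R] by (simp add: Ball_def)

definition definable_tuple :: "'m set \<Rightarrow> nat \<Rightarrow> (('v \<Rightarrow> 'm) \<Rightarrow> 'm list) \<Rightarrow> bool" where
  "definable_tuple A k xs \<longleftrightarrow>
     (\<exists>ts. length ts = k \<and> set ts \<subseteq> atoms A \<and> (\<forall>s. xs s = map (case_sum s id) ts))"

lemma definable_tuple_vars: "definable_tuple A (length ls) (\<lambda>s. map (\<lambda>l. s (h l)) ls)"
  unfolding definable_tuple_def by (intro exI[of _ "map (\<lambda>l. Inl (h l)) ls"]) auto

lemma definable_tuple_vars_upt: "definable_tuple A k (\<lambda>s. map (\<lambda>l. s (h l)) [0..<k])"
  using definable_tuple_vars[of A "[0..<k]"] by simp

lemma definable_tuple_const: "set d \<subseteq> A \<Longrightarrow> definable_tuple A (length d) (\<lambda>s. d)"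
  unfolding definable_tuple_def by (intro exI[of _ "map Inr d"]) (auto simp: comp_def)

lemma definable_tuple_const_len: "set d \<subseteq> A \<Longrightarrow> length d = k \<Longrightarrow> definable_tuple A k (\<lambda>s. d)"
  using definable_tuple_const by blast

lemma definable_tuple_append:
  assumes "definable_tuple A k xs" "definable_tuple A l ys"
  shows "definable_tuple A (k + l) (\<lambda>s. xs s @ ys s)"
proof -
  obtain ts us where
    "length ts = k" "set ts \<subseteq> atoms A" "\<And>s. xs s = map (case_sum s id) ts"
    "length us = l" "set us \<subseteq> atoms A" "\<And>s. ys s = map (case_sum s id) us"
    using assms unfolding definable_tuple_def by metis
  then show ?thesis unfolding definable_tuple_def by (intro exI[of _ "ts @ us"]) auto
qed

definition definable_on :: "'m set \<Rightarrow> nat \<Rightarrow> ('m list \<Rightarrow> bool) \<Rightarrow> bool" where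
  "definable_on A k R \<longleftrightarrow> definable A (\<lambda>s :: nat \<Rightarrow> 'm. R (map s [0..<k]))"

lemma definable_on_tuple:
  assumes "definable_on A k R" "definable_tuple A k xs"
  shows "definable A (\<lambda>s. R (xs s))"
proof -
  obtain ts where ts: "length ts = k" "set ts \<subseteq> atoms A"
    "\<And>s. xs s = map (case_sum s id) ts"
    using assms(2) unfolding definable_tuple_def by metis
  have "definable A (\<lambda>s. R (map (\<lambda>i. case_sum s id (if i < k then ts ! i else Inl undefined)) [0..<k]))"
    using assms(1) unfolding definable_on_def
    by (rule definable_subst_params) (use ts in \<open>auto dest!: nth_mem\<close>)
  moreover have "map (\<lambda>i. case_sum s id (if i < k then ts ! i else Inl undefined)) [0..<k] = xs s" for s
    by (auto simp: ts intro!: nth_equalityI simp flip: ts(1))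
  ultimately show ?thesis by simp
qed

lemma definable_onI:
  "(\<And>h. definable A (\<lambda>s :: nat \<Rightarrow> 'm. R (map (\<lambda>l. s (h l)) [0..<k]))) \<Longrightarrow> definable_on A k R"
  unfolding definable_on_def by (drule meta_spec[of _ id]) simp

lemma definable_on_mono: "definable_on A k R \<Longrightarrow> A \<subseteq> A' \<Longrightarrow> definable_on A' k R"
  unfolding definable_on_def by (rule definable_mono)

lemma definable_on_holds:
  assumes "pformula_over L k A \<psi>"
  shows "definable_on A k (\<lambda>xs. holds M (fst \<psi>) (xs @ snd \<psi>))"
  unfolding definable_on_def
proof (rule definableI[of "fst \<psi>" "\<lambda>i. if i < k then Inl i else Inr (snd \<psi> ! (i - k))"])
  show "formula_of L (fst \<psi>)" using assms by (simp add: pformula_over_def)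
  show "(if i < k then Inl i else Inr (snd \<psi> ! (i - k))) \<in> atoms A"
    if "i \<in> free_vars (fst \<psi>)" for i
  proof (cases "i < k")
    case False
    then have "snd \<psi> ! (i - k) \<in> set (snd \<psi>)"
      using that assms by (intro nth_mem) (auto simp: pformula_over_def)
    then show ?thesis using False assms by (auto simp: pformula_over_def)
  qed simp
  show "holds M (fst \<psi>) (map s [0..<k] @ snd \<psi>) =
      sat M (\<lambda>i. case_sum s id (if i < k then Inl i else Inr (snd \<psi> ! (i - k)))) (fst \<psi>)" for s
    unfolding holds_def by (intro sat_cong) (auto simp: nth_append)
qed

lemma definable_on_eq: "definable_on A (k + k) (\<lambda>xs. take k xs = drop k xs)"
proof -
  have "definable A (\<lambda>s :: nat \<Rightarrow> 'm. s i = s j)" for i j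
    by (rule definableI[of "Equal (Var 0) (Var 1)" "\<lambda>l. Inl (if l = 0 then i else j)"]) auto
  then have "definable A (\<lambda>s :: nat \<Rightarrow> 'm. \<forall>i<k. s i = s (k + i))"
    by (intro definable_all_less)
  moreover have "(take k (map s [0..<k + k]) = drop k (map s [0..<k + k])) = (\<forall>i<k. s i = s (k + i))"
    for s :: "nat \<Rightarrow> 'm"
    by (auto simp: list_eq_iff_nth_eq)
  ultimately show ?thesis unfolding definable_on_def by simp
qed

lemma definable_eq_tuple:
  assumes "definable_tuple A k xs" "definable_tuple A k ys"
  shows "definable A (\<lambda>s. xs s = ys s)"
proof -
  have "length (xs s) = k" "length (ys s) = k" for s
    using assms unfolding definable_tuple_def by auto
  then show ?thesis
    using definable_on_tuple[OF definable_on_eq definable_tuple_append[OF assms]] by simp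
qed

text \<open>
  The way back from predicates to formulas. The parameters \<open>d\<close> are placed between two groups of
  variables because the configurations in the definition of strongly$^2$ dependent theories end with
  the tuples \<open>b\<^sub>i\<close>, which are variables from this point of view.
\<close>

lemma definable_formula:
  fixes R :: "('v \<Rightarrow> 'm) \<Rightarrow> bool"
  assumes "definable A R" "depends_on R (set vs \<union> set ws)"
  obtains \<phi> d where "set d \<subseteq> A" "formula_of L \<phi>"
    "free_vars \<phi> \<subseteq> {..<length vs + length d + length ws}"
    "\<And>s. holds M \<phi> (map s vs @ d @ map s ws) \<longleftrightarrow> R s"
proof -
  obtain \<phi> f where 1: "formula_of L \<phi>" "\<And>i. i \<in> free_vars \<phi> \<Longrightarrow> f i \<in> atoms A"
    "\<And>s. R s \<longleftrightarrow> sat M (\<lambda>i. case_sum s id (f i)) \<phi>" using assms(1) by (rule definableE) (rule that)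
  have "finite (Inr -` (f ` free_vars \<phi>))"
    by (intro finite_vimageI) (auto simp: finite_free_vars)
  then obtain d where d: "set d = Inr -` (f ` free_vars \<phi>)" by (metis finite_list)
  have dA: "set d \<subseteq> A"
  proof
    fix m assume "m \<in> set d"
    then obtain i where "i \<in> free_vars \<phi>" "Inr m = f i" by (auto simp: d)
    then show "m \<in> A" using 1(2)[of i] by (metis atoms_simps(2))
  qed
  define K where "K = length vs + length d + length ws"
  define xs where "xs s = map s vs @ d @ map s ws" for s
  define W where "W = Inl ` (set vs \<union> set ws) \<union> range (Inr :: 'm \<Rightarrow> 'v + 'm)"
  have "\<exists>j. (j < K \<and> (\<forall>s. xs s ! j = case_sum s id (f i)) \<and> f i \<in> W) \<or>
      (j = K \<and> (\<exists>v. f i = Inl v \<and> v \<notin> set vs \<union> set ws))" if i: "i \<in> free_vars \<phi>" for i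
  proof (cases "f i")
    case (Inl v)
    consider j where "j < length vs" "vs ! j = v" | j where "j < length ws" "ws ! j = v"
      | "v \<notin> set vs \<union> set ws" by (auto simp: in_set_conv_nth)
    then show ?thesis
    proof cases
      case (1 j)
      then have "j < K \<and> (\<forall>s. xs s ! j = case_sum s id (f i)) \<and> f i \<in> W"
        by (auto simp: W_def Inl xs_def nth_append K_def)
      then show ?thesis by blast
    next
      case (2 j)
      then have "length vs + length d + j < K \<and>
          (\<forall>s. xs s ! (length vs + length d + j) = case_sum s id (f i)) \<and> f i \<in> W"
        by (auto simp: W_def Inl xs_def nth_append K_def)
      then show ?thesis by blast
    qed (use Inl in blast)
  next
    case (Inr m)
    then have "m \<in> set d" using i by (metis d imageI vimageI)
    then obtain j where "j < length d" "d ! j = m" by (auto simp: in_set_conv_nth)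
    then have "length vs + j < K \<and> (\<forall>s. xs s ! (length vs + j) = case_sum s id (f i)) \<and> f i \<in> W"
      by (auto simp: W_def Inr xs_def nth_append K_def)
    then show ?thesis by blast
  qed
  then obtain g where g: "\<And>i. i \<in> free_vars \<phi> \<Longrightarrow>
      (g i < K \<and> (\<forall>s. xs s ! g i = case_sum s id (f i)) \<and> f i \<in> W) \<or>
      (g i = K \<and> (\<exists>v. f i = Inl v \<and> v \<notin> set vs \<union> set ws))" by metis
  \<comment> \<open>All variables on which \<open>R\<close> does not depend are sent to \<open>K\<close> and quantified away, so that no free
    variable is left over even if there are no variables and no parameters at all.\<close>
  define \<psi> where "\<psi> = Exists K (rename \<phi> g)"
  have "free_vars \<psi> \<subseteq> {..<K}"
  proof
    fix x assume "x \<in> free_vars \<psi>"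
    then obtain i where "i \<in> free_vars \<phi>" "x = g i" "x \<noteq> K" by (auto simp: \<psi>_def rename)
    then show "x \<in> {..<K}" using g[of i] by auto
  qed
  moreover have "holds M \<psi> (xs s) \<longleftrightarrow> R s" for s
  proof -
    let ?xs = "xs s"
    have "sat M (((!) ?xs)(K := m) \<circ> g) \<phi> = R (\<lambda>v. if v \<in> set vs \<union> set ws then s v else m)" for m
      unfolding 1(3)
    proof (intro sat_cong)
      fix i assume i: "i \<in> free_vars \<phi>"
      show "(((!) ?xs)(K := m) \<circ> g) i =
        case_sum (\<lambda>v. if v \<in> set vs \<union> set ws then s v else m) id (f i)"
        using g[OF i]
      proof (elim disjE conjE exE)
        assume "g i < K" "\<forall>s. xs s ! g i = case_sum s id (f i)" "f i \<in> W"
        then have "(((!) ?xs)(K := m) \<circ> g) i = case_sum s id (f i)" by simp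
        also have "\<dots> = case_sum (\<lambda>v. if v \<in> set vs \<union> set ws then s v else m) id (f i)"
        proof (cases "f i")
          case (Inl v)
          then have "v \<in> set vs \<union> set ws" using \<open>f i \<in> W\<close> by (auto simp: W_def)
          then show ?thesis by (simp add: Inl)
        qed simp
        finally show ?thesis .
      qed simp
    qed
    also have "R (\<lambda>v. if v \<in> set vs \<union> set ws then s v else m) = R s" for m
      by (rule depends_onD[OF assms(2)]) auto
    finally show ?thesis by (simp add: holds_def \<psi>_def rename)
  qed
  moreover have "formula_of L \<psi>" using 1 by (simp add: \<psi>_def rename)
  ultimately show ?thesis using that[OF dA] by (simp add: K_def xs_def)
qed

end

section \<open>Saturation and compactness\<close>

lemma small_Un_countable:
  fixes A C :: "'m set"
  assumes unc: "uncountable (UNIV :: 'm set)" and "small A" "countable C"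
  shows "small (A \<union> C)"
proof -
  have less: "B \<prec> (UNIV :: 'm set) \<longleftrightarrow> \<not> (UNIV :: 'm set) \<lesssim> B" for B :: "'m set"
    by (metis eqpoll_imp_lepoll eqpoll_sym lepoll_antisym lesspoll_def subset_UNIV subset_imp_lepoll)
  have ord: "(\<not> (UNIV :: 'm set) \<lesssim> B) = ((card_of B, card_of (UNIV :: 'm set)) \<in> ordLess)"
    for B :: "'m set"
    unfolding lepoll_def card_of_ordLess ..
  have "\<not> (UNIV :: 'm set) \<lesssim> C"
    using assms by (metis countable_lepoll)
  then show ?thesis
    using assms card_of_Un_ordLess_infinite[of "UNIV :: 'm set" A C]
    by (auto simp: small_def less ord dest: countable_finite)
qed

locale monster = fo_structure L M
  for L :: "('f, 'r) language" and M :: "('f, 'r, 'm) fo_struct" +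
  assumes saturated: "saturated L M" and uncountable: "uncountable (UNIV :: 'm set)"
begin

lemma small_Un: "small (A :: 'm set) \<Longrightarrow> countable C \<Longrightarrow> small (A \<union> C)"
  by (rule small_Un_countable[OF uncountable])

text \<open>
  The value of the next variable realises the 1-type saying that every finite part of \<open>\<Gamma>\<close> can still
  be satisfied by a choice of the remaining variables.
\<close>

lemma saturation_step:
  fixes \<Gamma> :: "((nat \<Rightarrow> 'm) \<Rightarrow> bool) set" and s :: "nat \<Rightarrow> 'm"
  assumes A: "small A" and \<Gamma>: "\<And>R. R \<in> \<Gamma> \<Longrightarrow> definable A R"
    and fin: "\<And>\<Delta>. finite \<Delta> \<Longrightarrow> \<Delta> \<subseteq> \<Gamma> \<Longrightarrow> \<exists>s'. (\<forall>i<k. s' i = s i) \<and> (\<forall>R\<in>\<Delta>. R s')"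
  shows "\<exists>m. \<forall>\<Delta>. finite \<Delta> \<longrightarrow> \<Delta> \<subseteq> \<Gamma> \<longrightarrow>
    (\<exists>s'. (\<forall>i<k. s' i = s i) \<and> s' k = m \<and> (\<forall>R\<in>\<Delta>. R s'))"
proof -
  define A' where "A' = A \<union> s ` {..<k}"
  define h :: "nat \<Rightarrow> (nat + nat) + 'm" where
    "h i = (if i < k then Inr (s i) else if i = k then Inl (Inl 0) else Inl (Inr i))" for i
  define Q where "Q \<Delta> z \<longleftrightarrow> (\<exists>y. \<forall>R\<in>\<Delta>. R (\<lambda>i. case_sum (case_sum z y) id (h i)))"
    for \<Delta> :: "((nat \<Rightarrow> 'm) \<Rightarrow> bool) set" and z :: "nat \<Rightarrow> 'm"
  have Q: "Q \<Delta> z \<longleftrightarrow> (\<exists>s'. (\<forall>i<k. s' i = s i) \<and> s' k = z 0 \<and> (\<forall>R\<in>\<Delta>. R s'))" for \<Delta> z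
  proof
    assume "Q \<Delta> z"
    then obtain y where "\<forall>R\<in>\<Delta>. R (\<lambda>i. case_sum (case_sum z y) id (h i))" by (auto simp: Q_def)
    then show "\<exists>s'. (\<forall>i<k. s' i = s i) \<and> s' k = z 0 \<and> (\<forall>R\<in>\<Delta>. R s')"
      by (intro exI[of _ "\<lambda>i. case_sum (case_sum z y) id (h i)"]) (auto simp: h_def)
  next
    assume "\<exists>s'. (\<forall>i<k. s' i = s i) \<and> s' k = z 0 \<and> (\<forall>R\<in>\<Delta>. R s')"
    then obtain s' where s': "\<forall>i<k. s' i = s i" "s' k = z 0" "\<forall>R\<in>\<Delta>. R s'" by blast
    then have "(\<lambda>i. case_sum (case_sum z s') id (h i)) = s'" by (auto simp: h_def fun_eq_iff)
    then show "Q \<Delta> z" using s'(3) by (auto simp: Q_def intro!: exI[of _ s'])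
  qed
  have def_Q: "definable A' (Q \<Delta>)" if "finite \<Delta>" "\<Delta> \<subseteq> \<Gamma>" for \<Delta>
    unfolding Q_def
  proof (intro definable_ex definable_ball)
    fix R assume "R \<in> \<Delta>"
    then have "definable A' R" using \<Gamma> that by (auto intro: definable_mono simp: A'_def)
    then have "definable A' (\<lambda>z. R (\<lambda>i. case_sum z id (h i)))"
      by (rule definable_subst_params) (auto simp: h_def A'_def)
    moreover have eta: "case_sum (\<lambda>v. z (Inl v)) (\<lambda>w. z (Inr w)) = z" for z :: "nat + nat \<Rightarrow> 'm"
      by (auto simp: fun_eq_iff split: sum.splits)
    ultimately show "definable A'
      (\<lambda>z. R (\<lambda>i. case_sum (case_sum (\<lambda>v. z (Inl v)) (\<lambda>w. z (Inr w))) id (h i)))" unfolding eta by blast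
  qed (use that in auto)
  define realized where
    "realized \<Delta> \<psi> \<longleftrightarrow> pformula_over L 1 A' \<psi> \<and> (\<forall>m. holds M (fst \<psi>) ([m] @ snd \<psi>) \<longleftrightarrow> Q \<Delta> (\<lambda>_. m))"
    for \<Delta> and \<psi> :: "('f, 'r, 'm) pformula"
  have "\<exists>\<psi>. realized \<Delta> \<psi>" if \<Delta>: "finite \<Delta> \<and> \<Delta> \<subseteq> \<Gamma>" for \<Delta>
  proof -
    have "depends_on (Q \<Delta>) (set [0] \<union> set [])"
      unfolding depends_on_def Q by simp
    then obtain \<phi> d where \<phi>: "set d \<subseteq> A'" "formula_of L \<phi>"
      "free_vars \<phi> \<subseteq> {..<length [0 :: nat] + length d + length ([] :: nat list)}"
      "\<And>z. holds M \<phi> (map z [0] @ d @ map z []) \<longleftrightarrow> Q \<Delta> z"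
      using \<Delta> by (elim definable_formula[OF def_Q, rotated 2]) auto
    have "holds M \<phi> ([m] @ d) \<longleftrightarrow> Q \<Delta> (\<lambda>_. m)" for m
      using \<phi>(4)[of "\<lambda>_. m"] by simp
    then have "realized \<Delta> (\<phi>, d)"
      using \<phi>(1-3) by (simp add: realized_def pformula_over_def)
    then show ?thesis by blast
  qed
  then obtain F where "\<forall>\<Delta>. finite \<Delta> \<and> \<Delta> \<subseteq> \<Gamma> \<longrightarrow> realized \<Delta> (F \<Delta>)" by metis
  then have F: "\<And>\<Delta>. finite \<Delta> \<Longrightarrow> \<Delta> \<subseteq> \<Gamma> \<Longrightarrow> pformula_over L 1 A' (F \<Delta>)"
    "\<And>\<Delta> m. finite \<Delta> \<Longrightarrow> \<Delta> \<subseteq> \<Gamma> \<Longrightarrow> holds M (fst (F \<Delta>)) ([m] @ snd (F \<Delta>)) \<longleftrightarrow> Q \<Delta> (\<lambda>_. m)"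
    unfolding realized_def by simp_all
  define p where "p = F ` {\<Delta>. finite \<Delta> \<and> \<Delta> \<subseteq> \<Gamma>}"
  have "small A'" unfolding A'_def by (intro small_Un A) auto
  moreover have "type_over L 1 A' p" using F(1) by (auto simp: type_over_def p_def)
  moreover have "consistent M 1 p"
    unfolding consistent_def
  proof (intro allI impI)
    fix q assume "q \<subseteq> p" "finite q"
    then obtain \<D> where \<D>: "finite \<D>" "q = F ` \<D>" "\<D> \<subseteq> {\<Delta>. finite \<Delta> \<and> \<Delta> \<subseteq> \<Gamma>}"
      unfolding p_def by (meson finite_subset_image)
    then have "finite (\<Union>\<D>)" "\<Union>\<D> \<subseteq> \<Gamma>" by auto
    from fin[OF this] obtain s' where s': "\<forall>i<k. s' i = s i" "\<forall>R\<in>\<Union>\<D>. R s'" by blast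
    have "holds M (fst (F \<Delta>)) ([s' k] @ snd (F \<Delta>))" if "\<Delta> \<in> \<D>" for \<Delta>
      using that \<D>(3) s' by (subst F(2)) (auto simp: Q intro!: exI[of _ s'])
    then have "[s' k] \<in> solutions M 1 q" using \<D>(2) by (auto simp: solutions_def split_beta)
    then show "solutions M 1 q \<noteq> {}" by blast
  qed
  ultimately obtain xs where "xs \<in> solutions M 1 p"
    using saturated unfolding saturated_def by blast
  then obtain m where m: "[m] \<in> solutions M 1 p"
    by (auto simp: solutions_def length_Suc_conv)
  show ?thesis
  proof (intro exI[of _ m] allI impI)
    fix \<Delta> assume \<Delta>: "finite \<Delta>" "\<Delta> \<subseteq> \<Gamma>"
    then have "holds M (fst (F \<Delta>)) ([m] @ snd (F \<Delta>))"
      using m by (auto simp: solutions_def p_def split_beta)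
    then show "\<exists>s'. (\<forall>i<k. s' i = s i) \<and> s' k = m \<and> (\<forall>R\<in>\<Delta>. R s')"
      unfolding F(2)[OF \<Delta>] Q .
  qed
qed

text \<open>
  Saturation is about types in one variable; countably many variables are treated one after the
  other. The limit assignment satisfies each relation in \<open>\<Gamma>\<close> because it depends on an initial
  segment of the variables.
\<close>

lemma compactness_nat:
  fixes \<Gamma> :: "((nat \<Rightarrow> 'm) \<Rightarrow> bool) set"
  assumes A: "small A" and \<Gamma>: "\<And>R. R \<in> \<Gamma> \<Longrightarrow> definable A R"
    and fin: "\<And>\<Delta>. finite \<Delta> \<Longrightarrow> \<Delta> \<subseteq> \<Gamma> \<Longrightarrow> \<exists>s. \<forall>R\<in>\<Delta>. R s"
  shows "\<exists>s. \<forall>R\<in>\<Gamma>. R s"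
proof -
  define good where "good k s \<longleftrightarrow>
    (\<forall>\<Delta>. finite \<Delta> \<longrightarrow> \<Delta> \<subseteq> \<Gamma> \<longrightarrow> (\<exists>s'. (\<forall>i<k. s' i = s i) \<and> (\<forall>R\<in>\<Delta>. R s')))"
    for k :: nat and s
  have step: "\<exists>s'. good (Suc k) s' \<and> (\<forall>i<k. s' i = s i)" if "good k s" for k s
  proof -
    have "\<exists>s'. (\<forall>i<k. s' i = s i) \<and> (\<forall>R\<in>\<Delta>. R s')" if "finite \<Delta>" "\<Delta> \<subseteq> \<Gamma>" for \<Delta>
      using \<open>good k s\<close> that unfolding good_def by simp
    from saturation_step[OF A \<Gamma> this] obtain m where m: "\<forall>\<Delta>. finite \<Delta> \<longrightarrow> \<Delta> \<subseteq> \<Gamma> \<longrightarrow>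
        (\<exists>s'. (\<forall>i<k. s' i = s i) \<and> s' k = m \<and> (\<forall>R\<in>\<Delta>. R s'))" by (rule exE)
    have "good (Suc k) (s(k := m))"
      unfolding good_def
    proof (intro allI impI)
      fix \<Delta> assume "finite \<Delta>" "\<Delta> \<subseteq> \<Gamma>"
      then obtain s' where "\<forall>i<k. s' i = s i" "s' k = m" "\<forall>R\<in>\<Delta>. R s'"
        using m[rule_format, of \<Delta>] by auto
      then show "\<exists>s'. (\<forall>i<Suc k. s' i = (s(k := m)) i) \<and> (\<forall>R\<in>\<Delta>. R s')"
        by (intro exI[of _ s']) (auto simp: less_Suc_eq)
    qed
    then show ?thesis by (intro exI[of _ "s(k := m)"]) auto
  qed
  have "\<exists>f. \<forall>k. good k (f k) \<and> (\<forall>i<k. f (Suc k) i = f k i)"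
  proof (rule dependent_nat_choice)
    show "\<exists>s. good 0 s" using fin by (simp add: good_def)
  qed (rule step)
  then obtain f where f: "\<And>k. good k (f k)" "\<And>k i. i < k \<Longrightarrow> f (Suc k) i = f k i" by blast
  define s where "s k = f (Suc k) k" for k
  have s: "i < k \<Longrightarrow> s i = f k i" for i k
    by (induction k) (auto simp: s_def less_Suc_eq f(2))
  show ?thesis
  proof (intro exI[of _ s] ballI)
    fix R assume R: "R \<in> \<Gamma>"
    obtain V where V: "finite V" "depends_on R V"
      using \<Gamma>[OF R] by (elim definable_depends_on_finite)
    then obtain k where k: "V \<subseteq> {..<k}" by (meson finite_nat_iff_bounded)
    obtain s' where "\<forall>i<k. s' i = f k i" "R s'"
      using f(1)[of k, unfolded good_def, rule_format, of "{R}"] R by auto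
    moreover have "R s = R s'"
      using k s calculation(1) by (intro depends_onD[OF V(2)]) auto
    ultimately show "R s" by simp
  qed
qed

lemma compactness:
  fixes \<Gamma> :: "(('v :: countable \<Rightarrow> 'm) \<Rightarrow> bool) set"
  assumes A: "small A" and \<Gamma>: "\<And>R. R \<in> \<Gamma> \<Longrightarrow> definable A R"
    and fin: "\<And>\<Delta>. finite \<Delta> \<Longrightarrow> \<Delta> \<subseteq> \<Gamma> \<Longrightarrow> \<exists>s. \<forall>R\<in>\<Delta>. R s"
  obtains s where "\<And>R. R \<in> \<Gamma> \<Longrightarrow> R s"
proof -
  define T :: "(('v \<Rightarrow> 'm) \<Rightarrow> bool) \<Rightarrow> (nat \<Rightarrow> 'm) \<Rightarrow> bool"
    where "T R s = R (\<lambda>v. s (to_nat v))" for R s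
  have "\<exists>s. \<forall>R\<in>T ` \<Gamma>. R s"
  proof (rule compactness_nat[OF A])
    show "definable A R" if "R \<in> T ` \<Gamma>" for R
    proof -
      obtain R' where R': "R = T R'" "R' \<in> \<Gamma>" using \<open>R \<in> T ` \<Gamma>\<close> by (rule imageE)
      show ?thesis unfolding R'(1) T_def by (rule definable_subst[OF \<Gamma>[OF R'(2)]])
    qed
    show "\<exists>s. \<forall>R\<in>\<Delta>. R s" if *: "finite \<Delta>" "\<Delta> \<subseteq> T ` \<Gamma>" for \<Delta>
    proof -
      obtain \<Delta>' where \<Delta>': "finite \<Delta>'" "\<Delta>' \<subseteq> \<Gamma>" "\<Delta> = T ` \<Delta>'"
        using finite_subset_image[OF *] by auto
      then obtain s where "\<forall>R\<in>\<Delta>'. R s" using fin[of \<Delta>'] by auto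
      then show ?thesis unfolding \<Delta>'(3) by (intro exI[of _ "\<lambda>n. s (from_nat n)"]) (auto simp: T_def)
    qed
  qed
  then show ?thesis using that by (auto simp: T_def)
qed

text \<open>
  The form in which compactness is applied: a contradiction with a directed family of conditions is
  already one with a single member.
\<close>

lemma compactness_directed:
  fixes Q :: "'i \<Rightarrow> ('v :: countable \<Rightarrow> 'm) \<Rightarrow> bool"
  assumes A: "small A" and R: "definable A R" and Q: "\<And>i. i \<in> I \<Longrightarrow> definable A (Q i)"
    and "I \<noteq> {}"
    and dir: "\<And>i j. i \<in> I \<Longrightarrow> j \<in> I \<Longrightarrow> \<exists>k\<in>I. \<forall>s. Q k s \<longrightarrow> Q i s \<and> Q j s"
    and unsat: "\<And>s. R s \<Longrightarrow> (\<And>i. i \<in> I \<Longrightarrow> Q i s) \<Longrightarrow> False"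
  shows "\<exists>i\<in>I. \<forall>s. R s \<longrightarrow> \<not> Q i s"
proof (rule ccontr)
  assume *: "\<not> (\<exists>i\<in>I. \<forall>s. R s \<longrightarrow> \<not> Q i s)"
  have bound: "\<exists>k\<in>I. \<forall>s. Q k s \<longrightarrow> (\<forall>i\<in>J. Q i s)" if "finite J" "J \<subseteq> I" for J
    using that
  proof induction
    case empty
    then show ?case using \<open>I \<noteq> {}\<close> by auto
  next
    case (insert j J)
    then obtain k where k: "k \<in> I" "\<forall>s. Q k s \<longrightarrow> (\<forall>i\<in>J. Q i s)" by auto
    then show ?case using dir[OF k(1), of j] insert.prems by (metis insert_iff subset_iff)
  qed
  have "\<exists>s. \<forall>S\<in>\<Delta>. S s" if \<Delta>: "finite \<Delta>" "\<Delta> \<subseteq> insert R (Q ` I)" for \<Delta>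
  proof -
    obtain J where J: "finite J" "J \<subseteq> I" "\<Delta> - {R} = Q ` J"
      using finite_subset_image[of "\<Delta> - {R}" Q I] \<Delta> by auto
    then obtain k where k: "k \<in> I" "\<forall>s. Q k s \<longrightarrow> (\<forall>i\<in>J. Q i s)" using bound by blast
    then obtain s where "R s" "Q k s" using * by blast
    moreover have "S = R \<or> (\<exists>j\<in>J. S = Q j)" if "S \<in> \<Delta>" for S
      using that J(3) by blast
    ultimately have "\<forall>S\<in>\<Delta>. S s" using k(2) by blast
    then show ?thesis by blast
  qed
  moreover have "definable A S" if "S \<in> insert R (Q ` I)" for S
    using that R Q by auto
  ultimately obtain s where s: "\<And>S. S \<in> insert R (Q ` I) \<Longrightarrow> S s"
    using compactness[OF A, of "insert R (Q ` I)"] by metis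
  show False
    by (rule unsat[of s]) (use s in auto)
qed

end

section \<open>Indiscernible sequences\<close>

lemma strict_mono_on_eq_of_image_eq:
  fixes f g :: "'a :: linorder \<Rightarrow> 'b :: linorder"
  assumes "finite F" "strict_mono_on F f" "strict_mono_on F g" "f ` F = g ` F" "x \<in> F"
  shows "f x = g x"
proof -
  let ?xs = "sorted_list_of_set F"
  have "sorted_wrt (<) (map h ?xs)" if "strict_mono_on F h" for h :: "'a \<Rightarrow> 'b"
    using that assms(1)
    by (auto simp: sorted_wrt_map strict_mono_on_def intro: sorted_wrt_mono_rel[OF _ strict_sorted_list_of_set])
  then have "map f ?xs = map g ?xs"
    using assms by (intro strict_sorted_equal) auto
  then show ?thesis using assms by simp
qed

lemma strict_mono_on_into_infinite_nat:
  fixes F :: "'a :: linorder set"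
  assumes "finite F" "infinite (Y :: nat set)"
  obtains g where "strict_mono_on F g" "g ` F \<subseteq> Y"
proof
  define g where "g x = enumerate Y (card {y \<in> F. y < x})" for x
  show "strict_mono_on F g"
  proof (rule strict_mono_onI)
    fix x y assume "x \<in> F" "y \<in> F" "x < y"
    then have "card {z \<in> F. z < x} < card {z \<in> F. z < y}"
      using assms(1) by (intro psubset_card_mono) auto
    then show "g x < g y" unfolding g_def by (intro enumerate_mono assms(2))
  qed
  show "g ` F \<subseteq> Y" using assms(2) by (auto simp: g_def enumerate_in_set)
qed

text \<open>
  All increasing copies of \<open>F\<close> in \<open>Y\<close> give the relation \<open>R\<close> the same truth value along \<open>r\<close>.
\<close>

definition homogeneous ::
  "(nat \<times> 'c \<Rightarrow> 'm) \<Rightarrow> nat set \<Rightarrow> 'i :: linorder set \<Rightarrow> (('i \<times> 'c \<Rightarrow> 'm) \<Rightarrow> bool) \<Rightarrow> bool" where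
  "homogeneous r Y F R \<longleftrightarrow> (\<forall>f g. strict_mono_on F f \<longrightarrow> f ` F \<subseteq> Y \<longrightarrow> strict_mono_on F g \<longrightarrow>
    g ` F \<subseteq> Y \<longrightarrow> R (r \<circ> map_prod f id) = R (r \<circ> map_prod g id))"

lemma homogeneousD:
  assumes "homogeneous r Y F R" "strict_mono_on F f" "f ` F \<subseteq> Y" "strict_mono_on F g" "g ` F \<subseteq> Y"
  shows "R (r \<circ> map_prod f id) = R (r \<circ> map_prod g id)"
  by (rule assms(1)[unfolded homogeneous_def, rule_format, OF assms(2-)])

lemma homogeneous_subset:
  assumes "homogeneous r Z F R" "Y \<subseteq> Z" shows "homogeneous r Y F R"
  unfolding homogeneous_def using assms(2)
  by (intro allI impI homogeneousD[OF assms(1)]) auto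

text \<open>
  An increasing copy of \<open>F\<close> is determined by its image, a set of size \<open>card F\<close>; colouring these sets
  by the truth value of \<open>R\<close> reduces the claim to Ramsey's theorem.
\<close>

lemma ramsey_relation:
  fixes F :: "'i :: linorder set" and r :: "nat \<times> 'c \<Rightarrow> 'm"
  assumes F: "finite F" and R: "depends_on R (F \<times> UNIV)" and Z: "infinite Z"
  shows "\<exists>Y\<subseteq>Z. infinite Y \<and> homogeneous r Y F R"
proof -
  define col where "col X = (if \<exists>g. strict_mono_on F g \<and> g ` F = X \<and> R (r \<circ> map_prod g id) then 1 else 0 :: nat)" for X
  have "\<forall>X. X \<subseteq> Z \<and> finite X \<and> card X = card F \<longrightarrow> col X < 2" by (simp add: col_def)
  then obtain Y c where Y: "Y \<subseteq> Z" "infinite Y"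
    and c: "\<And>X. X \<subseteq> Y \<Longrightarrow> finite X \<Longrightarrow> card X = card F \<Longrightarrow> col X = c"
    using Ramsey[OF Z, of "card F" col 2] by metis
  have col: "R (r \<circ> map_prod f id) \<longleftrightarrow> col (f ` F) = 1" if f: "strict_mono_on F f" for f
  proof
    assume "R (r \<circ> map_prod f id)" then show "col (f ` F) = 1" using f by (auto simp: col_def)
  next
    assume "col (f ` F) = 1"
    then obtain g where g: "strict_mono_on F g" "g ` F = f ` F" "R (r \<circ> map_prod g id)"
      by (auto simp: col_def split: if_splits)
    have "R (r \<circ> map_prod g id) = R (r \<circ> map_prod f id)"
      by (rule depends_onD[OF R]) (use strict_mono_on_eq_of_image_eq[OF F g(1) f g(2)] in auto)
    then show "R (r \<circ> map_prod f id)" using g(3) by simp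
  qed
  have "col (f ` F) = c" if "strict_mono_on F f" "f ` F \<subseteq> Y" for f
    using that F by (intro c) (auto intro!: card_image strict_mono_on_imp_inj_on)
  then have "homogeneous r Y F R" unfolding homogeneous_def using col by simp
  then show ?thesis using Y by auto
qed

lemma ramsey_relations:
  fixes F :: "'j \<Rightarrow> 'i :: linorder set" and r :: "nat \<times> 'c \<Rightarrow> 'm"
  assumes "finite J" "\<And>j. j \<in> J \<Longrightarrow> finite (F j)" "\<And>j. j \<in> J \<Longrightarrow> depends_on (R j) (F j \<times> UNIV)"
  shows "\<exists>Y. infinite Y \<and> (\<forall>j\<in>J. homogeneous r Y (F j) (R j))"
  using assms
proof (induction J)
  case empty
  then show ?case by (auto intro: infinite_UNIV_nat)
next
  case (insert i J)
  have "\<exists>Z. infinite Z \<and> (\<forall>j\<in>J. homogeneous r Z (F j) (R j))"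
    by (rule insert.IH) (use insert.prems in auto)
  then obtain Z where Z: "infinite Z" "\<forall>j\<in>J. homogeneous r Z (F j) (R j)"
    by (elim exE conjE)
  obtain Y where Y: "Y \<subseteq> Z" "infinite Y" "homogeneous r Y (F i) (R i)"
    using ramsey_relation[of "F i" "R i" Z r] insert.prems Z(1) by auto
  have "\<forall>j\<in>J. homogeneous r Y (F j) (R j)"
    by (intro ballI homogeneous_subset[OF Z(2)[rule_format] Y(1)])
  then show ?case using Y(2,3) by (intro exI[of _ Y]) simp
qed

context fo_structure
begin

text \<open>
  The sequence is indexed by an arbitrary linear order and its members are families indexed by \<open>'c\<close>,
  which may be infinite; only the coordinates in \<open>C\<close> are taken into account. A finite increasing map
  of indices replaces the pair of increasing index tuples.
\<close>

definition indisc :: "'m set \<Rightarrow> 'c set \<Rightarrow> ('i :: linorder \<times> 'c \<Rightarrow> 'm) \<Rightarrow> bool" where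
  "indisc A C t \<longleftrightarrow> (\<forall>R F h. definable A R \<longrightarrow> finite F \<longrightarrow> depends_on R (F \<times> C) \<longrightarrow>
     strict_mono_on F h \<longrightarrow> R (t \<circ> map_prod h id) = R t)"

lemma indiscD:
  "indisc A C t \<Longrightarrow> definable A R \<Longrightarrow> finite F \<Longrightarrow> depends_on R (F \<times> C) \<Longrightarrow> strict_mono_on F h \<Longrightarrow>
     R (t \<circ> map_prod h id) = R t"
  by (rule indisc_def[THEN iffD1, rule_format])

text \<open>
  \<open>t\<close> realises the Ehrenfeucht--Mostowski type of \<open>r\<close>: what holds along all increasing copies of an
  index pattern in \<open>r\<close> holds for \<open>t\<close>.
\<close>

definition em_type :: "'m set \<Rightarrow> (nat \<times> 'c \<Rightarrow> 'm) \<Rightarrow> ('i :: linorder \<times> 'c \<Rightarrow> 'm) \<Rightarrow> bool" where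
  "em_type A r t \<longleftrightarrow> (\<forall>R F. definable A R \<longrightarrow> finite F \<longrightarrow> depends_on R (F \<times> UNIV) \<longrightarrow>
     (\<forall>g. strict_mono_on F g \<longrightarrow> R (r \<circ> map_prod g id)) \<longrightarrow> R t)"

lemma em_typeD:
  assumes "em_type A r t" "definable A R" "finite F" "depends_on R (F \<times> UNIV)"
    "\<And>g. strict_mono_on F g \<Longrightarrow> R (r \<circ> map_prod g id)"
  shows "R t"
  by (rule assms(1)[unfolded em_type_def, rule_format, OF assms(2-4)]) (rule assms(5))

text \<open>
  Listing \<open>F\<close> in increasing order turns a definable relation on the rows in \<open>F\<close> into a formula
  about the concatenated tuple.
\<close>

lemma indisc_of_indiscernible:
  assumes ind: "indiscernible L M A a" and len: "\<And>i. length (a i) = m"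
  shows "indisc A {..<m} (\<lambda>(k, l). a k ! l)"
  unfolding indisc_def
proof (intro allI impI)
  fix R :: "(nat \<times> nat \<Rightarrow> 'm) \<Rightarrow> bool" and F and h :: "nat \<Rightarrow> nat"
  assume R: "definable A R" and F: "finite F" and dep: "depends_on R (F \<times> {..<m})" and h: "strict_mono_on F h"
  let ?t = "\<lambda>(k, l). a k ! l"
  define xs where "xs = sorted_list_of_set F"
  define vs where "vs = concat (map (\<lambda>k. map (Pair k) [0..<m]) xs)"
  have "set vs = F \<times> {..<m}" using F by (auto simp: vs_def xs_def)
  then have "depends_on R (set vs \<union> set [])" using dep by simp
  then obtain \<phi> d where \<phi>: "set d \<subseteq> A" "formula_of L \<phi>"
    "free_vars \<phi> \<subseteq> {..<length vs + length d + length ([] :: (nat \<times> nat) list)}"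
    "\<And>s. holds M \<phi> (map s vs @ d @ map s []) \<longleftrightarrow> R s"
    by (rule definable_formula[OF R]) (rule that)
  have map: "map (?t \<circ> map_prod g id) vs = concat (map a (map g xs))" for g
    by (auto simp: vs_def map_concat o_def len intro!: arg_cong[where f = concat] nth_equalityI)
  have len_concat: "length (concat (map a ys)) = m * length ys" for ys
    by (induction ys) (auto simp: len)
  have "length vs = m * length xs"
    unfolding vs_def by (induction xs) auto
  then have fv: "free_vars \<phi> \<subseteq> {..<length (concat (map a (map g xs)) @ d)}" for g
    using \<phi>(3) by (simp add: len_concat del: map_map)
  have sorted: "sorted_wrt (<) (map g xs)" if "strict_mono_on F g" for g :: "nat \<Rightarrow> nat"
    using that F unfolding xs_def
    by (auto simp: sorted_wrt_map strict_mono_on_def intro: sorted_wrt_mono_rel[OF _ strict_sorted_list_of_set])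
  have "R (?t \<circ> map_prod h id) \<longleftrightarrow> holds M \<phi> (concat (map a (map h xs)) @ d)"
    using \<phi>(4)[of "?t \<circ> map_prod h id"] unfolding map by simp
  also have "\<dots> \<longleftrightarrow> holds M \<phi> (concat (map a (map id xs)) @ d)"
  proof -
    have "sorted_wrt (<) (map id xs)" by (rule sorted) (simp add: strict_mono_on_def)
    then show ?thesis
      using ind \<phi>(1,2) fv[of h] sorted[OF h] unfolding indiscernible_def by (metis length_map)
  qed
  also have "\<dots> \<longleftrightarrow> R (?t \<circ> map_prod id id)"
    using \<phi>(4)[of "?t \<circ> map_prod id id"] unfolding map by simp
  finally show "R (?t \<circ> map_prod h id) = R ?t" by (simp add: map_prod.id)
qed

end

context monster
begin

text \<open>
  Finitely many of the required conditions concern finitely many indices. By Ramsey's theorem these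
  can be sent into a homogeneous set for \<open>r\<close>, where the conditions hold; compactness does the rest.
  The index set is dense, so it has room for an array of order type \<open>\<omega> \<times> \<omega>\<close> and for further
  entries before it.
\<close>

lemma extract_indiscernible:
  fixes r :: "nat \<times> 'c :: countable \<Rightarrow> 'm"
  assumes A: "small A"
  shows "\<exists>t :: rat \<times> 'c \<Rightarrow> 'm. indisc A UNIV t \<and> em_type A r t"
proof -
  define con where "con S F R h \<longleftrightarrow> finite F \<and> definable A R \<and> depends_on R (F \<times> UNIV) \<and> strict_mono_on F h \<and>
      (S = (\<lambda>s. R (s \<circ> map_prod h id) = R s) \<or> S = R \<and> (\<forall>g. strict_mono_on F g \<longrightarrow> R (r \<circ> map_prod g id)))"
    for S R :: "(rat \<times> 'c \<Rightarrow> 'm) \<Rightarrow> bool" and F :: "rat set" and h :: "rat \<Rightarrow> rat"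
  define \<Gamma> where "\<Gamma> = {S. \<exists>F R h. con S F R h}"
  have defS: "definable A S" if S: "S \<in> \<Gamma>" for S
  proof -
    obtain F R h where "con S F R h" using S unfolding \<Gamma>_def by auto
    moreover have "definable A (\<lambda>s. R (s \<circ> map_prod h id) = R s)" if "definable A R"
      using definable_subst[OF that, of "map_prod h id"] that unfolding o_def by (rule definable_iff)
    ultimately show ?thesis unfolding con_def by auto
  qed
  have fin: "\<exists>s. \<forall>S\<in>\<Delta>. S s" if \<Delta>: "finite \<Delta>" "\<Delta> \<subseteq> \<Gamma>" for \<Delta>
  proof -
    have "\<forall>S\<in>\<Delta>. \<exists>F R h. con S F R h" using \<Delta>(2) unfolding \<Gamma>_def by auto
    then obtain F R h where con: "\<And>S. S \<in> \<Delta> \<Longrightarrow> con S (F S) (R S) (h S)"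
      unfolding bchoice_iff by auto
    have "\<exists>Y. infinite Y \<and> (\<forall>S\<in>\<Delta>. homogeneous r Y (F S) (R S))"
      by (rule ramsey_relations[OF \<Delta>(1)]) (use con in \<open>auto simp: con_def\<close>)
    then obtain Y where Y: "infinite Y" "\<forall>S\<in>\<Delta>. homogeneous r Y (F S) (R S)" by (elim exE conjE)
    define F0 where "F0 = (\<Union>S\<in>\<Delta>. F S \<union> h S ` F S)"
    have "finite F0" using \<Delta>(1) con unfolding F0_def con_def by auto
    then obtain g where g: "strict_mono_on F0 g" "g ` F0 \<subseteq> Y"
      by (rule strict_mono_on_into_infinite_nat[OF _ Y(1)])
    have "S (r \<circ> map_prod g id)" if S: "S \<in> \<Delta>" for S
    proof -
      have sub: "F S \<subseteq> F0" "h S ` F S \<subseteq> F0" using S by (auto simp: F0_def)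
      have g1: "strict_mono_on (F S) g" using g(1) sub(1) by (auto simp: strict_mono_on_def)
      have g2: "strict_mono_on (F S) (g \<circ> h S)"
        using g(1) sub(2) con[OF S] unfolding con_def strict_mono_on_def by (auto simp: image_subset_iff)
      have "R S (r \<circ> map_prod (g \<circ> h S) id) = R S (r \<circ> map_prod g id)"
        using sub g(2) by (intro homogeneousD[OF Y(2)[rule_format, OF S] g2 _ g1]) auto
      moreover have "r \<circ> map_prod (g \<circ> h S) id = (r \<circ> map_prod g id) \<circ> map_prod (h S) id"
        by (auto simp: fun_eq_iff)
      ultimately have "R S ((r \<circ> map_prod g id) \<circ> map_prod (h S) id) = R S (r \<circ> map_prod g id)" by simp
      moreover have "S = (\<lambda>s. R S (s \<circ> map_prod (h S) id) = R S s) \<or>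
          S = R S \<and> (\<forall>g. strict_mono_on (F S) g \<longrightarrow> R S (r \<circ> map_prod g id))"
        using con[OF S] unfolding con_def by simp
      ultimately show ?thesis
      proof (elim disjE conjE)
        assume "S = (\<lambda>s. R S (s \<circ> map_prod (h S) id) = R S s)"
        from fun_cong[OF this, of "r \<circ> map_prod g id"] show ?thesis
          using \<open>R S ((r \<circ> map_prod g id) \<circ> map_prod (h S) id) = R S (r \<circ> map_prod g id)\<close> by (rule iffD2)
      next
        assume "S = R S" and "\<forall>g. strict_mono_on (F S) g \<longrightarrow> R S (r \<circ> map_prod g id)"
        then have "R S (r \<circ> map_prod g id)" using g1 by (elim allE impE)
        from iffD2[OF fun_cong[OF \<open>S = R S\<close>] this] show ?thesis .
      qed
    qed
    then show ?thesis by auto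
  qed
  obtain t where t: "\<And>S. S \<in> \<Gamma> \<Longrightarrow> S t"
    using compactness[OF A defS fin] by metis
  show ?thesis
  proof (intro exI[of _ t] conjI)
    show "indisc A UNIV t"
      unfolding indisc_def
    proof (intro allI impI)
      fix R :: "(rat \<times> 'c \<Rightarrow> 'm) \<Rightarrow> bool" and F and h :: "rat \<Rightarrow> rat"
      assume "definable A R" "finite F" "depends_on R (F \<times> UNIV)" "strict_mono_on F h"
      then have "con (\<lambda>s. R (s \<circ> map_prod h id) = R s) F R h" unfolding con_def by (intro conjI disjI1 refl)
      then have "(\<lambda>s. R (s \<circ> map_prod h id) = R s) \<in> \<Gamma>" unfolding \<Gamma>_def mem_Collect_eq by (intro exI)
      from t[OF this] show "R (t \<circ> map_prod h id) = R t" .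
    qed
  next
    show "em_type A r t"
      unfolding em_type_def
    proof (intro allI impI)
    fix R :: "(rat \<times> 'c \<Rightarrow> 'm) \<Rightarrow> bool" and F
    assume "definable A R" "finite F" "depends_on R (F \<times> UNIV)"
      and "\<forall>g. strict_mono_on F g \<longrightarrow> R (r \<circ> map_prod g id)"
    note R = this
    have "strict_mono_on F id" by (simp add: strict_mono_on_def)
    then have "con R F R id" unfolding con_def
      by (intro conjI disjI2 refl R)
    then have "R \<in> \<Gamma>" unfolding \<Gamma>_def mem_Collect_eq by (intro exI)
    then show "R t" by (rule t)
    qed
  qed
qed

end

text \<open>
  Places row \<open>i\<close> of an array, in increasing order, into the interval from \<open>i\<close> to \<open>i + 1\<close>.
\<close>

definition pos :: "nat \<Rightarrow> nat \<Rightarrow> rat" where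
  "pos i j = of_nat i + of_nat j / of_nat (Suc j)"

lemma pos_bounds: "of_nat i \<le> pos i j" "pos i j < of_nat (Suc i)"
proof -
  have "of_nat j / of_nat (Suc j) < (1 :: rat)" by (simp add: field_simps)
  then show "pos i j < of_nat (Suc i)" by (simp add: pos_def)
  show "of_nat i \<le> pos i j" by (simp add: pos_def)
qed

lemma pos_less_row: "i < i' \<Longrightarrow> pos i j < pos i' j'"
proof -
  assume "i < i'"
  then have "of_nat (Suc i) \<le> (of_nat i' :: rat)" by (intro of_nat_mono) simp
  then show ?thesis using pos_bounds[of i j] pos_bounds[of i' j'] by linarith
qed

lemma pos_less_col: "j < j' \<Longrightarrow> pos i j < pos i j'"
proof -
  assume "j < j'"
  then have "of_nat j < (of_nat j' :: rat)" by simp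
  then have "of_nat j / (1 + of_nat j) < (of_nat j' / (1 + of_nat j') :: rat)"
    by (auto simp: divide_simps distrib_left distrib_right mult.commute)
  then show ?thesis by (simp add: pos_def)
qed

lemma pos_eq_iff: "pos i j = pos i' j' \<longleftrightarrow> i = i' \<and> j = j'"
  by (metis less_irrefl linorder_neqE_nat pos_less_col pos_less_row)

lemma inj_pos: "inj (pos i)"
  by (auto simp: inj_def pos_eq_iff)

section \<open>Patterns excluded by strong dependence\<close>

context fo_structure
begin

text \<open>
  The assignment for the \<open>i\<close>-th condition of a pattern at column \<open>j\<close>: first the elements \<open>x\<close>, then
  the entry in row \<open>i\<close>, and finally the entries of column 1 in the other rows.
\<close>

definition row_asg ::
  "(rat \<times> 'c \<Rightarrow> 'm) \<Rightarrow> (nat \<Rightarrow> 'm) \<Rightarrow> nat \<Rightarrow> nat \<Rightarrow> nat + 'c + (nat \<times> 'c) \<Rightarrow> 'm" where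
  "row_asg t x i j = case_sum x (case_sum (\<lambda>c. t (pos i j, c)) (\<lambda>(i', c). t (pos i' 1, c)))"

text \<open>
  Moving finitely many entries of one row within that row, while all other rows stay fixed, is an
  increasing map of the indices. The constants \<open>d i\<close> let the formula of row \<open>i\<close> use parameters.
\<close>

lemma indiscernible_array_of_indisc:
  fixes t :: "rat \<times> 'c \<Rightarrow> 'm"
  assumes t: "indisc B UNIV t" and d: "\<And>i. set (d i) \<subseteq> B"
  shows "indiscernible_array L M {} (\<lambda>i j. map (\<lambda>c. t (pos i j, c)) (ks i) @ d i)"
    (is "indiscernible_array L M {} ?a")
  unfolding indiscernible_array_def indiscernible_def
proof (intro allI conjI impI)
  fix i0 show "\<exists>m. \<forall>j. length (?a i0 j) = m" by auto
next
  fix i0 \<psi> d' and ls js :: "nat list"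
  assume "formula_of L \<psi> \<and> set d' \<subseteq> {} \<union> (\<Union>i\<in>- {i0}. \<Union>j. set (?a i j)) \<and>
      sorted_wrt (<) ls \<and> sorted_wrt (<) js \<and> length ls = length js \<and>
      free_vars \<psi> \<subseteq> {..<length (concat (map (?a i0) ls) @ d')}"
  then have \<psi>: "formula_of L \<psi>" "free_vars \<psi> \<subseteq> {..<length (concat (map (?a i0) ls) @ d')}"
    and d': "set d' \<subseteq> (\<Union>i\<in>- {i0}. \<Union>j. set (?a i j))"
    and ls: "sorted_wrt (<) ls" and js: "sorted_wrt (<) js" and len: "length ls = length js"
    by auto
  define O' where "O' = {pos i j |i j. i \<noteq> i0}"
  have "\<forall>x\<in>set d'. \<exists>u. x = case_sum t id u \<and> u \<in> Inl ` (O' \<times> UNIV) \<union> Inr ` B"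
  proof
    fix x assume "x \<in> set d'"
    then obtain i j where "i \<noteq> i0" "x \<in> set (?a i j)" using d' by blast
    then consider c where "x = t (pos i j, c)" | "x \<in> B" using d[of i] by auto
    then show "\<exists>u. x = case_sum t id u \<and> u \<in> Inl ` (O' \<times> UNIV) \<union> Inr ` B"
    proof cases
      case (1 c)
      then show ?thesis using \<open>i \<noteq> i0\<close> by (intro exI[of _ "Inl (pos i j, c)"]) (auto simp: O'_def)
    next
      case 2
      then show ?thesis by (intro exI[of _ "Inr x"]) auto
    qed
  qed
  then obtain u where u: "\<forall>x\<in>set d'. x = case_sum t id (u x) \<and> u x \<in> Inl ` (O' \<times> UNIV) \<union> Inr ` B"
    by (metis (no_types, lifting))
  define ts where "ts = map u d'"
  have ts: "map (case_sum t id) ts = d'" "set ts \<subseteq> Inl ` (O' \<times> UNIV) \<union> Inr ` B"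
    using u by (auto simp: ts_def intro!: map_idI)
  have "finite (fst ` (Inl -` set ts))" by (intro finite_imageI finite_vimageI) auto
  define F where "F = pos i0 ` set ls \<union> fst ` (Inl -` set ts)"
  have F: "finite F" unfolding F_def by (intro finite_UnI finite_imageI finite_vimageI) auto
  have FO: "fst ` (Inl -` set ts) \<subseteq> O'" using ts(2) by auto
  define cells where "cells = concat (map (\<lambda>j. map (\<lambda>c. Inl (pos i0 j, c)) (ks i0) @ map Inr (d i0)) ls) @ ts"
  define R where "R s = holds M \<psi> (map (case_sum s id) cells)" for s
  have cells: "map (case_sum (t \<circ> map_prod h id) id) cells =
      concat (map (\<lambda>j. map (\<lambda>c. t (h (pos i0 j), c)) (ks i0) @ d i0) ls) @
      map (case_sum (t \<circ> map_prod h id) id) ts" for h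
    by (simp add: cells_def map_concat o_def)
  have "length cells = length (concat (map (?a i0) ls) @ d')"
    by (simp add: cells_def ts_def length_concat o_def)
  then have "pformula_over L (length cells) B (\<psi>, [])"
    using \<psi> by (simp add: pformula_over_def)
  from definable_on_holds[OF this] have "definable_on B (length cells) (holds M \<psi>)" by simp
  moreover have "set cells \<subseteq> atoms B"
    using d[of i0] ts(2) by (auto simp: cells_def)
  then have "definable_tuple B (length cells) (\<lambda>s. map (case_sum s id) cells)"
    unfolding definable_tuple_def by auto
  ultimately have "definable B (\<lambda>s. holds M \<psi> (map (case_sum s id) cells))" by (rule definable_on_tuple)
  then have defR: "definable B R" unfolding R_def .
  have dep: "depends_on R (F \<times> UNIV)"
    unfolding depends_on_def
  proof (intro allI impI)
    fix s s' :: "rat \<times> 'c \<Rightarrow> 'm" assume eq: "\<forall>v\<in>F \<times> UNIV. s v = s' v"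
    have "case_sum s id x = case_sum s' id x" if "x \<in> set cells" for x
    proof (cases x)
      case (Inl v)
      then have "(\<exists>j\<in>set ls. \<exists>c. v = (pos i0 j, c)) \<or> v \<in> Inl -` set ts"
        using that by (auto simp: cells_def split: if_splits)
      then have "fst v \<in> F" unfolding F_def by (elim disjE bexE exE) auto
      then have "s v = s' v" using eq by (cases v) auto
      then show ?thesis by (simp add: Inl)
    qed simp
    then show "R s = R s'" unfolding R_def by (metis (no_types, lifting) map_cong)
  qed
  define f where "f j = the (map_of (zip ls js) j)" for j
  have f: "f (ls ! k) = js ! k" if "k < length ls" for k
    using that len ls by (simp add: f_def map_of_zip_nth strict_sorted_iff)
  have map_f: "map f ls = js" using f len by (auto intro!: nth_equalityI)
  have f_less: "f x < f y" if xy: "x \<in> set ls" "y \<in> set ls" "x < y" for x y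
  proof -
    obtain k l where kl: "k < length ls" "x = ls ! k" "l < length ls" "y = ls ! l"
      using xy by (auto simp: in_set_conv_nth)
    have "k < l"
      using kl ls \<open>x < y\<close> by (metis linorder_neqE_nat not_less_iff_gr_or_eq sorted_wrt_nth_less)
    then show ?thesis using kl f js len by (auto intro: sorted_wrt_nth_less)
  qed
  \<comment> \<open>Moves row \<open>i0\<close> and fixes the entries of the other rows.\<close>
  define h where "h q = (if q \<in> range (pos i0) then pos i0 (f (inv_into UNIV (pos i0) q)) else q)" for q
  have h_row: "h (pos i0 j) = pos i0 (f j)" for j by (simp add: h_def inj_pos)
  have h_out: "h q = q" if "q \<in> O'" for q
    using that by (auto simp: h_def O'_def pos_eq_iff)
  have "strict_mono_on F h"
  proof (rule strict_mono_onI)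
    fix q q' assume q: "q \<in> F" "q' \<in> F" and less: "q < q'"
    have F_cases: "(\<exists>j\<in>set ls. p = pos i0 j) \<or> (\<exists>i j. i \<noteq> i0 \<and> p = pos i j)" if "p \<in> F" for p
      using that FO unfolding F_def O'_def by blast
    have h_other: "h (pos i j) = pos i j" if "i \<noteq> i0" for i j
      using that by (intro h_out) (auto simp: O'_def)
    from F_cases[OF q(1)] F_cases[OF q(2)] show "h q < h q'"
    proof (elim disjE bexE exE conjE)
      fix j j' assume j: "j \<in> set ls" "j' \<in> set ls" "q = pos i0 j" "q' = pos i0 j'"
      have "j < j'"
        using less j pos_less_col[of j' j i0] by (metis linorder_neqE_nat less_asym less_irrefl)
      then show ?thesis using j f_less by (simp add: h_row pos_less_col)
    next
      fix j i j' assume j: "q = pos i0 j" "i \<noteq> i0" "q' = pos i j'"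
      have "i0 < i" using less j pos_less_row[of i i0] by (metis linorder_neqE_nat less_asym)
      then show ?thesis using j by (simp add: h_row h_other pos_less_row)
    next
      fix j' i j assume j: "i \<noteq> i0" "q = pos i j" "q' = pos i0 j'"
      have "i < i0" using less j pos_less_row[of i0 i] by (metis linorder_neqE_nat less_asym)
      then show ?thesis using j by (simp add: h_row h_other pos_less_row)
    next
      fix i j i' j' assume "i \<noteq> i0" "q = pos i j" "i' \<noteq> i0" "q' = pos i' j'"
      then show ?thesis using less by (simp add: h_other)
    qed
  qed
  from indiscD[OF t defR F dep this] have "R (t \<circ> map_prod h id) = R (t \<circ> map_prod id id)"
    by (simp add: map_prod.id)
  moreover have "map (case_sum (t \<circ> map_prod h id) id) ts = map (case_sum t id) ts"
    using FO h_out by (force split: sum.splits)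
  then have "R (t \<circ> map_prod h id) = holds M \<psi> (concat (map (?a i0) js) @ d')"
    unfolding R_def cells h_row ts(1) by (simp add: o_def flip: map_f)
  moreover have "R (t \<circ> map_prod id id) = holds M \<psi> (concat (map (?a i0) ls) @ d')"
    unfolding R_def cells using ts(1) by (simp add: map_prod.id)
  ultimately show "holds M \<psi> (concat (map (?a i0) ls) @ d') = holds M \<psi> (concat (map (?a i0) js) @ d')"
    by simp
qed

text \<open>
  The definition of strongly$^2$ dependent theories, transferred to arrays cut out of one indiscernible
  sequence. Parameters of the relations become constant entries of the rows. Since only finite
  consistency is asked for, the element \<open>x\<close> may depend on the number \<open>N\<close> of rows.
\<close>

lemma strongly2_dependent_no_pattern:
  fixes t :: "rat \<times> 'c \<Rightarrow> 'm"
  assumes strong: "strongly2_dependent L M" and t: "indisc B UNIV t"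
    and K: "\<And>i. finite (K i)" and R: "\<And>i. definable B (R i)"
    and dep: "\<And>i. depends_on (R i)
      (Inl ` {..<n} \<union> Inr ` (Inl ` K i \<union> Inr ` (SIGMA i':{..<i}. K i')))"
  shows "\<exists>N. \<forall>x. \<exists>i<N. \<not> (R i (row_asg t x i 0) \<and> \<not> R i (row_asg t x i 1))"
proof (rule ccontr)
  assume "\<not> ?thesis"
  then have ex: "\<exists>x. \<forall>i<N. R i (row_asg t x i 0) \<and> \<not> R i (row_asg t x i 1)" for N by metis
  have "\<forall>i. \<exists>xs. set xs = K i" using K by (auto intro: finite_list)
  then obtain ks where ks: "\<And>i. set (ks i) = K i" by metis
  have "\<forall>i. \<exists>xs. set xs = (SIGMA i':{..<i}. K i')" using K by (auto intro!: finite_list)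
  then obtain ps where ps: "\<And>i. set (ps i) = (SIGMA i':{..<i}. K i')" by metis
  define vs :: "nat \<Rightarrow> (nat + 'c + nat \<times> 'c) list"
    where "vs i = map Inl [0..<n] @ map (Inr \<circ> Inl) (ks i)" for i
  define ws :: "nat \<Rightarrow> (nat + 'c + nat \<times> 'c) list" where "ws i = map (Inr \<circ> Inr) (ps i)" for i
  define good where "good i \<phi> d \<longleftrightarrow> set d \<subseteq> B \<and> formula_of L \<phi> \<and>
    free_vars \<phi> \<subseteq> {..<n + (length (ks i) + length d) + length (ps i)} \<and>
    (\<forall>s. holds M \<phi> (map s (vs i) @ d @ map s (ws i)) \<longleftrightarrow> R i s)" for i \<phi> d
  have "\<forall>i. \<exists>\<phi> d. good i \<phi> d"
  proof
    fix i
    have "Inl ` {..<n} \<union> Inr ` (Inl ` K i \<union> Inr ` (SIGMA i':{..<i}. K i')) = set (vs i) \<union> set (ws i)"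
      unfolding vs_def ws_def by (auto simp: ks ps image_image image_Un)
    with dep[of i] have "depends_on (R i) (set (vs i) \<union> set (ws i))" by simp
    then obtain \<phi> d where "set d \<subseteq> B" "formula_of L \<phi>"
      "free_vars \<phi> \<subseteq> {..<length (vs i) + length d + length (ws i)}"
      "\<And>s. holds M \<phi> (map s (vs i) @ d @ map s (ws i)) \<longleftrightarrow> R i s"
      by (rule definable_formula[OF R]) (rule that)
    then have "good i \<phi> d" by (simp add: good_def vs_def ws_def add.assoc)
    then show "\<exists>\<phi> d. good i \<phi> d" by auto
  qed
  then obtain \<phi> d where good: "\<And>i. good i (\<phi> i) (d i)" by metis
  define a where "a i j = map (\<lambda>c. t (pos i j, c)) (ks i) @ d i" for i j
  define b where "b i = map (\<lambda>(i', c). t (pos i' 1, c)) (ps i)" for i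
  have arr: "indiscernible_array L M {} a"
    unfolding a_def using good by (intro indiscernible_array_of_indisc[OF t]) (simp add: good_def)
  have b: "set (b k) \<subseteq> (\<Union>i<k. \<Union>j. set (a i j))" for k
    by (force simp: b_def a_def ps ks)
  have holds: "holds M (\<phi> i) (map x [0..<n] @ a i j @ b i) \<longleftrightarrow> R i (row_asg t x i j)" for x i j
  proof -
    have "map (row_asg t x i j) (vs i) @ d i @ map (row_asg t x i j) (ws i) = map x [0..<n] @ a i j @ b i"
      by (auto simp: vs_def ws_def a_def b_def row_asg_def)
    moreover have "holds M (\<phi> i) (map s (vs i) @ d i @ map s (ws i)) \<longleftrightarrow> R i s" for s
      using good[of i] unfolding good_def by simp
    ultimately show ?thesis by metis
  qed
  have "consistent M n (\<Union>i. {(\<phi> i, a i 0 @ b i), (Neg (\<phi> i), a i 1 @ b i)})"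
    unfolding consistent_def
  proof (intro allI impI)
    let ?S = "\<lambda>i. {(\<phi> i, a i 0 @ b i), (Neg (\<phi> i), a i 1 @ b i)}"
    fix q assume q: "q \<subseteq> (\<Union>i. ?S i)" "finite q"
    then have "\<forall>\<psi>\<in>q. \<exists>i. \<psi> \<in> ?S i" by auto
    then obtain g where g: "\<forall>\<psi>\<in>q. \<psi> \<in> ?S (g \<psi>)" by (rule bchoice[THEN exE])
    obtain N where N: "\<forall>\<psi>\<in>q. g \<psi> < N"
      using q(2) by (metis finite_imageI finite_nat_set_iff_bounded imageI)
    obtain x where x: "\<forall>i<N. R i (row_asg t x i 0) \<and> \<not> R i (row_asg t x i 1)" using ex by auto
    have "holds M \<psi> (map x [0..<n] @ e)" if "(\<psi>, e) \<in> q" for \<psi> e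
    proof -
      define i where "i = g (\<psi>, e)"
      have "i < N" using N that unfolding i_def by (rule bspec)
      then have i: "R i (row_asg t x i 0)" "\<not> R i (row_asg t x i 1)" using x by auto
      have "(\<psi>, e) \<in> ?S i" using g that unfolding i_def by (rule bspec)
      then consider "\<psi> = \<phi> i" "e = a i 0 @ b i" | "\<psi> = Neg (\<phi> i)" "e = a i 1 @ b i" by auto
      then show ?thesis
      proof cases
        case 1
        show ?thesis unfolding 1 holds by (rule i)
      next
        case 2
        have "holds M (Neg (\<phi> i)) ys = (\<not> holds M (\<phi> i) ys)" for ys by (simp add: holds_def)
        then show ?thesis unfolding 2 using holds i(2) by simp
      qed
    qed
    then have "map x [0..<n] \<in> solutions M n q" by (auto simp: solutions_def)
    then show "solutions M n q \<noteq> {}" by auto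
  qed
  moreover have "formula_of L (\<phi> i) \<and> free_vars (\<phi> i) \<subseteq> {..<n + length (a i 0) + length (b i)}" for i
    using good[of i] by (simp add: good_def a_def b_def)
  ultimately show False
    using strong arr b unfolding strongly2_dependent_def by blast
qed

text \<open>
  Turns the parameters in a finite tuple into variables, for which another tuple can then be
  substituted.
\<close>

lemma definable_on_parameters:
  assumes "definable_on (A \<union> set e) m R"
  obtains R' where "definable_on A (length e + m) R'" "\<And>xs. length xs = m \<Longrightarrow> R xs \<longleftrightarrow> R' (e @ xs)"
proof -
  obtain \<phi> f where 1: "formula_of L \<phi>" "\<And>i. i \<in> free_vars \<phi> \<Longrightarrow> f i \<in> atoms (A \<union> set e)"
    "\<And>s :: nat \<Rightarrow> 'm. R (map s [0..<m]) \<longleftrightarrow> sat M (\<lambda>i. case_sum s id (f i)) \<phi>"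
    using assms unfolding definable_on_def by (rule definableE) (rule that)
  have "\<forall>x\<in>set e. \<exists>j<length e. e ! j = x" by (auto simp: in_set_conv_nth)
  then obtain idx where idx: "\<forall>x\<in>set e. idx x < length e \<and> e ! idx x = x" by metis
  define g where "g i = (case f i of Inl j \<Rightarrow> Inl (length e + j) | Inr x \<Rightarrow> if x \<in> A then Inr x else Inl (idx x))" for i
  define S where "S s \<longleftrightarrow> sat M (\<lambda>i. case_sum s id (g i)) \<phi>" for s :: "nat \<Rightarrow> 'm"
  define k where "k = length e + m"
  define R' where "R' ys \<longleftrightarrow> (\<exists>c :: nat \<Rightarrow> 'm. S (\<lambda>i. if i < k then ys ! i else c 0))" for ys
  have defS: "definable A S"
  proof (rule definableI[OF 1(1)])
    show "g i \<in> atoms A" if "i \<in> free_vars \<phi>" for i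
      using 1(2)[OF that] by (auto simp: g_def split: sum.splits)
  qed (simp add: S_def)
  have "definable A (\<lambda>s. \<exists>c :: nat \<Rightarrow> 'm. S (\<lambda>i. if i < k then s i else c 0))"
  proof (rule definable_ex)
    have "definable A (\<lambda>z :: nat + nat \<Rightarrow> 'm. S (\<lambda>i. z (if i < k then Inl i else Inr 0)))"
      by (rule definable_subst[OF defS])
    moreover have "(\<lambda>i. z (if i < k then Inl i else Inr 0)) = (\<lambda>i. if i < k then z (Inl i) else z (Inr 0))"
      for z :: "nat + nat \<Rightarrow> 'm" by auto
    ultimately show "definable A (\<lambda>z :: nat + nat \<Rightarrow> 'm. S (\<lambda>i. if i < k then z (Inl i) else z (Inr 0)))"
      by simp
  qed
  moreover have "R' (map s [0..<k]) = (\<exists>c :: nat \<Rightarrow> 'm. S (\<lambda>i. if i < k then s i else c 0))" for s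
  proof -
    have "(\<lambda>i. if i < k then map s [0..<k] ! i else c 0) = (\<lambda>i. if i < k then s i else c 0)" for c :: "nat \<Rightarrow> 'm"
      by auto
    then show ?thesis by (simp add: R'_def)
  qed
  ultimately have "definable_on A k R'" unfolding definable_on_def by simp
  moreover have "R xs \<longleftrightarrow> R' (e @ xs)" if xs: "length xs = m" for xs
  proof -
    have "S (\<lambda>i. if i < k then (e @ xs) ! i else c 0) \<longleftrightarrow> R xs" for c :: "nat \<Rightarrow> 'm"
    proof -
      define s where "s j = (if j < m then xs ! j else c 0)" for j
      have "S (\<lambda>i. if i < k then (e @ xs) ! i else c 0) \<longleftrightarrow> sat M (\<lambda>i. case_sum s id (f i)) \<phi>"
        unfolding S_def
      proof (rule sat_cong)
        fix i assume "i \<in> free_vars \<phi>"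
        then show "case_sum (\<lambda>i. if i < k then (e @ xs) ! i else c 0) id (g i) = case_sum s id (f i)"
          using 1(2)[of i] idx
          by (cases "f i") (auto simp: g_def s_def k_def nth_append xs)
      qed
      also have "\<dots> \<longleftrightarrow> R (map s [0..<m])" by (simp add: 1(3))
      also have "map s [0..<m] = xs" by (auto simp: s_def xs intro!: nth_equalityI)
      finally show ?thesis .
    qed
    then show ?thesis by (simp add: R'_def)
  qed
  ultimately show ?thesis using that by (simp add: k_def)
qed

lemma definable_on_Not: "definable_on A k R \<Longrightarrow> definable_on A k (\<lambda>xs. \<not> R xs)"
  unfolding definable_on_def by (rule definable_Not)

end

lemma pos_div_mod_less:
  "k < k' \<Longrightarrow> pos (k div 2) (k mod 2) < pos (k' div 2) (k' mod 2)"
proof (cases "k div 2 = k' div 2")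
  case True
  assume "k < k'"
  then have "k mod 2 < k' mod 2"
    using True by (metis add_less_cancel_left div_mult_mod_eq)
  then show ?thesis using True by (simp add: pos_less_col)
next
  case False
  assume "k < k'"
  then have "k div 2 < k' div 2" using False div_le_mono[of k k' 2] by simp
  then show ?thesis by (rule pos_less_row)
qed

context monster
begin

text \<open>
  If the type over \<open>e\<close> keeps changing, there are disjoint pairs of indices and formulas \<open>R\<^sub>i\<close> such that
  \<open>R\<^sub>i(e, \<cdot>)\<close> holds at the first and fails at the second member of the \<open>i\<close>-th pair. An indiscernible
  sequence with the same type over \<open>B\<close> admits the same pattern with some \<open>x\<close> in place of \<open>e\<close>.
\<close>

lemma eventually_constant_type:
  fixes a :: "nat \<Rightarrow> 'm list"
  assumes strong: "strongly2_dependent L M" and B: "small B"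
    and ind: "indisc B {..<m} (\<lambda>(k, l). a k ! l)" and len: "\<And>k. length (a k) = m"
  shows "\<exists>K. \<forall>R. definable_on (B \<union> set e) m R \<longrightarrow> (\<forall>k\<ge>K. \<forall>k'\<ge>K. R (a k) = R (a k'))"
proof (rule ccontr)
  assume neg: "\<not> ?thesis"
  define split where "split x \<longleftrightarrow> fst x < fst (snd x) \<and> definable_on B (length e + m) (snd (snd x)) \<and>
    snd (snd x) (e @ a (fst x)) \<and> \<not> snd (snd x) (e @ a (fst (snd x)))"
    for x :: "nat \<times> nat \<times> ('m list \<Rightarrow> bool)"
  have ex: "\<exists>x. split x \<and> K \<le> fst x" for K
  proof -
    obtain R k k' where R: "definable_on (B \<union> set e) m R" and k: "k \<ge> K" "k' \<ge> K" "R (a k) \<noteq> R (a k')"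
      using neg by meson
    obtain R' where R': "definable_on B (length e + m) R'" "\<And>xs. length xs = m \<Longrightarrow> R xs \<longleftrightarrow> R' (e @ xs)"
      using R by (rule definable_on_parameters) (rule that)
    have neq: "R' (e @ a k) \<noteq> R' (e @ a k')" using k(3) R'(2) len by simp
    define i j where "i = min k k'" and "j = max k k'"
    have ij: "i < j" "K \<le> i" "R' (e @ a i) \<noteq> R' (e @ a j)"
      using neq k by (auto simp: i_def j_def min_def max_def nat_less_le)
    show ?thesis
    proof (cases "R' (e @ a i)")
      case True
      then have "split (i, j, R')" using ij R'(1) by (simp add: split_def)
      then show ?thesis using ij by (intro exI[of _ "(i, j, R')"]) simp
    next
      case False
      then have "split (i, j, \<lambda>xs. \<not> R' xs)"
        using ij definable_on_Not[OF R'(1)] by (simp add: split_def)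
      then show ?thesis using ij by (intro exI[of _ "(i, j, \<lambda>xs. \<not> R' xs)"]) simp
    qed
  qed
  have "\<exists>x. \<forall>i. split (x i) \<and> Suc (fst (snd (x i))) \<le> fst (x (Suc i))"
  proof (rule dependent_nat_choice)
    show "\<exists>x. split x" using ex[of 0] by (elim exE conjE) (rule exI)
  qed (rule ex)
  then obtain x where x: "\<And>i. split (x i)" "\<And>i. Suc (fst (snd (x i))) \<le> fst (x (Suc i))" by auto
  define R where "R i = snd (snd (x i))" for i
  \<comment> \<open>The even and odd indices enumerate the first and the second members of the pairs.\<close>
  define \<sigma> where "\<sigma> k = (if even k then fst (x (k div 2)) else fst (snd (x (k div 2))))" for k
  have "strict_mono \<sigma>"
    unfolding strict_mono_Suc_iff
  proof
    fix k show "\<sigma> k < \<sigma> (Suc k)"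
      using x(1)[of "k div 2"] x(2)[of "k div 2"] by (cases "even k") (auto simp: \<sigma>_def split_def)
  qed
  have R: "definable_on B (length e + m) (R i)" "R i (e @ a (\<sigma> (2 * i)))" "\<not> R i (e @ a (\<sigma> (Suc (2 * i))))" for i
    using x(1)[of i] by (auto simp: R_def \<sigma>_def split_def)
  define r where "r = (\<lambda>(k, l). a k ! l)"
  obtain t :: "rat \<times> nat \<Rightarrow> 'm" where t: "indisc B UNIV t" and em: "em_type B r t"
    using extract_indiscernible[OF B, of r] by (elim exE conjE)
  define RR where "RR i z \<longleftrightarrow> R i (map (\<lambda>l. z (Inl l)) [0..<length e] @ map (\<lambda>l. z (Inr (Inl l))) [0..<m])"
    for i and z :: "nat + nat + nat \<times> nat \<Rightarrow> 'm"
  have "\<exists>N. \<forall>x. \<exists>i<N. \<not> (RR i (row_asg t x i 0) \<and> \<not> RR i (row_asg t x i 1))"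
  proof (rule strongly2_dependent_no_pattern[OF strong t, where K = "\<lambda>_. {..<m}" and n = "length e"])
    show "definable B (RR i)" for i
      unfolding RR_def by (intro definable_on_tuple[OF R(1)] definable_tuple_append definable_tuple_vars_upt)
    show "depends_on (RR i) (Inl ` {..<length e} \<union> Inr ` (Inl ` {..<m} \<union> Inr ` (SIGMA i':{..<i}. {..<m})))" for i
      unfolding depends_on_def RR_def by (auto intro!: arg_cong[where f = "R i"])
  qed simp
  then obtain N where N: "\<And>x. \<exists>i<N. \<not> (RR i (row_asg t x i 0) \<and> \<not> RR i (row_asg t x i 1))" by auto
  define Q where "Q u \<longleftrightarrow> (\<exists>x :: nat \<Rightarrow> 'm. \<forall>i<N.
      R i (map (\<lambda>l. x l) [0..<length e] @ map (\<lambda>l. u (2 * i, l)) [0..<m]) \<and>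
      \<not> R i (map (\<lambda>l. x l) [0..<length e] @ map (\<lambda>l. u (Suc (2 * i), l)) [0..<m]))"
    for u :: "nat \<times> nat \<Rightarrow> 'm"
  have defQ: "definable B Q"
    unfolding Q_def
    by (intro definable_ex definable_all_less definable_conj definable_Not definable_on_tuple[OF R(1)]
        definable_tuple_append definable_tuple_vars_upt)
  have depQ: "depends_on Q ({..<2 * N} \<times> {..<m})"
    unfolding depends_on_def
  proof (intro allI impI)
    fix u u' :: "nat \<times> nat \<Rightarrow> 'm" assume u: "\<forall>v\<in>{..<2 * N} \<times> {..<m}. u v = u' v"
    have "map (\<lambda>l. u (2 * i, l)) [0..<m] = map (\<lambda>l. u' (2 * i, l)) [0..<m]"
      "map (\<lambda>l. u (Suc (2 * i), l)) [0..<m] = map (\<lambda>l. u' (Suc (2 * i), l)) [0..<m]" if "i < N" for i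
      using u that by auto
    then show "Q u = Q u'"
      unfolding Q_def by (intro ex_cong1 all_cong) (simp only:)
  qed
  have Q_shift: "Q (r \<circ> map_prod f id)" if f: "strict_mono_on {..<2 * N} f" for f
  proof -
    have "Q (r \<circ> map_prod \<sigma> id)"
      unfolding Q_def
    proof (intro exI[of _ "(!) e"] allI impI)
      fix i
      have "map (\<lambda>l. (r \<circ> map_prod \<sigma> id) (k, l)) [0..<m] = a (\<sigma> k)" for k
        by (auto simp: r_def len intro!: nth_equalityI)
      moreover have "map (\<lambda>l. e ! l) [0..<length e] = e" by (rule map_nth)
      ultimately show "R i (map (\<lambda>l. e ! l) [0..<length e] @ map (\<lambda>l. (r \<circ> map_prod \<sigma> id) (2 * i, l)) [0..<m]) \<and>
        \<not> R i (map (\<lambda>l. e ! l) [0..<length e] @ map (\<lambda>l. (r \<circ> map_prod \<sigma> id) (Suc (2 * i), l)) [0..<m])"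
        using R(2,3)[of i] by metis
    qed
    moreover have "strict_mono_on {..<2 * N} \<sigma>"
      using \<open>strict_mono \<sigma>\<close> by (auto simp: strict_mono_on_def strict_mono_def)
    ultimately have "Q r"
      using indiscD[OF ind[folded r_def] defQ _ depQ, of \<sigma>] by simp
    then show ?thesis
      using indiscD[OF ind[folded r_def] defQ _ depQ f] by simp
  qed
  define ph where "ph k = pos (k div 2) (k mod 2)" for k :: nat
  have "Q (t \<circ> map_prod ph id)"
  proof (rule em_typeD[OF em, of "\<lambda>s. Q (s \<circ> map_prod ph id)" "ph ` {..<2 * N}"])
    show "definable B (\<lambda>s. Q (s \<circ> map_prod ph id))"
      using definable_subst[OF defQ, of "map_prod ph id"] by (simp add: o_def)
    show "depends_on (\<lambda>s. Q (s \<circ> map_prod ph id)) (ph ` {..<2 * N} \<times> UNIV)"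
      unfolding depends_on_def by (intro allI impI depends_onD[OF depQ]) auto
  next
    fix g :: "rat \<Rightarrow> nat" assume "strict_mono_on (ph ` {..<2 * N}) g"
    then have "strict_mono_on {..<2 * N} (g \<circ> ph)"
      using pos_div_mod_less by (auto simp: strict_mono_on_def ph_def)
    from Q_shift[OF this] show "Q (r \<circ> map_prod g id \<circ> map_prod ph id)"
      by (simp add: comp_assoc map_prod.comp)
  qed simp
  then obtain x where x: "\<And>i. i < N \<Longrightarrow>
      R i (map (\<lambda>l. x l) [0..<length e] @ map (\<lambda>l. (t \<circ> map_prod ph id) (2 * i, l)) [0..<m]) \<and>
      \<not> R i (map (\<lambda>l. x l) [0..<length e] @ map (\<lambda>l. (t \<circ> map_prod ph id) (Suc (2 * i), l)) [0..<m])"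
    unfolding Q_def by auto
  have "ph (2 * i) = pos i 0" "ph (Suc (2 * i)) = pos i 1" for i by (simp_all add: ph_def)
  then show False using N[of x] x unfolding RR_def row_asg_def by auto
qed

end

section \<open>Products in type definable groups\<close>

locale definable_group = monster L M + group G
  for L :: "('f, 'r) language" and M :: "('f, 'r, 'm) fo_struct" and G :: "'m list monoid" (structure) +
  fixes B :: "'m set" and n :: nat and \<Theta> :: "('m list \<Rightarrow> bool) set" and \<nu> :: "'m list \<Rightarrow> bool"
  assumes strong: "strongly2_dependent L M"
    and small_B: "small B"
    and carrier_eq: "carrier G = {x. length x = n \<and> (\<forall>\<theta>\<in>\<Theta>. \<theta> x)}"
    and \<Theta>_definable: "\<theta> \<in> \<Theta> \<Longrightarrow> definable_on B n \<theta>"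
    and \<Theta>_nonempty: "\<Theta> \<noteq> {}"
    and \<Theta>_directed: "\<theta> \<in> \<Theta> \<Longrightarrow> \<theta>' \<in> \<Theta> \<Longrightarrow> \<exists>\<eta>\<in>\<Theta>. \<forall>x. \<eta> x \<longrightarrow> \<theta> x \<and> \<theta>' x"
    and \<nu>_definable: "definable_on B (n + n + n) \<nu>"
    and \<nu>_iff: "x \<in> carrier G \<Longrightarrow> y \<in> carrier G \<Longrightarrow> z \<in> carrier G \<Longrightarrow> \<nu> (x @ y @ z) \<longleftrightarrow> x \<otimes> y = z"
begin

abbreviation block :: "(nat \<times> nat \<Rightarrow> 'm) \<Rightarrow> nat \<Rightarrow> 'm list" where
  "block s b \<equiv> map (\<lambda>l. s (b, l)) [0..<n]"

lemma carrierI: "length x = n \<Longrightarrow> (\<And>\<theta>. \<theta> \<in> \<Theta> \<Longrightarrow> \<theta> x) \<Longrightarrow> x \<in> carrier G"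
  unfolding carrier_eq by (intro CollectI conjI ballI)

lemma carrier_length: "x \<in> carrier G \<Longrightarrow> length x = n"
  using carrier_eq by simp

lemma carrier_\<Theta>: "x \<in> carrier G \<Longrightarrow> \<theta> \<in> \<Theta> \<Longrightarrow> \<theta> x"
  unfolding carrier_eq by (elim CollectE conjE) (rule bspec[where P = "\<lambda>\<theta>. \<theta> x"])

lemma definable_\<nu>:
  assumes "definable_tuple A n xs" "definable_tuple A n ys" "definable_tuple A n zs" "B \<subseteq> A"
  shows "definable A (\<lambda>s. \<nu> (xs s @ ys s @ zs s))"
  using definable_on_tuple[OF definable_on_mono[OF \<nu>_definable assms(4)],
      of "\<lambda>s. xs s @ ys s @ zs s"] definable_tuple_append[OF assms(1) definable_tuple_append[OF assms(2,3)]]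
  by (simp add: add.assoc)

text \<open>
  The group is only an intersection of definable sets. By compactness a single one of them suffices
  to make a solution of a cancellative equation unique among all tuples.
\<close>

lemma division_unique:
  fixes e :: "'m list \<Rightarrow> 'm list \<Rightarrow> 'm list \<Rightarrow> bool"
  assumes e: "definable B (\<lambda>s. e (block s 0) (block s 1) (block s 2))"
    and unique: "\<And>g y z z'. g \<in> carrier G \<Longrightarrow> y \<in> carrier G \<Longrightarrow> z \<in> carrier G \<Longrightarrow> z' \<in> carrier G \<Longrightarrow>
      e g y z \<Longrightarrow> e g y z' \<Longrightarrow> z = z'"
  shows "\<exists>\<theta>\<in>\<Theta>. \<forall>g\<in>carrier G. \<forall>y\<in>carrier G. \<forall>z\<in>carrier G. \<forall>z'.
    length z' = n \<longrightarrow> \<theta> z' \<longrightarrow> e g y z \<longrightarrow> e g y z' \<longrightarrow> z' = z"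
proof -
  define R where "R s \<longleftrightarrow> e (block s 0) (block s 1) (block s 2) \<and> e (block s 0) (block s 1) (block s 3) \<and>
      \<not> block s 2 = block s 3" for s
  define Q where "Q \<theta> s \<longleftrightarrow> \<theta> (block s 0) \<and> \<theta> (block s 1) \<and> \<theta> (block s 2) \<and> \<theta> (block s 3)"
    for \<theta> :: "'m list \<Rightarrow> bool" and s
  have "definable B (\<lambda>s. e (block s 0) (block s 1) (block s 3))"
    using definable_subst[OF e, of "\<lambda>(b, l). (if b = 2 then 3 else b, l)"] by simp
  then have "definable B R"
    unfolding R_def by (intro definable_conj definable_Not definable_eq_tuple[where k = n] definable_tuple_vars_upt e)
  moreover have "definable B (Q \<theta>)" if "\<theta> \<in> \<Theta>" for \<theta>
    unfolding Q_def by (intro definable_conj definable_on_tuple[OF \<Theta>_definable[OF that]] definable_tuple_vars_upt)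
  moreover have "\<exists>\<eta>\<in>\<Theta>. \<forall>s. Q \<eta> s \<longrightarrow> Q \<theta> s \<and> Q \<theta>' s" if "\<theta> \<in> \<Theta>" "\<theta>' \<in> \<Theta>" for \<theta> \<theta>'
    using \<Theta>_directed[OF that] unfolding Q_def by auto
  moreover have False if R: "R s" and Q: "\<And>\<theta>. \<theta> \<in> \<Theta> \<Longrightarrow> Q \<theta> s" for s
  proof -
    have "block s b \<in> carrier G" if "b \<in> {0, 1, 2, 3}" for b
      by (rule carrierI) (use Q that in \<open>auto simp: Q_def\<close>)
    then have "block s 2 = block s 3"
      by (intro unique[of "block s 0" "block s 1"]) (use R in \<open>simp_all only: R_def\<close>, simp_all)
    then show False using R unfolding R_def by (elim conjE notE)
  qed
  ultimately obtain \<theta> where \<theta>: "\<theta> \<in> \<Theta>" "\<And>s. R s \<Longrightarrow> \<not> Q \<theta> s"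
    using compactness_directed[OF small_B, of R \<Theta> Q] \<Theta>_nonempty by auto
  show ?thesis
  proof (intro bexI[OF _ \<theta>(1)] ballI allI impI)
    fix g y z z' assume *: "g \<in> carrier G" "y \<in> carrier G" "z \<in> carrier G" "length z' = n" "\<theta> z'" "e g y z" "e g y z'"
    define s where "s = (\<lambda>(b, l). [g, y, z, z'] ! b ! l)"
    have b: "block s 0 = g" "block s 1 = y" "block s 2 = z" "block s 3 = z'"
      using * by (simp_all add: s_def list_as_map carrier_length)
    show "z' = z"
    proof (rule ccontr)
      assume "z' \<noteq> z"
      then have "R s" unfolding R_def b using * by simp
      moreover have "Q \<theta> s" unfolding Q_def b using * carrier_\<Theta>[OF _ \<theta>(1)] by simp
      ultimately show False using \<theta>(2) by simp
    qed
  qed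
qed

lemma left_division:
  "\<exists>\<theta>\<in>\<Theta>. \<forall>g\<in>carrier G. \<forall>y\<in>carrier G. \<forall>z. length z = n \<longrightarrow> \<theta> z \<longrightarrow> \<nu> (g @ z @ y) \<longrightarrow> z = inv g \<otimes> y"
proof -
  have "\<exists>\<theta>\<in>\<Theta>. \<forall>g\<in>carrier G. \<forall>y\<in>carrier G. \<forall>z\<in>carrier G. \<forall>z'.
    length z' = n \<longrightarrow> \<theta> z' \<longrightarrow> \<nu> (g @ z @ y) \<longrightarrow> \<nu> (g @ z' @ y) \<longrightarrow> z' = z"
    by (rule division_unique[of "\<lambda>g y z. \<nu> (g @ z @ y)"])
      (auto intro!: definable_\<nu> definable_tuple_vars_upt simp: \<nu>_iff)
  then obtain \<theta> where \<theta>: "\<theta> \<in> \<Theta>" "\<And>g y z z'. g \<in> carrier G \<Longrightarrow> y \<in> carrier G \<Longrightarrow> z \<in> carrier G \<Longrightarrow>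
    length z' = n \<Longrightarrow> \<theta> z' \<Longrightarrow> \<nu> (g @ z @ y) \<Longrightarrow> \<nu> (g @ z' @ y) \<Longrightarrow> z' = z" by auto
  have "z = inv g \<otimes> y" if "g \<in> carrier G" "y \<in> carrier G" "length z = n" "\<theta> z" "\<nu> (g @ z @ y)" for g y z
  proof (rule \<theta>(2)[of g y])
    show "\<nu> (g @ (inv g \<otimes> y) @ y)"
      using that(1,2) by (simp add: \<nu>_iff m_assoc[symmetric])
  qed (use that in auto)
  then show ?thesis using \<theta>(1) by auto
qed

lemma right_division:
  "\<exists>\<theta>\<in>\<Theta>. \<forall>g\<in>carrier G. \<forall>y\<in>carrier G. \<forall>z. length z = n \<longrightarrow> \<theta> z \<longrightarrow> \<nu> (z @ g @ y) \<longrightarrow> z = y \<otimes> inv g"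
proof -
  have "\<exists>\<theta>\<in>\<Theta>. \<forall>g\<in>carrier G. \<forall>y\<in>carrier G. \<forall>z\<in>carrier G. \<forall>z'.
    length z' = n \<longrightarrow> \<theta> z' \<longrightarrow> \<nu> (z @ g @ y) \<longrightarrow> \<nu> (z' @ g @ y) \<longrightarrow> z' = z"
    by (rule division_unique[of "\<lambda>g y z. \<nu> (z @ g @ y)"])
      (auto intro!: definable_\<nu> definable_tuple_vars_upt simp: \<nu>_iff)
  then obtain \<theta> where \<theta>: "\<theta> \<in> \<Theta>" "\<And>g y z z'. g \<in> carrier G \<Longrightarrow> y \<in> carrier G \<Longrightarrow> z \<in> carrier G \<Longrightarrow>
    length z' = n \<Longrightarrow> \<theta> z' \<Longrightarrow> \<nu> (z @ g @ y) \<Longrightarrow> \<nu> (z' @ g @ y) \<Longrightarrow> z' = z" by auto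
  have "z = y \<otimes> inv g" if "g \<in> carrier G" "y \<in> carrier G" "length z = n" "\<theta> z" "\<nu> (z @ g @ y)" for g y z
  proof (rule \<theta>(2)[of g y])
    show "\<nu> ((y \<otimes> inv g) @ g @ y)"
      using that(1,2) by (simp add: \<nu>_iff m_assoc)
  qed (use that in auto)
  then show ?thesis using \<theta>(1) by auto
qed

text \<open>
  A definable version of \<open>z = (w 0 \<cdot> \<dots> \<cdot> w (i - 1))\<^sup>-\<^sup>1 \<cdot> x\<close>. The formula \<open>\<theta>\<close> keeps
  solutions outside the group away.
\<close>

primrec left_quotient :: "('m list \<Rightarrow> bool) \<Rightarrow> nat \<Rightarrow> (nat \<Rightarrow> 'm list) \<Rightarrow> 'm list \<Rightarrow> 'm list \<Rightarrow> bool" where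
  "left_quotient \<theta> 0 w x z \<longleftrightarrow> z = x"
| "left_quotient \<theta> (Suc i) w x z \<longleftrightarrow> (\<exists>y :: nat \<Rightarrow> 'm. left_quotient \<theta> i w x (map (\<lambda>l. y l) [0..<n]) \<and>
     \<theta> z \<and> \<nu> (w i @ z @ map (\<lambda>l. y l) [0..<n]))"

lemma left_quotient_cong: "(\<And>j. j < i \<Longrightarrow> w j = w' j) \<Longrightarrow> left_quotient \<theta> i w x z = left_quotient \<theta> i w' x z"
  by (induction i arbitrary: z) auto

lemma definable_left_quotient:
  assumes "\<theta> \<in> \<Theta>"
  shows "definable B (\<lambda>s. left_quotient \<theta> i (\<lambda>j. block s (j + 2)) (block s 0) (block s 1))"
proof (induction i)
  case 0
  show ?case unfolding left_quotient.simps by (intro definable_eq_tuple[where k = n] definable_tuple_vars_upt)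
next
  case (Suc i)
  have "definable B (\<lambda>z :: nat \<times> nat + nat \<Rightarrow> 'm. left_quotient \<theta> i
      (\<lambda>j. map (\<lambda>l. z (Inl (j + 2, l))) [0..<n]) (map (\<lambda>l. z (Inl (0, l))) [0..<n]) (map (\<lambda>l. z (Inr l)) [0..<n]))"
    using definable_subst[OF Suc.IH, of "\<lambda>(b, l). if b = 1 then Inr l else Inl (b, l)"] by simp
  then show ?case
    unfolding left_quotient.simps
    by (intro definable_ex definable_conj definable_on_tuple[OF \<Theta>_definable[OF assms]] definable_\<nu>
        definable_tuple_vars_upt subset_refl)
qed

lemma left_quotient_iff:
  assumes \<theta>: "\<theta> \<in> \<Theta>" "\<forall>g\<in>carrier G. \<forall>y\<in>carrier G. \<forall>z. length z = n \<longrightarrow> \<theta> z \<longrightarrow> \<nu> (g @ z @ y) \<longrightarrow> z = inv g \<otimes> y"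
    and c: "\<And>i. c i \<in> carrier G" and y: "\<And>i. y i \<in> carrier G" "\<And>i. i < N \<Longrightarrow> y i = c i \<otimes> y (Suc i)"
    and "i \<le> N" "length z = n"
  shows "left_quotient \<theta> i c (y 0) z \<longleftrightarrow> z = y i"
  using assms(6,7)
proof (induction i arbitrary: z)
  case (Suc i)
  have yi: "y i = c i \<otimes> y (Suc i)" using Suc.prems y(2) by simp
  have "left_quotient \<theta> (Suc i) c (y 0) z \<longleftrightarrow>
      (\<exists>f :: nat \<Rightarrow> 'm. map (\<lambda>l. f l) [0..<n] = y i \<and> \<theta> z \<and> \<nu> (c i @ z @ y i))"
    using Suc by auto
  also have "\<dots> \<longleftrightarrow> \<theta> z \<and> \<nu> (c i @ z @ y i)"
    using list_as_map[OF carrier_length[OF y(1)[of i]]] by auto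
  also have "\<dots> \<longleftrightarrow> z = y (Suc i)"
  proof
    assume "\<theta> z \<and> \<nu> (c i @ z @ y i)"
    then have "z = inv c i \<otimes> y i" using \<theta>(2) c[of i] y(1)[of i] Suc.prems by simp
    also have "\<dots> = y (Suc i)"
      unfolding yi using c[of i] y(1)[of "Suc i"] by (simp add: m_assoc[symmetric])
    finally show "z = y (Suc i)" .
  next
    assume z: "z = y (Suc i)"
    have "\<nu> (c i @ y (Suc i) @ y i)"
      by (subst \<nu>_iff) (use c y(1) yi in simp_all)
    then show "\<theta> z \<and> \<nu> (c i @ z @ y i)" using carrier_\<Theta>[OF y(1) \<theta>(1)] z by simp
  qed
  finally show ?case .
qed simp

text \<open>
  For the product \<open>x\<close> of the first \<open>N\<close> elements \<open>c i\<close>, the quotient of \<open>x\<close> by the first \<open>i\<close> factors is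
  \<open>c i \<otimes> f\<close> with \<open>f\<close> in \<open>F (Suc i)\<close>. So the relations saying that this quotient satisfies \<open>\<chi> i\<close>
  form an excluded pattern; the divisors are entries of earlier rows, which is where strongly$^2$
  dependent is more than strongly dependent.
\<close>

lemma no_separated_cosets:
  fixes t :: "rat \<times> (nat + nat \<times> nat) \<Rightarrow> 'm" and m :: nat
  defines "\<alpha> \<equiv> \<lambda>q. map (\<lambda>l. t (q, Inl l)) [0..<m]"
  defines "c \<equiv> \<lambda>i. map (\<lambda>l. t (pos i 1, Inr (i, l))) [0..<n]"
  assumes t: "indisc B UNIV t"
    and F: "\<And>i. F i \<subseteq> carrier G" "\<And>i. \<one> \<in> F i" "\<And>i x y. x \<in> F i \<Longrightarrow> y \<in> F i \<Longrightarrow> x \<otimes> y \<in> F i"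
      "\<And>i. F (Suc i) \<subseteq> F i"
    and c: "\<And>i. c i \<in> F i"
    and \<chi>: "\<And>i. definable_on B (n + m) (\<chi> i)"
    and sep: "\<And>i f. f \<in> F (Suc i) \<Longrightarrow>
      \<chi> i ((c i \<otimes> f) @ \<alpha> (pos i 0)) \<and> \<not> \<chi> i ((c i \<otimes> f) @ \<alpha> (pos i 1))"
  shows False
proof -
  obtain \<theta> where \<theta>: "\<theta> \<in> \<Theta>" "\<forall>g\<in>carrier G. \<forall>y\<in>carrier G. \<forall>z. length z = n \<longrightarrow> \<theta> z \<longrightarrow> \<nu> (g @ z @ y) \<longrightarrow> z = inv g \<otimes> y"
    using left_division by auto
  define w where "w v j = map (\<lambda>l. v (Inr (Inr (j, Inr (j, l))))) [0..<n]"
    for v :: "nat + (nat + nat \<times> nat) + nat \<times> (nat + nat \<times> nat) \<Rightarrow> 'm" and j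
  define R where "R i v \<longleftrightarrow> (\<exists>y :: nat \<Rightarrow> 'm. left_quotient \<theta> i (w v) (map (\<lambda>l. v (Inl l)) [0..<n]) (map (\<lambda>l. y l) [0..<n]) \<and>
      \<chi> i (map (\<lambda>l. y l) [0..<n] @ map (\<lambda>l. v (Inr (Inl (Inl l)))) [0..<m]))"
    for i and v :: "nat + (nat + nat \<times> nat) + nat \<times> (nat + nat \<times> nat) \<Rightarrow> 'm"
  define K where "K i = Inl ` {..<m} \<union> Inr ` ({i} \<times> {..<n})" for i :: nat
  have "definable B (R i)" for i
  proof -
    let ?h = "\<lambda>(b, l). if b = 1 then Inr l else if b = 0 then Inl (Inl l) else Inl (Inr (Inr (b - 2, Inr (b - 2, l))))"
    have "definable B (\<lambda>z :: (nat + (nat + nat \<times> nat) + nat \<times> (nat + nat \<times> nat)) + nat \<Rightarrow> 'm.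
        left_quotient \<theta> i (w (\<lambda>v. z (Inl v))) (map (\<lambda>l. z (Inl (Inl l))) [0..<n]) (map (\<lambda>l. z (Inr l)) [0..<n]))"
      using definable_subst[OF definable_left_quotient[OF \<theta>(1), of i], of ?h] by (simp add: w_def[abs_def])
    then show ?thesis
      unfolding R_def[abs_def]
      by (intro definable_ex definable_conj definable_on_tuple[OF \<chi>] definable_tuple_append definable_tuple_vars_upt)
  qed
  moreover have "depends_on (R i) (Inl ` {..<n} \<union> Inr ` (Inl ` K i \<union> Inr ` (SIGMA i':{..<i}. K i')))" for i
    unfolding depends_on_def
  proof (intro allI impI)
    fix s s' :: "nat + (nat + nat \<times> nat) + nat \<times> (nat + nat \<times> nat) \<Rightarrow> 'm"
    assume eq: "\<forall>v\<in>Inl ` {..<n} \<union> Inr ` (Inl ` K i \<union> Inr ` (SIGMA i':{..<i}. K i')). s v = s' v"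
    have "map (\<lambda>l. s (Inl l)) [0..<n] = map (\<lambda>l. s' (Inl l)) [0..<n]"
      "map (\<lambda>l. s (Inr (Inl (Inl l)))) [0..<m] = map (\<lambda>l. s' (Inr (Inl (Inl l)))) [0..<m]"
      using eq by (auto simp: K_def)
    moreover have "w s j = w s' j" if "j < i" for j
      using eq that by (auto simp: w_def K_def)
    then have "left_quotient \<theta> i (w s) x z = left_quotient \<theta> i (w s') x z" for x z by (rule left_quotient_cong)
    ultimately show "R i s = R i s'" unfolding R_def by (simp only:)
  qed
  moreover have "finite (K i)" for i by (simp add: K_def)
  ultimately obtain N where N: "\<And>x. \<exists>i<N. \<not> (R i (row_asg t x i 0) \<and> \<not> R i (row_asg t x i 1))"
    using strongly2_dependent_no_pattern[OF strong t, of K R n] by auto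
  \<comment> \<open>\<open>T k\<close> is the product of the last \<open>k\<close> of the \<open>N\<close> factors, and \<open>y i\<close> the product of those from \<open>i\<close> on.\<close>
  define T where "T = rec_nat \<one> (\<lambda>k p. c (N - Suc k) \<otimes> p)"
  define y where "y i = T (N - i)" for i
  have T: "T k \<in> F (N - k)" if "k \<le> N" for k
    using that
  proof (induction k)
    case 0 show ?case by (simp add: T_def F(2))
  next
    case (Suc k)
    then have "N - k = Suc (N - Suc k)" by simp
    with Suc have "T k \<in> F (N - Suc k)" using F(4)[of "N - Suc k"] by auto
    then show ?case using F(3) c[of "N - Suc k"] by (simp add: T_def)
  qed
  have yF: "y i \<in> F i" if "i \<le> N" for i using T[of "N - i"] that by (simp add: y_def)
  have y_carrier: "y i \<in> carrier G" for i
    using yF[of i] F(1,2) by (cases "i \<le> N") (auto simp: y_def T_def)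
  have y_Suc: "y i = c i \<otimes> y (Suc i)" if "i < N" for i
  proof -
    have "N - i = Suc (N - Suc i)" "N - Suc (N - Suc i) = i" using that by auto
    then show ?thesis unfolding y_def T_def by simp
  qed
  have c_carrier: "c i \<in> carrier G" for i using c[of i] F(1)[of i] by auto
  define x where "x = (!) (y 0)"
  have R_iff: "R i (row_asg t x i j) \<longleftrightarrow> \<chi> i (y i @ \<alpha> (pos i j))" if "i < N" for i j
  proof -
    have lq: "left_quotient \<theta> i c (y 0) z \<longleftrightarrow> z = y i" if "length z = n" for z
      by (rule left_quotient_iff[where N = N, OF \<theta>]) (use c_carrier y_carrier y_Suc \<open>i < N\<close> that in auto)
    have "w (row_asg t x i j) = c" by (simp add: fun_eq_iff w_def row_asg_def c_def)
    moreover have "map (\<lambda>l. row_asg t x i j (Inl l)) [0..<n] = y 0"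
      using list_as_map[OF carrier_length[OF y_carrier[of 0]]] by (simp add: row_asg_def x_def)
    moreover have "map (\<lambda>l. row_asg t x i j (Inr (Inl (Inl l)))) [0..<m] = \<alpha> (pos i j)"
      by (simp add: row_asg_def \<alpha>_def)
    ultimately have "R i (row_asg t x i j) \<longleftrightarrow> (\<exists>f :: nat \<Rightarrow> 'm. left_quotient \<theta> i c (y 0) (map (\<lambda>l. f l) [0..<n]) \<and>
        \<chi> i (map (\<lambda>l. f l) [0..<n] @ \<alpha> (pos i j)))"
      unfolding R_def by simp
    also have "\<dots> \<longleftrightarrow> (\<exists>f :: nat \<Rightarrow> 'm. map (\<lambda>l. f l) [0..<n] = y i \<and> \<chi> i (y i @ \<alpha> (pos i j)))"
      by (auto simp: lq cong: conj_cong)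
    also have "\<dots> \<longleftrightarrow> \<chi> i (y i @ \<alpha> (pos i j))"
      using list_as_map[OF carrier_length[OF y_carrier[of i]]] by auto
    finally show ?thesis .
  qed
  obtain i where "i < N" "\<not> (R i (row_asg t x i 0) \<and> \<not> R i (row_asg t x i 1))" using N by auto
  then show False using R_iff[of i] sep[OF yF[of "Suc i"]] y_Suc[of i] by simp
qed

end

section \<open>Uniformly type definable subgroups\<close>

lemma strict_mono_on_into_finite:
  fixes A :: "'a :: linorder set" and B :: "'b :: linorder set"
  assumes "finite A" "finite B" "card A \<le> card B"
  obtains h where "strict_mono_on A h" "h ` A \<subseteq> B"
proof
  define h where "h x = sorted_list_of_set B ! card {y \<in> A. y < x}" for x
  have less: "card {y \<in> A. y < x} < card B" if "x \<in> A" for x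
  proof -
    have "card {y \<in> A. y < x} < card A" using that assms(1) by (intro psubset_card_mono) auto
    then show ?thesis using assms(3) by simp
  qed
  show "strict_mono_on A h"
  proof (rule strict_mono_onI)
    fix x y assume "x \<in> A" "y \<in> A" "x < y"
    then have "card {z \<in> A. z < x} < card {z \<in> A. z < y}"
      using assms(1) by (intro psubset_card_mono) auto
    then show "h x < h y" unfolding h_def
      using less[OF \<open>y \<in> A\<close>] by (intro sorted_wrt_nth_less[OF strict_sorted_list_of_set]) simp_all
  qed
  show "h ` A \<subseteq> B"
  proof (rule image_subsetI)
    fix x assume "x \<in> A"
    then have "h x \<in> set (sorted_list_of_set B)" unfolding h_def using less by (intro nth_mem) simp
    then show "h x \<in> B" using assms(2) by simp
  qed
qed

definition realizes :: "'a \<Rightarrow> ('a \<Rightarrow> bool) set \<Rightarrow> bool" where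
  "realizes x P \<longleftrightarrow> (\<forall>\<psi>\<in>P. \<psi> x)"

lemma realizesD: "realizes x P \<Longrightarrow> \<psi> \<in> P \<Longrightarrow> \<psi> x"
  unfolding realizes_def by (rule bspec[where P = "\<lambda>\<psi>. \<psi> x"])

lemma realizesI: "(\<And>\<psi>. \<psi> \<in> P \<Longrightarrow> \<psi> x) \<Longrightarrow> realizes x P"
  unfolding realizes_def by (rule ballI)

context fo_structure
begin

lemma indisc_mono:
  fixes t :: "'i :: linorder \<times> 'c \<Rightarrow> 'm"
  assumes "indisc A UNIV t" shows "indisc A C t"
  unfolding indisc_def
proof (intro allI impI)
  fix R :: "('i \<times> 'c \<Rightarrow> 'm) \<Rightarrow> bool" and F and h :: "'i \<Rightarrow> 'i"
  assume "definable A R" "finite F" "depends_on R (F \<times> C)" "strict_mono_on F h"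
  moreover have "depends_on R (F \<times> UNIV)"
    by (rule depends_on_mono[OF \<open>depends_on R (F \<times> C)\<close>]) auto
  ultimately show "R (t \<circ> map_prod h id) = R t"
    by (intro indiscD[OF assms])
qed

lemma indisc_mono_params:
  assumes "indisc A C t" "B \<subseteq> A" shows "indisc B C t"
  unfolding indisc_def
  by (intro allI impI) (rule indiscD[OF assms(1) definable_mono[OF _ assms(2)]])

lemma em_type_tuple:
  assumes em: "em_type A r t" and R: "definable_on A (length vs) R"
    and F: "finite F" "fst ` set vs \<subseteq> F"
    and r: "\<And>g. strict_mono_on F g \<Longrightarrow> R (map (\<lambda>(p, c). r (g p, c)) vs)"
  shows "R (map t vs)"
proof (rule em_typeD[OF em, of "\<lambda>s. R (map s vs)", OF _ F(1)])
  show "definable A (\<lambda>s. R (map s vs))"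
    using definable_on_tuple[OF R definable_tuple_vars[of A vs "\<lambda>l. l"]] by simp
  show "depends_on (\<lambda>s. R (map s vs)) (F \<times> UNIV)"
    unfolding depends_on_def using F(2) by (intro allI impI arg_cong[where f = R]) (auto simp: subset_iff)
  show "R (map (r \<circ> map_prod g id) vs)" if "strict_mono_on F g" for g
    using r[OF that] by (simp add: o_def map_prod_def case_prod_unfold)
qed

definition cell :: "nat \<Rightarrow> ('i \<times> nat \<Rightarrow> 'm) \<Rightarrow> 'i \<Rightarrow> 'm list" where
  "cell m t p = map (\<lambda>l. t (p, l)) [0..<m]"

lemma length_cell [simp]: "length (cell m t p) = m"
  by (simp add: cell_def)

text \<open>
  Inclusions between intersections of type definable sets are studied one formula at a time: on the
  left stands one formula, and below the whole type, at each parameter in \<open>F\<close>.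
\<close>

definition implied :: "nat \<Rightarrow> nat \<Rightarrow> ('i \<times> nat \<Rightarrow> 'm) \<Rightarrow> 'i set \<Rightarrow> ('m list \<Rightarrow> bool) \<Rightarrow> ('m list \<Rightarrow> bool) \<Rightarrow> 'i \<Rightarrow> bool" where
  "implied n m t F \<chi> \<psi> q \<longleftrightarrow>
     (\<forall>x. length x = n \<longrightarrow> (\<forall>p\<in>F. \<chi> (x @ cell m t p)) \<longrightarrow> \<psi> (x @ cell m t q))"

definition implied_by_type :: "nat \<Rightarrow> nat \<Rightarrow> ('i \<times> nat \<Rightarrow> 'm) \<Rightarrow> ('m list \<Rightarrow> bool) set \<Rightarrow> 'i set \<Rightarrow> ('m list \<Rightarrow> bool) \<Rightarrow> 'i \<Rightarrow> bool" where
  "implied_by_type n m t P F \<psi> q \<longleftrightarrow>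
     (\<forall>x. length x = n \<longrightarrow> (\<forall>p\<in>F. realizes (x @ cell m t p) P) \<longrightarrow> \<psi> (x @ cell m t q))"

lemma impliedD:
  "implied n m t F \<chi> \<psi> q \<Longrightarrow> length x = n \<Longrightarrow> (\<And>p. p \<in> F \<Longrightarrow> \<chi> (x @ cell m t p)) \<Longrightarrow> \<psi> (x @ cell m t q)"
  unfolding implied_def by simp

lemma implied_imp_by_type: "implied n m t F \<chi> \<psi> q \<Longrightarrow> \<chi> \<in> P \<Longrightarrow> implied_by_type n m t P F \<psi> q"
  unfolding implied_def implied_by_type_def using realizesD by fast

lemma implied_iff_fun:
  "implied n m t F \<chi> \<psi> q \<longleftrightarrow> (\<forall>y. (\<forall>p\<in>F. \<chi> (map (\<lambda>l. y l) [0..<n] @ map (\<lambda>l. t (p, l)) [0..<m])) \<longrightarrow>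
     \<psi> (map (\<lambda>l. y l) [0..<n] @ map (\<lambda>l. t (q, l)) [0..<m]))"
proof
  assume "implied n m t F \<chi> \<psi> q"
  then show "\<forall>y. (\<forall>p\<in>F. \<chi> (map (\<lambda>l. y l) [0..<n] @ map (\<lambda>l. t (p, l)) [0..<m])) \<longrightarrow>
     \<psi> (map (\<lambda>l. y l) [0..<n] @ map (\<lambda>l. t (q, l)) [0..<m])"
    unfolding implied_def cell_def by simp
next
  assume *: "\<forall>y. (\<forall>p\<in>F. \<chi> (map (\<lambda>l. y l) [0..<n] @ map (\<lambda>l. t (p, l)) [0..<m])) \<longrightarrow>
     \<psi> (map (\<lambda>l. y l) [0..<n] @ map (\<lambda>l. t (q, l)) [0..<m])"
  show "implied n m t F \<chi> \<psi> q"
    unfolding implied_def cell_def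
  proof (intro allI impI)
    fix x assume "length x = n" "\<forall>p\<in>F. \<chi> (x @ map (\<lambda>l. t (p, l)) [0..<m])"
    then show "\<psi> (x @ map (\<lambda>l. t (q, l)) [0..<m])"
      using *[rule_format, of "\<lambda>l. x ! l"] list_as_map[of x n] by simp
  qed
qed

lemma implied_transfer:
  assumes t: "indisc B {..<m} t" and \<chi>: "definable_on B (n + m) \<chi>" and \<psi>: "definable_on B (n + m) \<psi>"
    and F: "finite F" and h: "strict_mono_on (insert q F) h"
  shows "implied n m t (h ` F) \<chi> \<psi> (h q) \<longleftrightarrow> implied n m t F \<chi> \<psi> q"
proof -
  define R where "R s \<longleftrightarrow> implied n m s F \<chi> \<psi> q" for s
  have "definable B R"
    unfolding R_def implied_iff_fun
    by (intro definable_all definable_imp definable_ball F definable_on_tuple[OF \<chi>] definable_on_tuple[OF \<psi>]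
        definable_tuple_append definable_tuple_vars_upt)
  moreover have "depends_on R (insert q F \<times> {..<m})"
    unfolding depends_on_def
  proof (intro allI impI)
    fix s s' :: "'a \<times> nat \<Rightarrow> 'm" assume "\<forall>v\<in>insert q F \<times> {..<m}. s v = s' v"
    then have "cell m s p = cell m s' p" if "p \<in> insert q F" for p
      using that by (auto simp: cell_def)
    then show "R s = R s'" unfolding R_def implied_def by simp
  qed
  ultimately have "R (t \<circ> map_prod h id) = R t"
    using F h by (intro indiscD[OF t]) auto
  then show ?thesis by (simp add: R_def implied_def cell_def)
qed

end

context monster
begin

lemma implied_by_type_compact:
  assumes B: "small B" and P: "\<And>\<chi>. \<chi> \<in> P \<Longrightarrow> definable_on B (n + m) \<chi>" "P \<noteq> {}"
      "\<And>\<chi> \<chi>'. \<chi> \<in> P \<Longrightarrow> \<chi>' \<in> P \<Longrightarrow> \<exists>\<eta>\<in>P. \<forall>x. \<eta> x \<longrightarrow> \<chi> x \<and> \<chi>' x"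
    and \<psi>: "definable_on B (n + m) \<psi>" and F: "finite F" and imp: "implied_by_type n m t P F \<psi> q"
  shows "\<exists>\<chi>\<in>P. implied n m t F \<chi> \<psi> q"
proof -
  define A where "A = B \<union> (\<Union>p\<in>insert q F. set (cell m t p))"
  have A: "small A" unfolding A_def using F by (intro small_Un B countable_finite) auto
  have BA: "B \<subseteq> A" by (simp add: A_def)
  have cells: "definable_tuple A m (\<lambda>s. cell m t p)" if "p \<in> insert q F" for p
    using that by (intro definable_tuple_const_len) (auto simp: A_def)
  define R where "R y \<longleftrightarrow> \<not> \<psi> (map (\<lambda>l. y l) [0..<n] @ cell m t q)" for y :: "nat \<Rightarrow> 'm"
  define Q where "Q \<chi> y \<longleftrightarrow> (\<forall>p\<in>F. \<chi> (map (\<lambda>l. y l) [0..<n] @ cell m t p))" for \<chi> and y :: "nat \<Rightarrow> 'm"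
  have "\<exists>\<chi>\<in>P. \<forall>y. R y \<longrightarrow> \<not> Q \<chi> y"
  proof (rule compactness_directed[OF A])
    show "definable A R" unfolding R_def
      by (intro definable_Not definable_on_tuple[OF definable_on_mono[OF \<psi> BA]]
          definable_tuple_append definable_tuple_vars_upt cells) simp
    show "definable A (Q \<chi>)" if "\<chi> \<in> P" for \<chi> unfolding Q_def
      by (intro definable_ball F definable_on_tuple[OF definable_on_mono[OF P(1)[OF that] BA]]
          definable_tuple_append definable_tuple_vars_upt cells) simp
    show "\<exists>\<eta>\<in>P. \<forall>s. Q \<eta> s \<longrightarrow> Q \<chi> s \<and> Q \<chi>' s" if "\<chi> \<in> P" "\<chi>' \<in> P" for \<chi> \<chi>'
      using P(3)[OF that] unfolding Q_def by auto
    show False if R: "R y" and Q: "\<And>\<chi>. \<chi> \<in> P \<Longrightarrow> Q \<chi> y" for y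
    proof -
      have "realizes (map (\<lambda>l. y l) [0..<n] @ cell m t p) P" if "p \<in> F" for p
      proof (rule realizesI)
        fix \<chi> assume "\<chi> \<in> P"
        from Q[OF this] show "\<chi> (map (\<lambda>l. y l) [0..<n] @ cell m t p)" using that by (simp add: Q_def)
      qed
      then show False using imp R unfolding implied_by_type_def R_def by simp
    qed
  qed (rule P(2))
  then obtain \<chi> where \<chi>: "\<chi> \<in> P" "\<And>y. R y \<Longrightarrow> \<not> Q \<chi> y" by auto
  have "implied n m t F \<chi> \<psi> q"
    unfolding implied_iff_fun using \<chi>(2) unfolding R_def Q_def cell_def by auto
  then show ?thesis using \<chi>(1) by (rule bexI)
qed

text \<open>
  By indiscernibility it only matters how many parameters there are before \<open>q\<close>, and the finite part
  \<open>\<chi>\<close> of the type can be chosen for all of them at once.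
\<close>

lemma implied_by_type_card:
  fixes t :: "'i :: linorder \<times> nat \<Rightarrow> 'm"
  assumes t: "indisc B {..<m} t"
    and B: "small B" and P: "\<And>\<chi>. \<chi> \<in> P \<Longrightarrow> definable_on B (n + m) \<chi>" "P \<noteq> {}"
      "\<And>\<chi> \<chi>'. \<chi> \<in> P \<Longrightarrow> \<chi>' \<in> P \<Longrightarrow> \<exists>\<eta>\<in>P. \<forall>x. \<eta> x \<longrightarrow> \<chi> x \<and> \<chi>' x"
    and \<psi>: "definable_on B (n + m) \<psi>" and F: "finite F" "\<And>p. p \<in> F \<Longrightarrow> p < q"
    and imp: "implied_by_type n m t P F \<psi> q"
  shows "\<exists>\<chi>\<in>P. \<forall>F' q'. finite F' \<longrightarrow> card F \<le> card F' \<longrightarrow> (\<forall>p\<in>F'. p < q') \<longrightarrow> implied n m t F' \<chi> \<psi> q'"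
proof -
  from implied_by_type_compact[OF B P \<psi> F(1) imp]
  obtain \<chi> where \<chi>: "\<chi> \<in> P" "implied n m t F \<chi> \<psi> q" by (rule bexE)
  have "implied n m t F' \<chi> \<psi> q'" if F': "finite F'" "card F \<le> card F'" "\<forall>p\<in>F'. p < q'" for F' q'
  proof -
    obtain h where h: "strict_mono_on F h" "h ` F \<subseteq> F'"
      by (rule strict_mono_on_into_finite[OF F(1) F'(1,2)]) (rule that)
    have "q \<notin> F" using F(2) by auto
    have "strict_mono_on (insert q F) (h(q := q'))"
    proof (rule strict_mono_onI)
      fix x y assume xy: "x \<in> insert q F" "y \<in> insert q F" "x < y"
      then have "x \<in> F" using F(2)[of y] less_asym by auto
      moreover from this have "h x < q'" using h(2) F'(3) by auto
      ultimately show "(h(q := q')) x < (h(q := q')) y"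
        using xy h(1) \<open>q \<notin> F\<close> by (cases "y = q") (auto simp: strict_mono_on_def)
    qed
    from implied_transfer[OF t P(1)[OF \<chi>(1)] \<psi> F(1) this] \<chi>(2)
    have "implied n m t (h(q := q') ` F) \<chi> \<psi> ((h(q := q')) q)" by (rule iffD2)
    moreover have "h(q := q') ` F = h ` F" using \<open>q \<notin> F\<close> by auto
    ultimately have "implied n m t (h ` F) \<chi> \<psi> q'" by simp
    then show ?thesis using h(2) unfolding implied_def by (simp add: subset_iff)
  qed
  then show ?thesis by (intro bexI[OF _ \<chi>(1)] allI impI)
qed

end

text \<open>
  The members of \<open>P\<close> are the finite conjunctions of the type \<open>p(x, y)\<close>. The functions \<open>g\<close> and \<open>h\<close>
  describe a modulus of continuity for the division: quotients of elements satisfying \<open>g \<eta>\<close>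
  satisfy \<open>\<eta>\<close>, as long as they satisfy \<open>h \<eta>\<close>.
\<close>

locale uniform_subgroups = definable_group L M G B n \<Theta> \<nu>
  for L :: "('f, 'r) language" and M :: "('f, 'r, 'm) fo_struct" and G :: "'m list monoid" (structure)
    and B n \<Theta> \<nu> +
  fixes m :: nat and P :: "('m list \<Rightarrow> bool) set"
    and g :: "('m list \<Rightarrow> bool) \<Rightarrow> 'm list \<Rightarrow> bool" and h :: "('m list \<Rightarrow> bool) \<Rightarrow> 'm list \<Rightarrow> bool"
  assumes P_definable: "\<psi> \<in> P \<Longrightarrow> definable_on B (n + m) \<psi>"
    and P_nonempty: "P \<noteq> {}"
    and P_directed: "\<psi> \<in> P \<Longrightarrow> \<psi>' \<in> P \<Longrightarrow> \<exists>\<eta>\<in>P. \<forall>x. \<eta> x \<longrightarrow> \<psi> x \<and> \<psi>' x"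
    and P_entails: "\<theta> \<in> \<Theta> \<Longrightarrow> \<exists>\<psi>\<in>P. \<forall>x \<alpha>. length x = n \<longrightarrow> length \<alpha> = m \<longrightarrow> \<psi> (x @ \<alpha>) \<longrightarrow> \<theta> x"
    and g: "\<eta> \<in> P \<Longrightarrow> g \<eta> \<in> P" and h: "\<eta> \<in> P \<Longrightarrow> h \<eta> \<in> \<Theta>"
    and one_params: "set \<one> \<subseteq> B"
begin

definition H :: "'m list \<Rightarrow> 'm list set" where
  "H \<alpha> = {x. length x = n \<and> realizes (x @ \<alpha>) P}"

definition controlled :: "('m list \<Rightarrow> bool) \<Rightarrow> 'm list \<Rightarrow> bool" where
  "controlled \<eta> \<alpha> \<longleftrightarrow> (\<forall>s. g \<eta> (block s 0 @ \<alpha>) \<longrightarrow> g \<eta> (block s 1 @ \<alpha>) \<longrightarrow> h \<eta> (block s 2) \<longrightarrow>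
     \<nu> (block s 2 @ block s 1 @ block s 0) \<longrightarrow> \<eta> (block s 2 @ \<alpha>))"

text \<open>
  Makes \<open>H \<alpha>\<close> a subgroup, with the prescribed moduli. Unlike being a subgroup, this is a
  conjunction of definable conditions on \<open>\<alpha>\<close>, hence inherited by the members of an extracted
  indiscernible sequence.
\<close>

definition good :: "'m list \<Rightarrow> bool" where
  "good \<alpha> \<longleftrightarrow> length \<alpha> = m \<and> (\<forall>\<eta>\<in>P. controlled \<eta> \<alpha>) \<and> realizes (\<one> @ \<alpha>) P"

lemma H_D: "x \<in> H \<alpha> \<Longrightarrow> \<psi> \<in> P \<Longrightarrow> \<psi> (x @ \<alpha>)" "x \<in> H \<alpha> \<Longrightarrow> length x = n"
  unfolding H_def by (elim CollectE conjE realizesD, assumption) simp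

lemma H_I: "length x = n \<Longrightarrow> (\<And>\<psi>. \<psi> \<in> P \<Longrightarrow> \<psi> (x @ \<alpha>)) \<Longrightarrow> x \<in> H \<alpha>"
  unfolding H_def by (intro CollectI conjI realizesI)

lemma H_subset: "length \<alpha> = m \<Longrightarrow> H \<alpha> \<subseteq> carrier G"
proof
  fix x assume \<alpha>: "length \<alpha> = m" and x: "x \<in> H \<alpha>"
  show "x \<in> carrier G"
  proof (rule carrierI)
    fix \<theta> assume "\<theta> \<in> \<Theta>"
    from P_entails[OF this] obtain \<psi> where \<psi>: "\<psi> \<in> P"
      "\<forall>x \<alpha>. length x = n \<longrightarrow> length \<alpha> = m \<longrightarrow> \<psi> (x @ \<alpha>) \<longrightarrow> \<theta> x" by (rule bexE)
    show "\<theta> x" by (rule \<psi>(2)[rule_format, OF H_D(2)[OF x] \<alpha> H_D(1)[OF x \<psi>(1)]])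
  qed (rule H_D(2)[OF x])
qed

lemma controlledD:
  assumes "controlled \<eta> \<alpha>" "length y = n" "length f = n" "length z = n"
    "g \<eta> (y @ \<alpha>)" "g \<eta> (f @ \<alpha>)" "h \<eta> z" "\<nu> (z @ f @ y)"
  shows "\<eta> (z @ \<alpha>)"
proof -
  define s where "s = (\<lambda>(b, l). [y, f, z] ! b ! l)"
  have b: "block s 0 = y" "block s 1 = f" "block s 2 = z"
    using assms by (simp_all add: s_def list_as_map)
  show ?thesis
    using assms(1)[unfolded controlled_def, rule_format, of s] assms(5-) unfolding b by simp
qed

lemma controlledI:
  assumes "\<And>y f z. length y = n \<Longrightarrow> length f = n \<Longrightarrow> length z = n \<Longrightarrow>
    g \<eta> (y @ \<alpha>) \<Longrightarrow> g \<eta> (f @ \<alpha>) \<Longrightarrow> h \<eta> z \<Longrightarrow> \<nu> (z @ f @ y) \<Longrightarrow> \<eta> (z @ \<alpha>)"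
  shows "controlled \<eta> \<alpha>"
  unfolding controlled_def by (intro allI impI) (rule assms, simp_all)

lemma definable_controlled:
  assumes "\<eta> \<in> P" shows "definable_on B m (controlled \<eta>)"
  unfolding controlled_def
  by (intro definable_onI definable_all definable_imp definable_\<nu> subset_refl
      definable_on_tuple[OF P_definable[OF g[OF assms]]] definable_on_tuple[OF P_definable[OF assms]]
      definable_on_tuple[OF \<Theta>_definable[OF h[OF assms]]] definable_tuple_append definable_tuple_vars_upt)

lemma good_length: "good \<alpha> \<Longrightarrow> length \<alpha> = m"
  and good_one: "good \<alpha> \<Longrightarrow> \<eta> \<in> P \<Longrightarrow> \<eta> (\<one> @ \<alpha>)"
  and good_controlled: "good \<alpha> \<Longrightarrow> \<eta> \<in> P \<Longrightarrow> controlled \<eta> \<alpha>"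
  unfolding good_def by (simp, elim conjE realizesD, assumption, simp)

lemma good_div:
  assumes "good \<alpha>" "\<eta> \<in> P" "y \<in> carrier G" "f \<in> carrier G" "g \<eta> (y @ \<alpha>)" "g \<eta> (f @ \<alpha>)"
  shows "\<eta> ((y \<otimes> inv f) @ \<alpha>)"
proof (rule controlledD[OF good_controlled[OF assms(1,2)]])
  show "\<nu> ((y \<otimes> inv f) @ f @ y)" using assms(3,4) by (simp add: \<nu>_iff m_assoc)
  show "h \<eta> (y \<otimes> inv f)" by (rule carrier_\<Theta>[OF _ h]) (use assms in auto)
  show "length (y \<otimes> inv f) = n" by (rule carrier_length) (use assms in auto)
qed (use assms carrier_length in auto)

text \<open>
  Multiply by dividing by the inverse, which itself is \<open>\<one>\<close> divided by the element; therefore the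
  modulus is applied twice.
\<close>

lemma mult_modulus:
  assumes "\<eta> \<in> P"
  shows "\<exists>\<chi>\<in>P. \<forall>\<alpha>. good \<alpha> \<longrightarrow> (\<forall>y\<in>carrier G. \<forall>f\<in>carrier G. \<chi> (y @ \<alpha>) \<longrightarrow> \<chi> (f @ \<alpha>) \<longrightarrow> \<eta> ((y \<otimes> f) @ \<alpha>))"
proof -
  obtain \<chi> where \<chi>: "\<chi> \<in> P" "\<And>x. \<chi> x \<Longrightarrow> g \<eta> x" "\<And>x. \<chi> x \<Longrightarrow> g (g \<eta>) x"
    using P_directed[OF g[OF assms] g[OF g[OF assms]]] by auto
  have "\<eta> ((y \<otimes> f) @ \<alpha>)"
    if \<alpha>: "good \<alpha>" and yf: "y \<in> carrier G" "f \<in> carrier G" "\<chi> (y @ \<alpha>)" "\<chi> (f @ \<alpha>)" for \<alpha> y f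
  proof -
    have "g \<eta> ((\<one> \<otimes> inv f) @ \<alpha>)"
      by (rule good_div[OF \<alpha> g[OF assms]])
        (use yf \<chi>(3) good_one[OF \<alpha> g[OF g[OF assms]]] in auto)
    then have "\<eta> ((y \<otimes> inv (inv f)) @ \<alpha>)"
      by (intro good_div[OF \<alpha> assms]) (use yf \<chi>(2) in auto)
    then show ?thesis using yf by simp
  qed
  then show ?thesis using \<chi>(1) by (intro bexI[of _ \<chi>]) auto
qed

lemma H_one: "good \<alpha> \<Longrightarrow> \<one> \<in> H \<alpha>"
  by (rule H_I) (auto simp: carrier_length good_one)

lemma H_mult:
  assumes "good \<alpha>" "x \<in> H \<alpha>" "y \<in> H \<alpha>" shows "x \<otimes> y \<in> H \<alpha>"
proof (rule H_I)
  have xy: "x \<in> carrier G" "y \<in> carrier G" using H_subset[OF good_length] assms by auto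
  then show "length (x \<otimes> y) = n" by (simp add: carrier_length)
  fix \<psi> assume "\<psi> \<in> P"
  from mult_modulus[OF this] obtain \<chi> where \<chi>: "\<chi> \<in> P" "\<forall>\<alpha>. good \<alpha> \<longrightarrow> (\<forall>y\<in>carrier G. \<forall>f\<in>carrier G.
    \<chi> (y @ \<alpha>) \<longrightarrow> \<chi> (f @ \<alpha>) \<longrightarrow> \<psi> ((y \<otimes> f) @ \<alpha>))" by (rule bexE)
  show "\<psi> ((x \<otimes> y) @ \<alpha>)"
    by (rule \<chi>(2)[rule_format, OF assms(1) xy]) (rule H_D(1)[OF _ \<chi>(1)], rule assms)+
qed

lemma em_type_good:
  assumes em: "em_type A r t" and "B \<subseteq> A" and r: "\<And>k. good (map (\<lambda>l. r (k, \<kappa> l)) [0..<m])"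
  shows "good (map (\<lambda>l. t (q, \<kappa> l)) [0..<m])"
  unfolding good_def
proof (intro conjI ballI realizesI)
  fix \<eta> assume \<eta>: "\<eta> \<in> P"
  let ?vs = "map (\<lambda>l. (q, \<kappa> l)) [0..<m]"
  have r': "map (\<lambda>(p, c). r (f p, c)) ?vs = map (\<lambda>l. r (f q, \<kappa> l)) [0..<m]" for f by simp
  have "controlled \<eta> (map t ?vs)"
  proof (rule em_type_tuple[OF em, where F = "{q}"])
    show "definable_on A (length ?vs) (controlled \<eta>)"
      using definable_on_mono[OF definable_controlled[OF \<eta>] \<open>B \<subseteq> A\<close>] by simp
    show "controlled \<eta> (map (\<lambda>(p, c). r (f p, c)) ?vs)" for f
      unfolding r' by (rule good_controlled[OF r \<eta>])
  qed auto
  then show "controlled \<eta> (map (\<lambda>l. t (q, \<kappa> l)) [0..<m])" by (simp add: o_def)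
next
  fix \<eta> assume \<eta>: "\<eta> \<in> P"
  let ?vs = "map (\<lambda>l. (q, \<kappa> l)) [0..<m]"
  have r': "map (\<lambda>(p, c). r (f p, c)) ?vs = map (\<lambda>l. r (f q, \<kappa> l)) [0..<m]" for f by simp
  have "\<eta> (\<one> @ map t ?vs)"
  proof (rule em_type_tuple[OF em, where R = "\<lambda>\<alpha>. \<eta> (\<one> @ \<alpha>)" and F = "{q}"])
    have "definable_on A m (\<lambda>\<alpha>. \<eta> (\<one> @ \<alpha>))"
      by (intro definable_onI definable_on_tuple[OF definable_on_mono[OF P_definable[OF \<eta>] \<open>B \<subseteq> A\<close>]]
          definable_tuple_append definable_tuple_vars_upt definable_tuple_const_len)
        (use one_params \<open>B \<subseteq> A\<close> carrier_length in auto)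
    then show "definable_on A (length ?vs) (\<lambda>\<alpha>. \<eta> (\<one> @ \<alpha>))" by simp
    show "\<eta> (\<one> @ map (\<lambda>(p, c). r (f p, c)) ?vs)" for f
      unfolding r' by (rule good_one[OF r \<eta>])
  qed auto
  then show "\<eta> (\<one> @ map (\<lambda>l. t (q, \<kappa> l)) [0..<m])" by (simp add: o_def)
qed simp

text \<open>
  The case where one formula \<open>\<psi>\<close> excludes every \<open>c k\<close> from \<open>H (a k)\<close>. In the extracted array the
  element in column 1 of row \<open>i\<close> lies in the groups of all earlier entries, column 0 of its own row
  included. The modulus \<open>g \<psi>\<close> separates: a factor in \<open>H\<close> cannot bring an element violating \<open>\<psi>\<close>
  back into \<open>g \<psi>\<close>.
\<close>

lemma no_strict_chain:
  fixes a c :: "nat \<Rightarrow> 'm list"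
  assumes a: "\<And>k. good (a k)" and \<psi>: "\<psi> \<in> P" and len: "\<And>k. length (c k) = n"
    and c: "\<And>k j. j < k \<Longrightarrow> c k \<in> H (a j)" and not: "\<And>k. \<not> \<psi> (c k @ a k)"
  shows False
proof -
  define r where "r = (\<lambda>(k :: nat, v). case v of Inl l \<Rightarrow> a k ! l | Inr (i :: nat, l) \<Rightarrow> c k ! l)"
  have ra: "map (\<lambda>l. r (k, Inl l)) [0..<m] = a k" for k
    using list_as_map[OF good_length[OF a]] by (simp add: r_def)
  have rc: "map (\<lambda>l. r (k, Inr (i, l))) [0..<n] = c k" for k i
    using list_as_map[OF len] by (simp add: r_def)
  obtain t :: "rat \<times> (nat + nat \<times> nat) \<Rightarrow> 'm" where t: "indisc B UNIV t" and em: "em_type B r t"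
    using extract_indiscernible[OF small_B, of r] by (elim exE conjE)
  define \<alpha> where "\<alpha> q = map (\<lambda>l. t (q, Inl l)) [0..<m]" for q
  define C where "C i q = map (\<lambda>l. t (q, Inr (i, l))) [0..<n]" for i q
  have good: "good (\<alpha> q)" for q
    unfolding \<alpha>_def by (rule em_type_good[OF em subset_refl]) (simp add: ra a)
  have C_len: "length (C i q) = n" for i q by (simp add: C_def)
  have C_H: "C i q \<in> H (\<alpha> q')" if "q' < q" for i q q'
  proof (rule H_I[OF C_len])
    fix \<chi> assume \<chi>: "\<chi> \<in> P"
    have "\<chi> (map t (map (\<lambda>l. (q, Inr (i, l))) [0..<n] @ map (\<lambda>l. (q', Inl l)) [0..<m]))"
    proof (rule em_type_tuple[OF em, where F = "{q', q}"])
      fix f :: "rat \<Rightarrow> nat" assume "strict_mono_on {q', q} f"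
      then have "f q' < f q" using that by (auto simp: strict_mono_on_def)
      then have "\<chi> (c (f q) @ a (f q'))" by (intro H_D(1)[OF c \<chi>])
      then show "\<chi> (map (\<lambda>(p, c). r (f p, c)) (map (\<lambda>l. (q, Inr (i, l))) [0..<n] @ map (\<lambda>l. (q', Inl l)) [0..<m]))"
        by (simp add: o_def ra rc)
    qed (use P_definable[OF \<chi>] in auto)
    then show "\<chi> (C i q @ \<alpha> q')" by (simp add: C_def \<alpha>_def o_def)
  qed
  have C_not: "\<not> \<psi> (C i q @ \<alpha> q)" for i q
  proof -
    have "\<not> \<psi> (map t (map (\<lambda>l. (q, Inr (i, l))) [0..<n] @ map (\<lambda>l. (q, Inl l)) [0..<m]))"
      by (rule em_type_tuple[OF em, where F = "{q}" and R = "\<lambda>x. \<not> \<psi> x"])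
        (use definable_on_Not[OF P_definable[OF \<psi>]] not in \<open>auto simp: o_def ra rc\<close>)
    then show ?thesis by (simp add: C_def \<alpha>_def o_def)
  qed
  define F where "F i = carrier G \<inter> (\<Inter>j<i. H (\<alpha> (pos j 0)) \<inter> H (\<alpha> (pos j 1)))" for i
  show False
  proof (rule no_separated_cosets[OF t, where m = m and F = F and \<chi> = "\<lambda>_. g \<psi>", folded \<alpha>_def C_def])
    show "F i \<subseteq> carrier G" "\<one> \<in> F i" for i
      by (auto simp: F_def intro: H_one good)
    show "x \<otimes> y \<in> F i" if "x \<in> F i" "y \<in> F i" for i x y
      using that by (auto simp: F_def intro: H_mult good)
    show "F (Suc i) \<subseteq> F i" for i by (auto simp: F_def)
    show "C i (pos i 1) \<in> F i" for i
    proof -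
      have "C i (pos i 1) \<in> H (\<alpha> (pos i 0))" by (intro C_H pos_less_col) simp
      then have "C i (pos i 1) \<in> carrier G" using H_subset[OF good_length[OF good]] by auto
      moreover have "C i (pos i 1) \<in> H (\<alpha> (pos j k))" if "j < i" for j k
        by (intro C_H pos_less_row that)
      ultimately show ?thesis by (auto simp: F_def)
    qed
    show "definable_on B (n + m) (g \<psi>)" by (rule P_definable[OF g[OF \<psi>]])
  next
    fix i f assume f: "f \<in> F (Suc i)"
    let ?c = "C i (pos i 1)"
    have f01: "f \<in> H (\<alpha> (pos i 0))" "f \<in> H (\<alpha> (pos i 1))" and fc: "f \<in> carrier G"
      using f by (auto simp: F_def)
    have c0: "?c \<in> H (\<alpha> (pos i 0))" by (intro C_H pos_less_col) simp
    then have cc: "?c \<in> carrier G" using H_subset[OF good_length[OF good]] by auto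
    have "g \<psi> ((?c \<otimes> f) @ \<alpha> (pos i 0))"
      by (rule H_D(1)[OF H_mult[OF good c0 f01(1)] g[OF \<psi>]])
    moreover have "\<not> g \<psi> ((?c \<otimes> f) @ \<alpha> (pos i 1))"
    proof
      assume "g \<psi> ((?c \<otimes> f) @ \<alpha> (pos i 1))"
      then have "\<psi> ((?c \<otimes> f \<otimes> inv f) @ \<alpha> (pos i 1))"
        by (intro good_div[OF good \<psi>]) (use cc fc H_D(1)[OF f01(2) g[OF \<psi>]] in auto)
      then show False using C_not[of i "pos i 1"] cc fc by (simp add: m_assoc)
    qed
    ultimately show "g \<psi> ((?c \<otimes> f) @ \<alpha> (pos i 0)) \<and> \<not> g \<psi> ((?c \<otimes> f) @ \<alpha> (pos i 1))" by (rule conjI)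
  qed
qed

end

context uniform_subgroups
begin

lemma realizes_iff_H: "length x = n \<Longrightarrow> realizes (x @ \<alpha>) P \<longleftrightarrow> x \<in> H \<alpha>"
  by (simp add: H_def)

lemma implied_by_type_iff_H:
  "implied_by_type n m t P F \<psi> q \<longleftrightarrow>
     (\<forall>x. length x = n \<longrightarrow> (\<forall>p\<in>F. x \<in> H (cell m t p)) \<longrightarrow> \<psi> (x @ cell m t q))"
  unfolding implied_by_type_def by (simp add: realizes_iff_H cong: imp_cong)

text \<open>
  Either some formula of \<open>P\<close> is never implied by the earlier groups, which is the previous case, or
  each formula is implied by a finite number of them. In the latter case the formulas \<open>\<psi>\<^sub>i\<close> must vary
  with the row, since each of them can tell apart only a bounded number of groups.
\<close>

lemma no_strict_intersections:
  fixes t0 :: "rat \<times> nat \<Rightarrow> 'm"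
  assumes t0: "indisc B UNIV t0" and good0: "\<And>q. good (cell m t0 q)"
    and strict: "\<And>k :: nat. \<exists>x. length x = n \<and> (\<forall>j<k. x \<in> H (cell m t0 (of_nat j))) \<and> x \<notin> H (cell m t0 (of_nat k))"
  shows False
proof -
  define imp where "imp F \<psi> q \<longleftrightarrow> implied_by_type n m t0 P F \<psi> q" for F \<psi> q
  \<comment> \<open>Membership in \<open>k\<close> earlier groups suffices for \<open>\<psi>\<close>.\<close>
  define ic where "ic k \<psi> \<longleftrightarrow> imp (of_nat ` {..<k}) \<psi> (of_nat k)" for k :: nat and \<psi>
  have witness: "\<exists>\<chi>\<in>P. \<forall>F' q'. finite F' \<longrightarrow> card F \<le> card F' \<longrightarrow> (\<forall>p\<in>F'. p < q') \<longrightarrow> implied n m t0 F' \<chi> \<psi> q'"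
    if "\<psi> \<in> P" "finite F" "\<And>p. p \<in> F \<Longrightarrow> p < q" "imp F \<psi> q" for F \<psi> q
    by (rule implied_by_type_card[OF indisc_mono[OF t0] small_B P_definable P_nonempty P_directed
          P_definable[OF that(1)] that(2,3) that(4)[unfolded imp_def]])
  have imp_card: "imp F' \<psi> q'"
    if "\<psi> \<in> P" "finite F" "\<And>p. p \<in> F \<Longrightarrow> p < q" "imp F \<psi> q" and F': "finite F'" "card F \<le> card F'" "\<And>p. p \<in> F' \<Longrightarrow> p < q'"
    for F \<psi> q F' q'
  proof -
    from witness[OF that(1-4)] obtain \<chi> where \<chi>: "\<chi> \<in> P"
      "\<forall>F' q'. finite F' \<longrightarrow> card F \<le> card F' \<longrightarrow> (\<forall>p\<in>F'. p < q') \<longrightarrow> implied n m t0 F' \<chi> \<psi> q'" by (rule bexE)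
    have "implied n m t0 F' \<chi> \<psi> q'" by (rule \<chi>(2)[rule_format, OF F'(1,2)]) (rule F'(3))
    then show ?thesis unfolding imp_def using \<chi>(1) by (rule implied_imp_by_type)
  qed
  have ball_of_nat: "(\<forall>p\<in>of_nat ` {..<k}. Q p) \<longleftrightarrow> (\<forall>j<k. Q (of_nat j))" for k and Q :: "rat \<Rightarrow> bool"
    by auto
  have card_nat: "card (of_nat ` {..<k} :: rat set) = k" for k
    by (simp add: card_image inj_on_def)
  have ic_iff: "imp F \<psi> q \<longleftrightarrow> ic (card F) \<psi>" if "\<psi> \<in> P" "finite F" "\<And>p. p \<in> F \<Longrightarrow> p < q" for F \<psi> q
    unfolding ic_def
    by (rule iffI; rule imp_card[OF that(1)]) (use that in \<open>auto simp: card_nat\<close>)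
  have ic_mono: "ic k' \<psi>" if "\<psi> \<in> P" "ic k \<psi>" "k \<le> k'" for k k' \<psi>
    using that(2) unfolding ic_def by (rule imp_card[OF that(1), rotated 2]) (use that in \<open>auto simp: card_nat\<close>)
  have ic_witness: "\<exists>\<chi>\<in>P. \<forall>F' q'. finite F' \<longrightarrow> k \<le> card F' \<longrightarrow> (\<forall>p\<in>F'. p < q') \<longrightarrow> implied n m t0 F' \<chi> \<psi> q'"
    if "\<psi> \<in> P" "ic k \<psi>" for k \<psi>
    by (rule witness[OF that(1) _ _ that(2)[unfolded ic_def], unfolded card_nat]) auto
  have strict': "\<exists>\<psi>\<in>P. \<not> ic k \<psi>" for k
  proof (rule ccontr)
    assume *: "\<not> (\<exists>\<psi>\<in>P. \<not> ic k \<psi>)"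
    obtain x where x: "length x = n" "\<forall>j<k. x \<in> H (cell m t0 (of_nat j))" "x \<notin> H (cell m t0 (of_nat k))"
      using strict by auto
    have "x \<in> H (cell m t0 (of_nat k))"
    proof (rule H_I[OF x(1)])
      fix \<psi> assume "\<psi> \<in> P"
      then have "ic k \<psi>" using * by simp
      then show "\<psi> (x @ cell m t0 (of_nat k))"
        using x unfolding ic_def imp_def implied_by_type_iff_H by simp
    qed
    then show False using x(3) by simp
  qed
  show False
  proof (cases "\<exists>\<psi>\<in>P. \<forall>k. \<not> ic k \<psi>")
    case True
    then obtain \<psi> where \<psi>: "\<psi> \<in> P" "\<forall>k. \<not> ic k \<psi>" by (rule bexE)
    have "\<forall>k. \<exists>x. length x = n \<and> (\<forall>j<k. x \<in> H (cell m t0 (of_nat j))) \<and> \<not> \<psi> (x @ cell m t0 (of_nat k))"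
      using \<psi>(2) unfolding ic_def imp_def implied_by_type_iff_H ball_of_nat by simp
    then obtain c where c: "\<forall>k. length (c k) = n \<and> (\<forall>j<k. c k \<in> H (cell m t0 (of_nat j))) \<and> \<not> \<psi> (c k @ cell m t0 (of_nat k))"
      by (rule choice[THEN exE])
    show False
      by (rule no_strict_chain[of "\<lambda>k. cell m t0 (of_nat k)" \<psi> c]) (use c good0 \<psi>(1) in auto)
  next
    case False
    then have bounded: "\<exists>k. ic k \<psi>" if "\<psi> \<in> P" for \<psi> using that by auto
    \<comment> \<open>The data of one row: \<open>s + 2\<close> groups suffice for \<open>\<psi>\<close> and \<open>s + 1\<close> do not; already the formula
      \<open>\<eta>\<close> at \<open>s + 2\<close> parameters implies \<open>\<psi>\<close>; and \<open>\<chi>\<close> is a modulus for multiplying into \<open>g \<eta>\<close>.\<close>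
    define valid where "valid s \<psi> \<eta> \<chi> \<longleftrightarrow> \<psi> \<in> P \<and> \<eta> \<in> P \<and> \<chi> \<in> P \<and> \<not> ic (Suc s) \<psi> \<and>
        (\<forall>F q. finite F \<longrightarrow> s + 2 \<le> card F \<longrightarrow> (\<forall>p\<in>F. p < q) \<longrightarrow> implied n m t0 F \<eta> \<psi> q) \<and>
        (\<forall>\<alpha>. good \<alpha> \<longrightarrow> (\<forall>y\<in>carrier G. \<forall>f\<in>carrier G. \<chi> (y @ \<alpha>) \<longrightarrow> \<chi> (f @ \<alpha>) \<longrightarrow> g \<eta> ((y \<otimes> f) @ \<alpha>)))"
      for s \<psi> \<eta> \<chi>
    have step: "\<exists>s \<psi> \<eta> \<chi>. valid s \<psi> \<eta> \<chi> \<and> s0 \<le> s" for s0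
    proof -
      from strict'[of "Suc s0"] obtain \<psi> where \<psi>: "\<psi> \<in> P" "\<not> ic (Suc s0) \<psi>" by (rule bexE)
      define k where "k = (LEAST k. ic k \<psi>)"
      have k: "ic k \<psi>" unfolding k_def using bounded[OF \<psi>(1)] by (rule LeastI_ex)
      have "Suc s0 < k" using ic_mono[OF \<psi>(1) k, of "Suc s0"] \<psi>(2) by (cases "Suc s0 < k") auto
      define s where "s = k - 2"
      have s: "k = s + 2" "s0 \<le> s" using \<open>Suc s0 < k\<close> by (simp_all add: s_def)
      have notic: "\<not> ic (Suc s) \<psi>" using not_less_Least[of "Suc s" "\<lambda>k. ic k \<psi>"] s by (simp add: k_def)
      from ic_witness[OF \<psi>(1) k] obtain \<eta> where \<eta>: "\<eta> \<in> P"
        "\<forall>F' q'. finite F' \<longrightarrow> k \<le> card F' \<longrightarrow> (\<forall>p\<in>F'. p < q') \<longrightarrow> implied n m t0 F' \<eta> \<psi> q'"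
        by (rule bexE)
      from mult_modulus[OF g[OF \<eta>(1)]] obtain \<chi> where \<chi>: "\<chi> \<in> P" "\<forall>\<alpha>. good \<alpha> \<longrightarrow> (\<forall>y\<in>carrier G. \<forall>f\<in>carrier G.
          \<chi> (y @ \<alpha>) \<longrightarrow> \<chi> (f @ \<alpha>) \<longrightarrow> g \<eta> ((y \<otimes> f) @ \<alpha>))" by (rule bexE)
      have "valid s \<psi> \<eta> \<chi>"
        unfolding valid_def using \<psi>(1) \<eta>(1) \<chi>(1) notic \<eta>(2)[unfolded s(1)] \<chi>(2) by (intro conjI)
      then show ?thesis using s(2) by (intro exI conjI)
    qed
    define good_state where "good_state x = (case x of (s, \<psi>, \<eta>, \<chi>) \<Rightarrow> valid s \<psi> \<eta> \<chi>)" for x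
    \<comment> \<open>The number of fixed groups for the next row is so large that they imply the modulus of this row.\<close>
    have "\<exists>x. \<forall>i. good_state (x i) \<and> fst (x i) \<le> fst (x (Suc i)) \<and> ic (fst (x (Suc i))) (snd (snd (snd (x i))))"
    proof (rule dependent_nat_choice)
      from step[of 0] obtain s \<psi> \<eta> \<chi> where "valid s \<psi> \<eta> \<chi>" by (elim exE conjE)
      then have "good_state (s, \<psi>, \<eta>, \<chi>)" by (simp add: good_state_def)
      then show "\<exists>x. good_state x" by (rule exI)
    next
      fix x and i :: nat assume x: "good_state x"
      define \<chi>0 where "\<chi>0 = snd (snd (snd x))"
      have "\<chi>0 \<in> P" using x by (simp add: good_state_def valid_def \<chi>0_def case_prod_unfold)
      then obtain k where k: "ic k \<chi>0" using bounded by auto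
      from step[of "max k (fst x)"] obtain s \<psi> \<eta> \<chi> where v: "valid s \<psi> \<eta> \<chi>" "max k (fst x) \<le> s"
        by (elim exE conjE)
      have "ic s \<chi>0" by (rule ic_mono[OF \<open>\<chi>0 \<in> P\<close> k]) (use v(2) in simp)
      then have "good_state (s, \<psi>, \<eta>, \<chi>) \<and> fst x \<le> fst (s, \<psi>, \<eta>, \<chi>) \<and> ic (fst (s, \<psi>, \<eta>, \<chi>)) (snd (snd (snd x)))"
        using v by (simp add: good_state_def \<chi>0_def)
      then show "\<exists>y. good_state y \<and> fst x \<le> fst y \<and> ic (fst y) (snd (snd (snd x)))" by (rule exI)
    qed
    then obtain x where x: "\<And>i. good_state (x i)" "\<And>i. fst (x i) \<le> fst (x (Suc i))"
      "\<And>i. ic (fst (x (Suc i))) (snd (snd (snd (x i))))" by auto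
    define s where "s i = fst (x i)" for i
    define \<psi> where "\<psi> i = fst (snd (x i))" for i
    define \<eta> where "\<eta> i = fst (snd (snd (x i)))" for i
    define \<chi> where "\<chi> i = snd (snd (snd (x i)))" for i
    have valid: "valid (s i) (\<psi> i) (\<eta> i) (\<chi> i)" for i
      using x(1)[of i] by (simp add: good_state_def s_def \<psi>_def \<eta>_def \<chi>_def case_prod_unfold)
    have P: "\<psi> i \<in> P" "\<eta> i \<in> P" "\<chi> i \<in> P" for i using valid[of i] by (simp_all add: valid_def)
    have not_ic: "\<not> ic (Suc (s i)) (\<psi> i)" for i using valid[of i] by (simp add: valid_def)
    have \<eta>: "implied n m t0 F (\<eta> i) (\<psi> i) q" if "finite F" "s i + 2 \<le> card F" "\<forall>p\<in>F. p < q" for i F q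
      using valid[of i] that unfolding valid_def by simp
    have \<chi>: "g (\<eta> i) ((y \<otimes> f) @ \<alpha>)"
      if "good \<alpha>" "y \<in> carrier G" "f \<in> carrier G" "\<chi> i (y @ \<alpha>)" "\<chi> i (f @ \<alpha>)" for i \<alpha> y f
      using valid[of i] that unfolding valid_def by simp
    have s: "s i \<le> s (Suc i)" "ic (s (Suc i)) (\<chi> i)" for i using x(2,3)[of i] by (simp_all add: s_def \<chi>_def)
    \<comment> \<open>The fixed groups sit at the negative integers, before all rows.\<close>
    define fl :: "nat \<Rightarrow> rat" where "fl j = - of_nat (Suc j)" for j
    define \<Phi> where "\<Phi> k = fl ` {..<k}" for k
    have fl_neg: "fl j < pos k l" for j k l
      using pos_bounds(1)[of k l] of_nat_0_le_iff[of k, where 'a = rat] by (simp add: fl_def)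
    have \<Phi>: "finite (\<Phi> k)" "card (\<Phi> k) = k" "\<And>p l i. p \<in> \<Phi> k \<Longrightarrow> p < pos i l" for k
      using fl_neg by (auto simp: \<Phi>_def card_image inj_on_def fl_def)
    have \<Phi>_notin: "pos i l \<notin> \<Phi> k" for i l k using \<Phi>(3)[of "pos i l" k i l] by auto
    have "\<exists>x. length x = n \<and> (\<forall>p\<in>\<Phi> (s i). x \<in> H (cell m t0 p)) \<and> x \<in> H (cell m t0 (pos k 0)) \<and>
        \<not> \<psi> i (x @ cell m t0 (pos k 1))" for i k
    proof -
      let ?F = "insert (pos k 0) (\<Phi> (s i))"
      have "card ?F = Suc (s i)" using \<Phi>(1,2) \<Phi>_notin by simp
      moreover have "p < pos k 1" if "p \<in> ?F" for p
        using that \<Phi>(3) pos_less_col[of 0 1 k] by auto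
      ultimately have "\<not> imp ?F (\<psi> i) (pos k 1)"
        using ic_iff[OF P(1)[of i], of ?F "pos k 1"] \<Phi>(1) not_ic[of i] by simp
      then show ?thesis unfolding imp_def implied_by_type_iff_H by auto
    qed
    then have "\<forall>i. \<forall>k. \<exists>x. length x = n \<and> (\<forall>p\<in>\<Phi> (s i). x \<in> H (cell m t0 p)) \<and> x \<in> H (cell m t0 (pos k 0)) \<and>
        \<not> \<psi> i (x @ cell m t0 (pos k 1))" by simp
    then obtain c where c: "\<And>i k. length (c i k) = n" "\<And>i k p. p \<in> \<Phi> (s i) \<Longrightarrow> c i k \<in> H (cell m t0 p)"
      "\<And>i k. c i k \<in> H (cell m t0 (pos k 0))" "\<And>i k. \<not> \<psi> i (c i k @ cell m t0 (pos k 1))"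
      by metis
    have c_not: "\<not> \<eta> i (c i k' @ cell m t0 (pos k 0))" if "k < k'" for i k k'
    proof
      assume *: "\<eta> i (c i k' @ cell m t0 (pos k 0))"
      let ?F = "insert (pos k 0) (insert (pos k' 0) (\<Phi> (s i)))"
      have "pos k 0 \<noteq> pos k' 0" using that by (simp add: pos_eq_iff)
      then have "card ?F = s i + 2" using \<Phi>(1,2) \<Phi>_notin by simp
      then have "implied n m t0 ?F (\<eta> i) (\<psi> i) (pos k' 1)"
        using \<Phi>(1,3) that by (intro \<eta>) (auto intro: pos_less_row pos_less_col)
      then have "\<psi> i (c i k' @ cell m t0 (pos k' 1))"
        by (rule impliedD) (use c H_D(1)[OF _ P(2)] * in auto)
      then show False using c(4) by simp
    qed
    \<comment> \<open>The entries of the rows are to be indiscernible over the fixed groups as well.\<close>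
    define A where "A = B \<union> range t0"
    have A: "small A" "B \<subseteq> A" unfolding A_def by (auto intro: small_Un small_B)
    have cell_A: "definable_tuple A m (\<lambda>s. cell m t0 p)" for p
      by (intro definable_tuple_const_len) (auto simp: A_def cell_def)
    define r where "r = (\<lambda>(k :: nat, v). case v of Inl l \<Rightarrow> t0 (pos k 0, l) | Inr (i :: nat, l) \<Rightarrow> c i k ! l)"
    have ra: "map (\<lambda>l. r (k, Inl l)) [0..<m] = cell m t0 (pos k 0)" for k
      by (simp add: r_def cell_def)
    have rc: "map (\<lambda>l. r (k, Inr (i, l))) [0..<n] = c i k" for k i
      using list_as_map[OF c(1)] by (simp add: r_def)
    obtain t :: "rat \<times> (nat + nat \<times> nat) \<Rightarrow> 'm" where t: "indisc A UNIV t" and em: "em_type A r t"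
      using extract_indiscernible[OF A(1), of r] by (elim exE conjE)
    define \<alpha> where "\<alpha> q = map (\<lambda>l. t (q, Inl l)) [0..<m]" for q
    define C where "C i q = map (\<lambda>l. t (q, Inr (i, l))) [0..<n]" for i q
    have good: "good (\<alpha> q)" for q
      unfolding \<alpha>_def by (rule em_type_good[OF em A(2)]) (simp add: ra good0)
    have C_len: "length (C i q) = n" for i q by (simp add: C_def)
    have P_A: "definable_on A (n + m) \<zeta>" if "\<zeta> \<in> P" for \<zeta>
      by (rule definable_on_mono[OF P_definable[OF that] A(2)])
    have C_H: "C i q \<in> H (\<alpha> q)" for i q
    proof (rule H_I[OF C_len])
      fix \<zeta> assume \<zeta>: "\<zeta> \<in> P"
      have "\<zeta> (map t (map (\<lambda>l. (q, Inr (i, l))) [0..<n] @ map (\<lambda>l. (q, Inl l)) [0..<m]))"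
        by (rule em_type_tuple[OF em, where F = "{q}"])
          (use P_A[OF \<zeta>] H_D(1)[OF c(3) \<zeta>] in \<open>auto simp: o_def ra rc\<close>)
      then show "\<zeta> (C i q @ \<alpha> q)" by (simp add: C_def \<alpha>_def o_def)
    qed
    have C_\<Phi>: "C i q \<in> H (cell m t0 p)" if "p \<in> \<Phi> (s i)" for i q p
    proof (rule H_I[OF C_len])
      fix \<zeta> assume \<zeta>: "\<zeta> \<in> P"
      have "definable_on A n (\<lambda>x. \<zeta> (x @ cell m t0 p))"
        by (intro definable_onI definable_on_tuple[OF P_A[OF \<zeta>]] definable_tuple_append
            definable_tuple_vars_upt cell_A)
      then have "\<zeta> (map t (map (\<lambda>l. (q, Inr (i, l))) [0..<n]) @ cell m t0 p)"
        by (intro em_type_tuple[OF em, where F = "{q}" and R = "\<lambda>x. \<zeta> (x @ cell m t0 p)"])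
          (use H_D(1)[OF c(2)[OF that] \<zeta>] in \<open>auto simp: o_def rc\<close>)
      then show "\<zeta> (C i q @ cell m t0 p)" by (simp add: C_def o_def)
    qed
    have C_not: "\<not> \<eta> i (C i q @ \<alpha> q')" if "q' < q" for i q q'
    proof -
      have "\<not> \<eta> i (map t (map (\<lambda>l. (q, Inr (i, l))) [0..<n] @ map (\<lambda>l. (q', Inl l)) [0..<m]))"
      proof (rule em_type_tuple[OF em, where F = "{q', q}" and R = "\<lambda>x. \<not> \<eta> i x"])
        fix f :: "rat \<Rightarrow> nat" assume "strict_mono_on {q', q} f"
        then have "f q' < f q" using that by (auto simp: strict_mono_on_def)
        then show "\<not> \<eta> i (map (\<lambda>(p, c). r (f p, c)) (map (\<lambda>l. (q, Inr (i, l))) [0..<n] @ map (\<lambda>l. (q', Inl l)) [0..<m]))"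
          by (simp add: o_def ra rc c_not)
      qed (use definable_on_Not[OF P_A[OF P(2)]] in auto)
      then show ?thesis by (simp add: C_def \<alpha>_def o_def)
    qed
    have \<chi>_\<Phi>: "\<chi> i (f @ \<alpha> q)" if f: "length f = n" "\<And>p. p \<in> \<Phi> (s (Suc i)) \<Longrightarrow> f \<in> H (cell m t0 p)" for i f q
    proof -
      from ic_witness[OF P(3) s(2)] obtain \<zeta> where \<zeta>: "\<zeta> \<in> P"
        "\<forall>F' q'. finite F' \<longrightarrow> s (Suc i) \<le> card F' \<longrightarrow> (\<forall>p\<in>F'. p < q') \<longrightarrow> implied n m t0 F' \<zeta> (\<chi> i) q'"
        by (rule bexE)
      define R where "R \<beta> \<longleftrightarrow> (\<forall>y :: nat \<Rightarrow> 'm. (\<forall>p\<in>\<Phi> (s (Suc i)). \<zeta> (map (\<lambda>l. y l) [0..<n] @ cell m t0 p)) \<longrightarrow>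
          \<chi> i (map (\<lambda>l. y l) [0..<n] @ \<beta>))" for \<beta>
      have "definable_on A m R"
        unfolding R_def[abs_def]
        by (intro definable_onI definable_all definable_imp definable_ball \<Phi>(1) definable_on_tuple[OF P_A[OF \<zeta>(1)]]
            definable_on_tuple[OF P_A[OF P(3)]] definable_tuple_append definable_tuple_vars_upt cell_A)
      moreover have "R (cell m t0 (pos k 0))" for k
      proof -
        have "implied n m t0 (\<Phi> (s (Suc i))) \<zeta> (\<chi> i) (pos k 0)"
          using \<Phi> by (intro \<zeta>(2)[rule_format]) simp_all
        then show ?thesis unfolding R_def implied_def by simp
      qed
      moreover have "map (\<lambda>(p, c). r (f' p, c)) (map (\<lambda>l. (q, Inl l)) [0..<m]) = cell m t0 (pos (f' q) 0)" for f'
        by (simp add: o_def ra)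
      ultimately have "R (map t (map (\<lambda>l. (q, Inl l)) [0..<m]))"
        by (intro em_type_tuple[OF em, where F = "{q}" and R = R]) (simp_all add: image_subset_iff)
      then have "R (\<alpha> q)" by (simp add: \<alpha>_def o_def)
      then show ?thesis
        unfolding R_def using list_as_map[OF f(1)] H_D(1)[OF f(2) \<zeta>(1)] by (elim allE[of _ "\<lambda>l. f ! l"]) simp
    qed
    define F where "F i = carrier G \<inter> (\<Inter>p\<in>\<Phi> (s i). H (cell m t0 p))" for i
    have mono: "\<Phi> (s i) \<subseteq> \<Phi> (s (Suc i))" for i using s(1)[of i] by (auto simp: \<Phi>_def)
    have C_carrier: "C i q \<in> carrier G" for i q
      using C_H H_subset[OF good_length[OF good]] by auto
    show False
    proof (rule no_separated_cosets[OF indisc_mono_params[OF t A(2)], where m = m and F = F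
          and \<chi> = "\<lambda>i x. \<not> g (\<eta> i) x", folded \<alpha>_def C_def])
      show "F i \<subseteq> carrier G" "\<one> \<in> F i" for i
        by (auto simp: F_def intro: H_one good0)
      show "x \<otimes> y \<in> F i" if "x \<in> F i" "y \<in> F i" for i x y
        using that by (auto simp: F_def intro: H_mult good0)
      show "F (Suc i) \<subseteq> F i" for i using mono[of i] by (auto simp: F_def)
      show "C i (pos i 1) \<in> F i" for i by (auto simp: F_def C_carrier C_\<Phi>)
      show "definable_on B (n + m) (\<lambda>x. \<not> g (\<eta> i) x)" for i
        by (intro definable_on_Not P_definable g P(2))
    next
      fix i f assume f: "f \<in> F (Suc i)"
      let ?c = "C i (pos i 1)"
      have fc: "f \<in> carrier G" using f by (simp add: F_def)
      have \<chi>f: "\<chi> i (f @ \<alpha> q)" for q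
        by (rule \<chi>_\<Phi>) (use f carrier_length in \<open>auto simp: F_def\<close>)
      have gf: "g (\<eta> i) (f @ \<alpha> q)" for q
        using \<chi>[OF good one_closed fc good_one[OF good P(3)] \<chi>f] fc by simp
      have "\<not> g (\<eta> i) ((?c \<otimes> f) @ \<alpha> (pos i 0))"
      proof
        assume "g (\<eta> i) ((?c \<otimes> f) @ \<alpha> (pos i 0))"
        then have "\<eta> i ((?c \<otimes> f \<otimes> inv f) @ \<alpha> (pos i 0))"
          by (intro good_div[OF good P(2)]) (use fc C_carrier gf in auto)
        then show False using C_not[of "pos i 0" "pos i 1" i] pos_less_col[of 0 1 i] C_carrier fc by (simp add: m_assoc)
      qed
      moreover have "g (\<eta> i) ((?c \<otimes> f) @ \<alpha> (pos i 1))"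
        by (rule \<chi>[OF good C_carrier fc H_D(1)[OF C_H P(3)] \<chi>f])
      ultimately show "\<not> g (\<eta> i) ((?c \<otimes> f) @ \<alpha> (pos i 0)) \<and> \<not> \<not> g (\<eta> i) ((?c \<otimes> f) @ \<alpha> (pos i 1))" by simp
    qed
  qed
qed

end

section \<open>Families of subgroups with indiscernible parameters\<close>

context fo_structure
begin

text \<open>
  A type need not be directed, which compactness asks for; its finite conjunctions are.
\<close>

definition conj_closure :: "('f, 'r, 'm) pformula set \<Rightarrow> ('m list \<Rightarrow> bool) set" where
  "conj_closure p = (\<lambda>q z. \<forall>\<psi>\<in>q. holds M (fst \<psi>) (z @ snd \<psi>)) ` {q. finite q \<and> q \<subseteq> p}"

lemma conj_closure_definable:
  assumes "type_over L k B p" "\<theta> \<in> conj_closure p" shows "definable_on B k \<theta>"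
proof -
  obtain q where q: "finite q" "q \<subseteq> p" "\<theta> = (\<lambda>z. \<forall>\<psi>\<in>q. holds M (fst \<psi>) (z @ snd \<psi>))"
    using assms(2) unfolding conj_closure_def by auto
  have def_q: "definable_on B k (\<lambda>z. holds M (fst \<psi>) (z @ snd \<psi>))" if "\<psi> \<in> q" for \<psi>
    using assms(1) q(2) that by (intro definable_on_holds) (auto simp: type_over_def)
  show ?thesis
    unfolding q(3)
    by (intro definable_onI definable_ball q(1)) (rule definable_on_tuple[OF def_q definable_tuple_vars_upt])
qed

lemma conj_closure_nonempty: "conj_closure p \<noteq> {}"
  unfolding conj_closure_def by auto

lemma conj_closure_directed:
  assumes "\<theta> \<in> conj_closure p" "\<theta>' \<in> conj_closure p"
  shows "\<exists>\<eta>\<in>conj_closure p. \<forall>x. \<eta> x \<longrightarrow> \<theta> x \<and> \<theta>' x"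
proof -
  obtain q q' where q: "finite q" "q \<subseteq> p" "\<theta> = (\<lambda>z. \<forall>\<psi>\<in>q. holds M (fst \<psi>) (z @ snd \<psi>))"
    and q': "finite q'" "q' \<subseteq> p" "\<theta>' = (\<lambda>z. \<forall>\<psi>\<in>q'. holds M (fst \<psi>) (z @ snd \<psi>))"
    using assms unfolding conj_closure_def by auto
  have "(\<lambda>z. \<forall>\<psi>\<in>q \<union> q'. holds M (fst \<psi>) (z @ snd \<psi>)) \<in> conj_closure p"
    unfolding conj_closure_def using q(1,2) q'(1,2) by (intro imageI) auto
  moreover have "\<forall>z. (\<forall>\<psi>\<in>q \<union> q'. holds M (fst \<psi>) (z @ snd \<psi>)) \<longrightarrow> \<theta> z \<and> \<theta>' z"
    unfolding q(3) q'(3) by auto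
  ultimately show ?thesis by (intro bexI)
qed

lemma realizes_conj_closure:
  "realizes z (conj_closure p) \<longleftrightarrow> (\<forall>\<psi>\<in>p. holds M (fst \<psi>) (z @ snd \<psi>))"
proof
  assume r: "realizes z (conj_closure p)"
  show "\<forall>\<psi>\<in>p. holds M (fst \<psi>) (z @ snd \<psi>)"
  proof
    fix \<psi> assume "\<psi> \<in> p"
    then have "(\<lambda>z. \<forall>\<psi>\<in>{\<psi>}. holds M (fst \<psi>) (z @ snd \<psi>)) \<in> conj_closure p"
      unfolding conj_closure_def by (intro imageI) auto
    from realizesD[OF r this] show "holds M (fst \<psi>) (z @ snd \<psi>)" by simp
  qed
next
  assume *: "\<forall>\<psi>\<in>p. holds M (fst \<psi>) (z @ snd \<psi>)"
  show "realizes z (conj_closure p)"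
  proof (rule realizesI)
    fix \<theta> assume "\<theta> \<in> conj_closure p"
    then obtain q where "finite q" "q \<subseteq> p" "\<theta> = (\<lambda>z. \<forall>\<psi>\<in>q. holds M (fst \<psi>) (z @ snd \<psi>))"
      unfolding conj_closure_def by auto
    then show "\<theta> z" using * by auto
  qed
qed

text \<open>
  Makes every set defined by \<open>P(x, y)\<close> a part of the one defined by \<open>\<Theta>(x)\<close>; it serves to cut the
  sets down to a subgroup that replaces the ambient group.
\<close>

definition restrict_to :: "nat \<Rightarrow> ('m list \<Rightarrow> bool) set \<Rightarrow> ('m list \<Rightarrow> bool) set \<Rightarrow> ('m list \<Rightarrow> bool) set" where
  "restrict_to n \<Theta> P = (\<lambda>(\<psi>, \<theta>) z. \<psi> z \<and> \<theta> (take n z)) ` (P \<times> \<Theta>)"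

lemma restrict_toE:
  assumes "\<eta> \<in> restrict_to n \<Theta> P"
  obtains \<psi> \<theta> where "\<eta> = (\<lambda>z. \<psi> z \<and> \<theta> (take n z))" "\<psi> \<in> P" "\<theta> \<in> \<Theta>"
  using assms unfolding restrict_to_def by auto

lemma restrict_toI: "\<psi> \<in> P \<Longrightarrow> \<theta> \<in> \<Theta> \<Longrightarrow> (\<lambda>z. \<psi> z \<and> \<theta> (take n z)) \<in> restrict_to n \<Theta> P"
  unfolding restrict_to_def by (rule image_eqI[of _ _ "(\<psi>, \<theta>)"]) auto

lemma restrict_to_nonempty: "P \<noteq> {} \<Longrightarrow> \<Theta> \<noteq> {} \<Longrightarrow> restrict_to n \<Theta> P \<noteq> {}"
  unfolding restrict_to_def by simp

lemma restrict_to_definable: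
  assumes "\<And>\<psi>. \<psi> \<in> P \<Longrightarrow> definable_on B (n + m) \<psi>" "\<And>\<theta>. \<theta> \<in> \<Theta> \<Longrightarrow> definable_on B n \<theta>"
    and "\<eta> \<in> restrict_to n \<Theta> P"
  shows "definable_on B (n + m) \<eta>"
proof -
  obtain \<psi> \<theta> where \<eta>: "\<eta> = (\<lambda>z. \<psi> z \<and> \<theta> (take n z))" "\<psi> \<in> P" "\<theta> \<in> \<Theta>"
    using assms(3) by (rule restrict_toE)
  have "definable B (\<lambda>s. \<psi> (map (\<lambda>l. s (h l)) [0..<n + m]) \<and> \<theta> (map (\<lambda>l. s (h l)) [0..<n]))" for h :: "nat \<Rightarrow> nat"
    by (intro definable_conj definable_on_tuple[OF assms(1)[OF \<eta>(2)]] definable_on_tuple[OF assms(2)[OF \<eta>(3)]]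
        definable_tuple_vars_upt)
  then show ?thesis unfolding \<eta>(1) by (intro definable_onI) (simp add: take_map)
qed

lemma restrict_to_directed:
  assumes "\<And>\<psi> \<psi>'. \<psi> \<in> P \<Longrightarrow> \<psi>' \<in> P \<Longrightarrow> \<exists>\<eta>\<in>P. \<forall>x. \<eta> x \<longrightarrow> \<psi> x \<and> \<psi>' x"
    and "\<And>\<theta> \<theta>'. \<theta> \<in> \<Theta> \<Longrightarrow> \<theta>' \<in> \<Theta> \<Longrightarrow> \<exists>\<eta>\<in>\<Theta>. \<forall>x. \<eta> x \<longrightarrow> \<theta> x \<and> \<theta>' x"
    and "\<rho> \<in> restrict_to n \<Theta> P" "\<rho>' \<in> restrict_to n \<Theta> P"
  shows "\<exists>\<eta>\<in>restrict_to n \<Theta> P. \<forall>x. \<eta> x \<longrightarrow> \<rho> x \<and> \<rho>' x"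
proof -
  obtain \<psi> \<theta> where \<rho>: "\<rho> = (\<lambda>z. \<psi> z \<and> \<theta> (take n z))" "\<psi> \<in> P" "\<theta> \<in> \<Theta>"
    using assms(3) by (rule restrict_toE)
  obtain \<psi>' \<theta>' where \<rho>': "\<rho>' = (\<lambda>z. \<psi>' z \<and> \<theta>' (take n z))" "\<psi>' \<in> P" "\<theta>' \<in> \<Theta>"
    using assms(4) by (rule restrict_toE)
  from assms(1)[OF \<rho>(2) \<rho>'(2)] obtain \<zeta> where \<zeta>: "\<zeta> \<in> P" "\<forall>x. \<zeta> x \<longrightarrow> \<psi> x \<and> \<psi>' x" by (rule bexE)
  from assms(2)[OF \<rho>(3) \<rho>'(3)] obtain \<kappa> where \<kappa>: "\<kappa> \<in> \<Theta>" "\<forall>x. \<kappa> x \<longrightarrow> \<theta> x \<and> \<theta>' x" by (rule bexE)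
  show ?thesis
    by (rule bexI[OF _ restrict_toI[OF \<zeta>(1) \<kappa>(1)]]) (simp add: \<rho>(1) \<rho>'(1) \<zeta>(2) \<kappa>(2))
qed

lemma restrict_to_entails:
  assumes "P \<noteq> {}" "\<theta> \<in> \<Theta>"
  shows "\<exists>\<psi>\<in>restrict_to n \<Theta> P. \<forall>x \<alpha>. length x = n \<longrightarrow> length \<alpha> = m \<longrightarrow> \<psi> (x @ \<alpha>) \<longrightarrow> \<theta> x"
proof -
  obtain \<psi> where "\<psi> \<in> P" using assms(1) by (auto simp: ex_in_conv[symmetric])
  then show ?thesis by (intro bexI[OF _ restrict_toI[OF _ assms(2)]]) simp_all
qed

lemma realizes_restrict_to:
  assumes "length x = n" "P \<noteq> {}" "\<Theta> \<noteq> {}"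
  shows "realizes (x @ \<alpha>) (restrict_to n \<Theta> P) \<longleftrightarrow> realizes (x @ \<alpha>) P \<and> realizes x \<Theta>"
proof
  assume r: "realizes (x @ \<alpha>) (restrict_to n \<Theta> P)"
  obtain \<psi>0 \<theta>0 where 0: "\<psi>0 \<in> P" "\<theta>0 \<in> \<Theta>" using assms(2,3) by (auto simp: ex_in_conv[symmetric])
  have both: "\<psi> (x @ \<alpha>) \<and> \<theta> x" if "\<psi> \<in> P" "\<theta> \<in> \<Theta>" for \<psi> \<theta>
    using realizesD[OF r restrict_toI[OF that]] assms(1) by simp
  have "realizes (x @ \<alpha>) P" by (rule realizesI) (rule both[THEN conjunct1, OF _ 0(2)])
  moreover have "realizes x \<Theta>" by (rule realizesI) (rule both[THEN conjunct2, OF 0(1)])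
  ultimately show "realizes (x @ \<alpha>) P \<and> realizes x \<Theta>" by (rule conjI)
next
  assume r: "realizes (x @ \<alpha>) P \<and> realizes x \<Theta>"
  show "realizes (x @ \<alpha>) (restrict_to n \<Theta> P)"
  proof (rule realizesI)
    fix \<eta> assume "\<eta> \<in> restrict_to n \<Theta> P"
    then obtain \<psi> \<theta> where \<eta>: "\<eta> = (\<lambda>z. \<psi> z \<and> \<theta> (take n z))" "\<psi> \<in> P" "\<theta> \<in> \<Theta>"
      by (rule restrict_toE)
    have "\<psi> (x @ \<alpha>)" "\<theta> x"
      using realizesD[OF conjunct1[OF r] \<eta>(2)] realizesD[OF conjunct2[OF r] \<eta>(3)] .
    then show "\<eta> (x @ \<alpha>)" using assms(1) by (simp add: \<eta>(1))
  qed
qed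

lemma solutions_iff_conj_closure:
  "x \<in> solutions M n p \<longleftrightarrow> length x = n \<and> realizes x (conj_closure p)"
  unfolding solutions_def realizes_conj_closure by auto

lemma solutions_plug_iff_conj_closure:
  "x \<in> solutions M n (plug a ` p) \<longleftrightarrow> length x = n \<and> realizes (x @ a) (conj_closure p)"
  unfolding solutions_def realizes_conj_closure plug_def by (auto simp: case_prod_unfold)

end

context monster
begin

text \<open>
  Inside the group \<open>S 0\<close> the parameters of the ambient group no longer occur, apart from the finite
  tuple \<open>e\<close>. Beyond some index \<open>K\<close> the type of \<open>a k\<close> over \<open>B\<close> and the finite tuple \<open>e @ a 0 @ \<one>\<close> is
  constant, so the moduli found at \<open>K\<close> are valid for all later indices and pass to an
  indiscernible sequence extracted from the tail.
\<close>

lemma subgroup_chain_stabilizes: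
  assumes strong: "strongly2_dependent L M" and grp: "type_definable_group L M G"
    and fam: "indiscernible_subgroup_family L M G n p a"
  shows "\<exists>k. \<forall>x. length x = n \<longrightarrow> (\<forall>j<k. x \<in> solutions M n (plug (a j) ` p)) \<longrightarrow> x \<in> solutions M n (plug (a k) ` p)"
proof (rule ccontr)
  assume neg: "\<not> ?thesis"
  define S where "S j = solutions M n (plug (a j) ` p)" for j
  have strict: "\<exists>x. length x = n \<and> (\<forall>j<k. x \<in> S j) \<and> x \<notin> S k" for k
    using neg unfolding S_def by auto
  define m where "m = length (a 0)"
  obtain B where B: "small B" and p: "type_over L (n + m) B p" and ind: "indiscernible L M B a"
    and sub: "\<And>i. subgroup (S i) G"
    using fam unfolding indiscernible_subgroup_family_def S_def m_def by auto
  obtain N where "\<forall>i. length (a i) = N" using ind unfolding indiscernible_def by auto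
  then have len: "length (a i) = m" for i by (simp add: m_def)
  obtain n' \<nu> e A where G: "group G" and \<nu>: "pformula_over L (n' + n' + n') A (\<nu>, e)"
    and carrier_len: "\<And>x. x \<in> carrier G \<Longrightarrow> length x = n'"
    and op: "\<And>x y z. x \<in> carrier G \<Longrightarrow> y \<in> carrier G \<Longrightarrow> z \<in> carrier G \<Longrightarrow>
      x \<otimes>\<^bsub>G\<^esub> y = z \<longleftrightarrow> holds M \<nu> (x @ y @ z @ e)"
    using grp unfolding type_definable_group_def by (auto simp: solutions_def)
  interpret G: group G by (rule G)
  have one: "\<one>\<^bsub>G\<^esub> \<in> S i" for i by (rule subgroup.one_closed[OF sub])
  have len_one: "length \<one>\<^bsub>G\<^esub> = n" using one[of 0] by (simp add: S_def solutions_def)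
  have n': "n' = n" using len_one carrier_len[OF G.one_closed] by simp
  define P where "P = conj_closure p"
  have S_iff: "x \<in> S j \<longleftrightarrow> length x = n \<and> realizes (x @ a j) P" for x j
    unfolding S_def P_def by (rule solutions_plug_iff_conj_closure)
  have P_def': "definable_on B (n + m) \<psi>" if "\<psi> \<in> P" for \<psi>
    using conj_closure_definable[OF p] that by (simp add: P_def)
  have P_dir: "\<exists>\<eta>\<in>P. \<forall>x. \<eta> x \<longrightarrow> \<psi> x \<and> \<psi>' x" if "\<psi> \<in> P" "\<psi>' \<in> P" for \<psi> \<psi>'
    using that unfolding P_def by (rule conj_closure_directed)
  have P_ne: "P \<noteq> {}" unfolding P_def by (rule conj_closure_nonempty)
  have ind': "indisc B {..<m} (\<lambda>(k, l). a k ! l)" by (rule indisc_of_indiscernible[OF ind len])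
  \<comment> \<open>All parameters of the group structure on \<open>S 0\<close>, apart from those of the type.\<close>
  define e' where "e' = e @ a 0 @ \<one>\<^bsub>G\<^esub>"
  obtain K where K: "\<And>R k k'. definable_on (B \<union> set e') m R \<Longrightarrow> K \<le> k \<Longrightarrow> K \<le> k' \<Longrightarrow> R (a k) = R (a k')"
    using eventually_constant_type[OF strong B ind' len, of e'] by auto
  define B2 where "B2 = B \<union> set e'"
  have B2: "small B2" unfolding B2_def by (intro small_Un B) (simp add: countable_finite)
  have BB2: "B \<subseteq> B2" by (simp add: B2_def)
  have P_B2: "definable_on B2 (n + m) \<psi>" if "\<psi> \<in> P" for \<psi>
    by (rule definable_on_mono[OF P_def'[OF that] BB2])
  define G0 where "G0 = G\<lparr>carrier := S 0\<rparr>"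
  have G0: "group G0" unfolding G0_def by (rule subgroup.subgroup_is_group[OF sub G])
  have G0_simps: "carrier G0 = S 0" "mult G0 = mult G" "one G0 = one G" by (simp_all add: G0_def)
  have S_carrier: "S i \<subseteq> carrier G" for i by (rule subgroup.subset[OF sub])
  define at0 where "at0 \<psi> x \<longleftrightarrow> \<psi> (x @ a 0)" for \<psi> :: "'m list \<Rightarrow> bool" and x
  define \<Theta> where "\<Theta> = at0 ` P"
  define \<nu>' where "\<nu>' z = holds M \<nu> (z @ e)" for z
  have a0_tuple: "definable_tuple B2 m (\<lambda>s. a 0)"
    by (intro definable_tuple_const_len) (auto simp: B2_def e'_def len)
  have at0_def': "definable_on B2 n (at0 \<psi>)" if "\<psi> \<in> P" for \<psi>
    unfolding at0_def
    by (intro definable_onI definable_on_tuple[OF P_B2[OF that]] definable_tuple_append definable_tuple_vars_upt a0_tuple)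
  have \<nu>_B2: "definable_on B2 (n + n + n) \<nu>'"
  proof -
    have "pformula_over L (n + n + n) B2 (\<nu>, e)"
      using \<nu> by (auto simp: pformula_over_def n' B2_def e'_def)
    from definable_on_holds[OF this] show ?thesis by (simp add: \<nu>'_def[abs_def])
  qed
  have S0_iff: "x \<in> S 0 \<longleftrightarrow> length x = n \<and> realizes x \<Theta>" for x
  proof -
    have "realizes x \<Theta> \<longleftrightarrow> realizes (x @ a 0) P"
      unfolding realizes_def \<Theta>_def at0_def by (rule ball_simps)
    then show ?thesis by (simp add: S_iff)
  qed
  have \<Theta>_def': "definable_on B2 n \<theta>" if "\<theta> \<in> \<Theta>" for \<theta>
  proof -
    obtain \<psi> where "\<theta> = at0 \<psi>" "\<psi> \<in> P" using \<open>\<theta> \<in> \<Theta>\<close> unfolding \<Theta>_def by (rule imageE)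
    then show ?thesis using at0_def' by simp
  qed
  have \<Theta>_dir: "\<exists>\<eta>\<in>\<Theta>. \<forall>x. \<eta> x \<longrightarrow> \<theta> x \<and> \<theta>' x" if \<theta>: "\<theta> \<in> \<Theta>" "\<theta>' \<in> \<Theta>" for \<theta> \<theta>'
  proof -
    obtain \<psi> where \<psi>: "\<theta> = at0 \<psi>" "\<psi> \<in> P" using \<theta>(1) unfolding \<Theta>_def by (rule imageE)
    obtain \<psi>' where \<psi>': "\<theta>' = at0 \<psi>'" "\<psi>' \<in> P" using \<theta>(2) unfolding \<Theta>_def by (rule imageE)
    from P_dir[OF \<psi>(2) \<psi>'(2)] obtain \<eta> where "\<eta> \<in> P" "\<forall>x. \<eta> x \<longrightarrow> \<psi> x \<and> \<psi>' x" by (rule bexE)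
    then show ?thesis unfolding \<psi>(1) \<psi>'(1) \<Theta>_def at0_def by (intro bexI[of _ "at0 \<eta>"]) (auto simp: at0_def[abs_def])
  qed
  have \<nu>_op: "\<nu>' (x @ y @ z) \<longleftrightarrow> x \<otimes>\<^bsub>G0\<^esub> y = z" if "x \<in> carrier G0" "y \<in> carrier G0" "z \<in> carrier G0" for x y z
    using that op[of x y z] S_carrier[of 0] unfolding G0_simps \<nu>'_def by (auto simp: subset_iff)
  have carrier0: "carrier G0 = {x. length x = n \<and> (\<forall>\<theta>\<in>\<Theta>. \<theta> x)}"
    by (rule Set.set_eqI) (simp only: mem_Collect_eq G0_simps S0_iff realizes_def)
  have \<Theta>_ne: "\<Theta> \<noteq> {}" using P_ne by (simp add: \<Theta>_def)
  note grp0 = definable_group.intro[OF monster_axioms G0 definable_group_axioms.intro[OF strong B2 carrier0 \<Theta>_def' \<Theta>_ne \<Theta>_dir \<nu>_B2 \<nu>_op]]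
  define P2 where "P2 = restrict_to n \<Theta> P"
  have P2_def': "definable_on B2 (n + m) \<psi>" if "\<psi> \<in> P2" for \<psi>
    by (rule restrict_to_definable) (use that P_B2 \<Theta>_def' in \<open>simp_all add: P2_def\<close>)
  have P2_ne: "P2 \<noteq> {}" unfolding P2_def by (rule restrict_to_nonempty[OF P_ne \<Theta>_ne])
  have P2_dir: "\<exists>\<eta>\<in>P2. \<forall>x. \<eta> x \<longrightarrow> \<psi> x \<and> \<psi>' x" if "\<psi> \<in> P2" "\<psi>' \<in> P2" for \<psi> \<psi>'
    using that unfolding P2_def by (rule restrict_to_directed[rotated 2]) (rule P_dir \<Theta>_dir, assumption+)+
  have P2_entails: "\<exists>\<psi>\<in>P2. \<forall>x \<alpha>. length x = n \<longrightarrow> length \<alpha> = m \<longrightarrow> \<psi> (x @ \<alpha>) \<longrightarrow> \<theta> x" if "\<theta> \<in> \<Theta>" for \<theta>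
    unfolding P2_def by (rule restrict_to_entails[OF P_ne that])
  have P2_iff: "realizes (x @ \<alpha>) P2 \<longleftrightarrow> realizes (x @ \<alpha>) P \<and> x \<in> S 0" if x: "length x = n" for x \<alpha>
    unfolding P2_def S0_iff using realizes_restrict_to[OF x P_ne \<Theta>_ne] x by simp
  define U where "U \<eta> \<chi> \<theta> \<alpha> \<longleftrightarrow> (\<forall>s :: nat \<times> nat \<Rightarrow> 'm.
      \<chi> (map (\<lambda>l. s (0, l)) [0..<n] @ \<alpha>) \<longrightarrow> \<chi> (map (\<lambda>l. s (1, l)) [0..<n] @ \<alpha>) \<longrightarrow>
      \<theta> (map (\<lambda>l. s (2, l)) [0..<n]) \<longrightarrow>
      \<nu>' (map (\<lambda>l. s (2, l)) [0..<n] @ map (\<lambda>l. s (1, l)) [0..<n] @ map (\<lambda>l. s (0, l)) [0..<n]) \<longrightarrow>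
      \<eta> (map (\<lambda>l. s (2, l)) [0..<n] @ \<alpha>))" for \<eta> \<chi> \<theta> :: "'m list \<Rightarrow> bool" and \<alpha>
  have U_def': "definable_on B2 m (U \<eta> \<chi> \<theta>)" if "\<eta> \<in> P2" "\<chi> \<in> P2" "\<theta> \<in> \<Theta>" for \<eta> \<chi> \<theta>
    unfolding U_def[abs_def]
    by (intro definable_onI definable_all definable_imp definable_on_tuple[OF P2_def'[OF that(1)]]
        definable_on_tuple[OF P2_def'[OF that(2)]] definable_on_tuple[OF \<Theta>_def'[OF that(3)]]
        definable_on_tuple[OF \<nu>_B2[unfolded add.assoc]] definable_tuple_append definable_tuple_vars_upt)
  have "\<exists>\<chi>\<theta>. \<chi>\<theta> \<in> P2 \<times> \<Theta> \<and> U \<eta> (fst \<chi>\<theta>) (snd \<chi>\<theta>) (a K)" if \<eta>: "\<eta> \<in> P2" for \<eta>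
  proof -
    define A' where "A' = B2 \<union> set (a K)"
    have A': "small A'" "B2 \<subseteq> A'" unfolding A'_def using B2 by (auto intro!: small_Un countable_finite)
    have aK: "definable_tuple A' m (\<lambda>s. a K)" by (intro definable_tuple_const_len) (auto simp: A'_def len)
    let ?b = "\<lambda>i s. map (\<lambda>l. s (i :: nat, l)) [0..<n] :: 'm list"
    define R where "R s \<longleftrightarrow> \<nu>' (?b 2 s @ ?b 1 s @ ?b 0 s) \<and> \<not> \<eta> (?b 2 s @ a K)" for s
    define Q where "Q \<chi>\<theta> s \<longleftrightarrow> fst \<chi>\<theta> (?b 0 s @ a K) \<and> fst \<chi>\<theta> (?b 1 s @ a K) \<and> snd \<chi>\<theta> (?b 2 s)" for \<chi>\<theta> s
    have "\<exists>\<chi>\<theta>\<in>P2 \<times> \<Theta>. \<forall>s. R s \<longrightarrow> \<not> Q \<chi>\<theta> s"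
    proof (rule compactness_directed[OF A'(1)])
      show "definable A' R" unfolding R_def[abs_def]
        by (intro definable_conj definable_Not definable_on_tuple[OF definable_on_mono[OF P2_def'[OF \<eta>] A'(2)]]
            definable_on_tuple[OF definable_on_mono[OF \<nu>_B2[unfolded add.assoc] A'(2)]] definable_tuple_append definable_tuple_vars_upt aK)
      show "definable A' (Q \<chi>\<theta>)" if "\<chi>\<theta> \<in> P2 \<times> \<Theta>" for \<chi>\<theta>
      proof -
        have 1: "fst \<chi>\<theta> \<in> P2" "snd \<chi>\<theta> \<in> \<Theta>" using that by auto
        show ?thesis unfolding Q_def[abs_def]
          by (intro definable_conj definable_on_tuple[OF definable_on_mono[OF P2_def'[OF 1(1)] A'(2)]]
            definable_on_tuple[OF definable_on_mono[OF \<Theta>_def'[OF 1(2)] A'(2)]] definable_tuple_append definable_tuple_vars_upt aK)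
      qed
      show "P2 \<times> \<Theta> \<noteq> {}" using P2_ne \<Theta>_ne by simp
      show "\<exists>k\<in>P2 \<times> \<Theta>. \<forall>s. Q k s \<longrightarrow> Q i s \<and> Q j s" if "i \<in> P2 \<times> \<Theta>" "j \<in> P2 \<times> \<Theta>" for i j
      proof -
        have ij: "fst i \<in> P2" "fst j \<in> P2" "snd i \<in> \<Theta>" "snd j \<in> \<Theta>" using that by auto
        from P2_dir[OF ij(1,2)] obtain \<chi> where \<chi>: "\<chi> \<in> P2" "\<forall>x. \<chi> x \<longrightarrow> fst i x \<and> fst j x" by (rule bexE)
        from \<Theta>_dir[OF ij(3,4)] obtain \<theta> where \<theta>: "\<theta> \<in> \<Theta>" "\<forall>x. \<theta> x \<longrightarrow> snd i x \<and> snd j x" by (rule bexE)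
        have "(\<chi>, \<theta>) \<in> P2 \<times> \<Theta>" using \<chi>(1) \<theta>(1) by (rule SigmaI)
        moreover have "\<forall>s. Q (\<chi>, \<theta>) s \<longrightarrow> Q i s \<and> Q j s" unfolding Q_def using \<chi>(2) \<theta>(2) by simp
        ultimately show ?thesis by (intro bexI)
      qed
      show False if R: "R s" and Q: "\<And>i. i \<in> P2 \<times> \<Theta> \<Longrightarrow> Q i s" for s
      proof -
        obtain \<chi>0 where \<chi>0: "\<chi>0 \<in> P2" using P2_ne by (auto simp: ex_in_conv[symmetric])
        obtain \<theta>0 where \<theta>0: "\<theta>0 \<in> \<Theta>" using \<Theta>_ne by (auto simp: ex_in_conv[symmetric])
        have b01: "\<psi> (?b 0 s @ a K)" "\<psi> (?b 1 s @ a K)" if "\<psi> \<in> P2" for \<psi>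
          using Q[of "(\<psi>, \<theta>0)"] that \<theta>0 by (simp_all add: Q_def)
        have b2': "\<theta> (?b 2 s)" if "\<theta> \<in> \<Theta>" for \<theta>
          using Q[of "(\<chi>0, \<theta>)"] that \<chi>0 by (simp add: Q_def)
        have "realizes (?b 0 s @ a K) P2" by (rule realizesI) (rule b01(1))
        moreover have "realizes (?b 1 s @ a K) P2" by (rule realizesI) (rule b01(2))
        ultimately have b: "?b 0 s \<in> S K" "?b 1 s \<in> S K" by (simp_all add: P2_iff S_iff)
        have "realizes (?b 2 s) \<Theta>" by (rule realizesI) (rule b2')
        then have b2: "?b 2 s \<in> S 0" unfolding S0_iff by simp
        have c: "?b 0 s \<in> carrier G" "?b 1 s \<in> carrier G" "?b 2 s \<in> carrier G"
          using b b2 S_carrier by auto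
        have "\<nu>' (?b 2 s @ ?b 1 s @ ?b 0 s)" using R unfolding R_def by (rule conjunct1)
        then have "?b 2 s \<otimes>\<^bsub>G\<^esub> ?b 1 s = ?b 0 s" using op[OF c(3,2,1)] by (simp add: \<nu>'_def)
        then have "?b 2 s = ?b 0 s \<otimes>\<^bsub>G\<^esub> inv\<^bsub>G\<^esub> ?b 1 s" using c by (metis G.inv_solve_right)
        also have "\<dots> \<in> S K" using b subgroup.m_closed[OF sub] subgroup.m_inv_closed[OF sub] by simp
        finally have "realizes (?b 2 s @ a K) P2" using b2 by (simp add: P2_iff S_iff)
        from realizesD[OF this \<eta>] show False using R unfolding R_def by simp
      qed
    qed
    then obtain \<chi>\<theta> where 1: "\<chi>\<theta> \<in> P2 \<times> \<Theta>" "\<forall>s. R s \<longrightarrow> \<not> Q \<chi>\<theta> s" by (rule bexE)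
    have "U \<eta> (fst \<chi>\<theta>) (snd \<chi>\<theta>) (a K)"
      unfolding U_def
    proof (intro allI impI)
      fix s :: "nat \<times> nat \<Rightarrow> 'm"
      assume "fst \<chi>\<theta> (?b 0 s @ a K)" "fst \<chi>\<theta> (?b 1 s @ a K)" "snd \<chi>\<theta> (?b 2 s)"
        and \<nu>: "\<nu>' (?b 2 s @ ?b 1 s @ ?b 0 s)"
      then have "Q \<chi>\<theta> s" unfolding Q_def by (intro conjI)
      then have "\<not> R s" using 1(2) by auto
      then show "\<eta> (?b 2 s @ a K)" using \<nu> unfolding R_def by (simp only: simp_thms)
    qed
    then show ?thesis using 1(1) by (intro exI conjI)
  qed
  then have "\<forall>\<eta>\<in>P2. \<exists>\<chi>\<theta>. \<chi>\<theta> \<in> P2 \<times> \<Theta> \<and> U \<eta> (fst \<chi>\<theta>) (snd \<chi>\<theta>) (a K)" by (rule ballI)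
  then obtain gh where gh: "\<forall>\<eta>\<in>P2. gh \<eta> \<in> P2 \<times> \<Theta> \<and> U \<eta> (fst (gh \<eta>)) (snd (gh \<eta>)) (a K)"
    by (rule bchoice[THEN exE])
  define g where "g \<eta> = fst (gh \<eta>)" for \<eta>
  define h where "h \<eta> = snd (gh \<eta>)" for \<eta>
  have gh_in: "g \<eta> \<in> P2" "h \<eta> \<in> \<Theta>" and UK: "U \<eta> (g \<eta>) (h \<eta>) (a K)" if "\<eta> \<in> P2" for \<eta>
    using bspec[OF gh that] by (auto simp: g_def h_def)
  have one_B2: "set \<one>\<^bsub>G0\<^esub> \<subseteq> B2" by (auto simp: G0_simps B2_def e'_def)
  interpret D: uniform_subgroups L M G0 B2 n \<Theta> \<nu>' m P2 g h
    by (rule uniform_subgroups.intro[OF grp0 uniform_subgroups_axioms.intro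
          [OF P2_def' P2_ne P2_dir P2_entails gh_in one_B2]])
  have good_a: "D.good (a k)" if "K \<le> k" for k
    unfolding D.good_def
  proof (intro conjI ballI)
    fix \<eta> assume \<eta>: "\<eta> \<in> P2"
    have "U \<eta> (g \<eta>) (h \<eta>) (a k)"
      using K[OF U_def'[OF \<eta> gh_in[OF \<eta>], unfolded B2_def] \<open>K \<le> k\<close> order_refl] UK[OF \<eta>] by simp
    then show "D.controlled \<eta> (a k)" unfolding D.controlled_def U_def .
  next
    show "realizes (\<one>\<^bsub>G0\<^esub> @ a k) P2"
      using P2_iff[OF len_one, of "a k"] one[of k] one[of 0] by (simp add: G0_simps S_iff)
  qed (rule len)
  define r where "r = (\<lambda>(k, l). a (Suc (K + k)) ! l)"
  obtain t0 :: "rat \<times> nat \<Rightarrow> 'm" where t0: "indisc B2 UNIV t0" and em: "em_type B2 r t0"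
    using extract_indiscernible[OF B2, of r] by (elim exE conjE)
  have good_t0: "D.good (cell m t0 q)" for q
    unfolding cell_def
    by (rule D.em_type_good[OF em subset_refl, where \<kappa> = "\<lambda>l. l"]) (simp add: r_def list_as_map[OF len] good_a)
  have H_iff: "x \<in> D.H \<alpha> \<longleftrightarrow> length x = n \<and> realizes (x @ \<alpha>) P \<and> x \<in> S 0" for x \<alpha>
    unfolding D.H_def using P2_iff by auto
  show False
  proof (rule D.no_strict_intersections[OF t0 good_t0], rule ccontr)
    fix k :: nat
    assume "\<nexists>x. length x = n \<and> (\<forall>j<k. x \<in> D.H (cell m t0 (of_nat j))) \<and> x \<notin> D.H (cell m t0 (of_nat k))"
    then have contra: "x \<in> D.H (cell m t0 (of_nat k))"
      if "length x = n" "\<And>j. j < k \<Longrightarrow> x \<in> D.H (cell m t0 (of_nat j))" for x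
      using that by auto
    obtain x0 where x0: "length x0 = n" "\<forall>j<Suc (K + k). x0 \<in> S j" "x0 \<notin> S (Suc (K + k))"
      using strict by auto
    obtain \<psi>0 where \<psi>0: "\<psi>0 \<in> P" "\<not> \<psi>0 (x0 @ a (Suc (K + k)))"
      using x0(1,3) unfolding S_iff realizes_def by auto
    \<comment> \<open>\<open>S 0\<close> enters all intersections, so \<open>a 0\<close> is put in front of the sequence.\<close>
    define ua where "ua s = (\<lambda>(i, l). if i = 0 then a 0 ! l else s (of_nat (i - 1), l))"
      for s :: "rat \<times> nat \<Rightarrow> 'm"
    have ua0: "cell m (ua s) 0 = a 0" for s using list_as_map[OF len] by (simp add: cell_def ua_def)
    have uaS: "cell m (ua s) (Suc j) = cell m s (of_nat j)" for s j by (simp add: cell_def ua_def)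
    have "implied_by_type n m (ua t0) P {..k} \<psi>0 (Suc k)"
      unfolding implied_by_type_def
    proof (intro allI impI)
      fix x assume x: "length x = n" and r: "\<forall>p\<in>{..k}. realizes (x @ cell m (ua t0) p) P"
      have "x \<in> S 0" using r x ua0[of t0] by (force simp: S_iff)
      moreover have "realizes (x @ cell m t0 (of_nat j)) P" if "j < k" for j
        using r that uaS[of t0 j] by (auto dest!: bspec[of _ _ "Suc j"])
      ultimately have "x \<in> D.H (cell m t0 (of_nat k))" using x by (intro contra) (simp_all add: H_iff)
      then have "realizes (x @ cell m (ua t0) (Suc k)) P" by (simp add: H_iff uaS)
      then show "\<psi>0 (x @ cell m (ua t0) (Suc k))" using \<psi>0(1) by (rule realizesD)
    qed
    from implied_by_type_compact[OF B P_def' P_ne P_dir P_def'[OF \<psi>0(1)] finite_atMost this]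
    obtain \<chi> where \<chi>: "\<chi> \<in> P" "implied n m (ua t0) {..k} \<chi> \<psi>0 (Suc k)" by (rule bexE)
    define ta where "ta = (\<lambda>(k, l). a k ! l)"
    have ta: "cell m ta i = a i" for i using list_as_map[OF len] by (simp add: cell_def ta_def)
    have transfer: "implied n m ta (h ` {..k}) \<chi> \<psi>0 (h (Suc k)) \<longleftrightarrow> implied n m ta {..k} \<chi> \<psi>0 (Suc k)"
      if "strict_mono_on {..Suc k} h" for h
      by (rule implied_transfer[OF ind'[folded ta_def] P_def'[OF \<chi>(1)] P_def'[OF \<psi>0(1)]])
        (use that in \<open>simp_all add: atMost_Suc\<close>)
    \<comment> \<open>The original sequence has the same order type as \<open>a 0\<close> followed by a part of its tail.\<close>
    define h0 where "h0 i = (if i = 0 then 0 else K + i)" for i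
    have "strict_mono_on {..Suc k} h0" by (auto simp: strict_mono_on_def h0_def)
    note transfer0 = transfer[OF this]
    have "\<not> implied n m ta (h0 ` {..k}) \<chi> \<psi>0 (h0 (Suc k))"
    proof
      assume "implied n m ta (h0 ` {..k}) \<chi> \<psi>0 (h0 (Suc k))"
      then have "\<psi>0 (x0 @ cell m ta (h0 (Suc k)))"
      proof (rule impliedD[OF _ x0(1)])
        fix p assume "p \<in> h0 ` {..k}"
        then have "p < Suc (K + k)" by (auto simp: h0_def)
        then have "realizes (x0 @ a p) P" using x0(2) by (simp add: S_iff)
        then show "\<chi> (x0 @ cell m ta p)" unfolding ta using \<chi>(1) by (rule realizesD)
      qed
      then show False using \<psi>0(2) by (simp add: ta h0_def)
    qed
    then have not_a: "\<not> implied n m ta (h ` {..k}) \<chi> \<psi>0 (h (Suc k))" if "strict_mono_on {..Suc k} h" for h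
      using transfer[OF that] transfer0 by simp
    define R where "R s \<longleftrightarrow> \<not> implied n m (ua s) {..k} \<chi> \<psi>0 (Suc k)" for s
    have "R t0"
    proof (rule em_typeD[OF em])
      have tup: "definable_tuple B2 m (\<lambda>z :: (rat \<times> nat) + nat \<Rightarrow> 'm. map (\<lambda>l. ua (\<lambda>v. z (Inl v)) (p, l)) [0..<m])" for p
      proof (cases p)
        case 0
        have "map (\<lambda>l. ua s (0, l)) [0..<m] = a 0" for s
          using list_as_map[OF len] by (simp add: ua_def)
        then show ?thesis using a0_tuple 0 by simp
      next
        case (Suc j)
        have "(\<lambda>z :: (rat \<times> nat) + nat \<Rightarrow> 'm. map (\<lambda>l. ua (\<lambda>v. z (Inl v)) (Suc j, l)) [0..<m]) =
            (\<lambda>z. map (\<lambda>l. z (Inl (of_nat j, l))) [0..<m])"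
          by (simp add: ua_def fun_eq_iff)
        then show ?thesis unfolding Suc by (simp only: definable_tuple_vars_upt)
      qed
      show "definable B2 R"
        unfolding R_def[abs_def] implied_iff_fun
        by (intro definable_Not definable_all definable_imp definable_ball finite_atMost
            definable_on_tuple[OF P_B2[OF \<chi>(1)]] definable_on_tuple[OF P_B2[OF \<psi>0(1)]]
            definable_tuple_append definable_tuple_vars_upt tup)
      show "depends_on R (of_nat ` {..k} \<times> UNIV)"
        unfolding depends_on_def
      proof (intro allI impI)
        fix s s' :: "rat \<times> nat \<Rightarrow> 'm" assume eq: "\<forall>v\<in>of_nat ` {..k} \<times> UNIV. s v = s' v"
        have "cell m (ua s) p = cell m (ua s') p" if "p \<le> Suc k" for p
        proof (cases p)
          case (Suc j)
          then show ?thesis using eq that unfolding Suc uaS by (auto simp: cell_def)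
        qed (simp add: ua0)
        then show "R s = R s'" unfolding R_def implied_def by simp
      qed
    next
      fix f :: "rat \<Rightarrow> nat" assume f: "strict_mono_on (of_nat ` {..k}) f"
      define f' where "f' j = f (of_nat j)" for j :: nat
      have f': "f' i < f' j" if "i < j" "j \<le> k" for i j
        unfolding f'_def by (rule strict_mono_onD[OF f]) (use that in auto)
      define h where "h i = (if i = 0 then 0 else Suc (K + f' (i - 1)))" for i
      have "strict_mono_on {..Suc k} h"
      proof (rule strict_mono_onI)
        fix i j assume "i \<in> {..Suc k}" "j \<in> {..Suc k}" "i < j"
        then show "h i < h j"
          using f'[of "i - 1" "j - 1"] by (auto simp: h_def)
      qed
      moreover have "cell m (ua (r \<circ> map_prod f id)) p = cell m ta (h p)" for p
      proof (cases p)
        case (Suc j)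
        then show ?thesis unfolding Suc uaS ta using list_as_map[OF len] by (simp add: cell_def r_def h_def f'_def)
      qed (simp add: ua0 ta h_def)
      ultimately show "R (r \<circ> map_prod f id)"
        using not_a[of h] unfolding R_def implied_def by simp
    qed simp
    then show False using \<chi>(2) by (simp add: R_def)
  qed
qed

end

section \<open>Stabilisation of intersections\<close>

context monster
begin

text \<open>
  The inclusion for the first \<open>k\<close> groups spreads to all sets of at least \<open>k\<close> indices below \<open>q\<close>. The
  bound is kept positive, as an empty intersection would contain tuples of any length.
\<close>

lemma intersection_stabilizes:
  fixes n :: nat and a p
  defines "S \<equiv> \<lambda>j. solutions M n (plug (a j) ` p)"
  assumes strong: "strongly2_dependent L M" and grp: "type_definable_group L M G"
    and fam: "indiscernible_subgroup_family L M G n p a"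
  obtains k where "0 < k"
    "\<And>F q. finite F \<Longrightarrow> k \<le> card F \<Longrightarrow> (\<And>j. j \<in> F \<Longrightarrow> j < q) \<Longrightarrow> (\<Inter>j\<in>F. S j) \<subseteq> S q"
proof -
  define m where "m = length (a 0)"
  obtain B where B: "small B" and p: "type_over L (n + m) B p" and ind: "indiscernible L M B a"
    using fam unfolding indiscernible_subgroup_family_def m_def by auto
  obtain N where "\<forall>i. length (a i) = N" using ind unfolding indiscernible_def by auto
  then have len: "length (a i) = m" for i by (simp add: m_def)
  define P where "P = conj_closure p"
  have S_iff: "x \<in> S j \<longleftrightarrow> length x = n \<and> realizes (x @ a j) P" for x j
    unfolding S_def P_def by (rule solutions_plug_iff_conj_closure)
  have P_def': "definable_on B (n + m) \<psi>" if "\<psi> \<in> P" for \<psi>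
    using conj_closure_definable[OF p] that by (simp add: P_def)
  have P_dir: "\<exists>\<eta>\<in>P. \<forall>x. \<eta> x \<longrightarrow> \<psi> x \<and> \<psi>' x" if "\<psi> \<in> P" "\<psi>' \<in> P" for \<psi> \<psi>'
    using that unfolding P_def by (rule conj_closure_directed)
  have P_ne: "P \<noteq> {}" unfolding P_def by (rule conj_closure_nonempty)
  define ta where "ta = (\<lambda>(k, l). a k ! l)"
  have ind': "indisc B {..<m} ta" unfolding ta_def by (rule indisc_of_indiscernible[OF ind len])
  have ta: "cell m ta i = a i" for i using list_as_map[OF len] by (simp add: cell_def ta_def)
  obtain k where k: "\<And>x. length x = n \<Longrightarrow> (\<And>j. j < k \<Longrightarrow> x \<in> S j) \<Longrightarrow> x \<in> S k"
    using subgroup_chain_stabilizes[OF strong grp fam] unfolding S_def by auto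
  have *: "x \<in> S q" if F: "finite F" "Suc k \<le> card F" "\<And>j. j \<in> F \<Longrightarrow> j < q" and x: "x \<in> (\<Inter>j\<in>F. S j)" for F q x
  proof -
    have "F \<noteq> {}" using F(2) by auto
    then have xn: "length x = n" using x by (auto simp: S_iff)
    have "realizes (x @ a q) P"
    proof (rule realizesI)
      fix \<psi> assume \<psi>: "\<psi> \<in> P"
      have imp: "implied_by_type n m ta P {..<k} \<psi> k"
        unfolding implied_by_type_def ta
      proof (intro allI impI)
        fix y assume y: "length y = n" "\<forall>j\<in>{..<k}. realizes (y @ a j) P"
        then have "y \<in> S k" by (intro k) (simp_all add: S_iff)
        then show "\<psi> (y @ a k)" using \<psi> unfolding S_iff by (elim conjE realizesD)
      qed
      have "finite {..<k}" "\<And>j. j \<in> {..<k} \<Longrightarrow> j < k" by simp_all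
      from implied_by_type_card[OF ind' B P_def' P_ne P_dir P_def'[OF \<psi>] this imp]
      obtain \<chi> where \<chi>: "\<chi> \<in> P" "\<forall>F' q'. finite F' \<longrightarrow> card {..<k} \<le> card F' \<longrightarrow> (\<forall>j\<in>F'. j < q') \<longrightarrow>
          implied n m ta F' \<chi> \<psi> q'" by (rule bexE)
      have imp': "implied n m ta F \<chi> \<psi> q" by (rule \<chi>(2)[rule_format]) (use F in auto)
      show "\<psi> (x @ a q)"
      proof (rule impliedD[OF imp' xn, unfolded ta])
        fix j assume "j \<in> F"
        then have "realizes (x @ a j) P" using x by (auto simp: S_iff)
        then show "\<chi> (x @ a j)" using \<chi>(1) by (rule realizesD)
      qed
    qed
    then show ?thesis using xn by (simp add: S_iff)
  qed
  show ?thesis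
  proof (rule that[of "Suc k"])
    show "(\<Inter>j\<in>F. S j) \<subseteq> S q" if "finite F" "Suc k \<le> card F" "\<And>j. j \<in> F \<Longrightarrow> j < q" for F q
      by (rule subsetI) (rule *[OF that])
  qed simp
qed

lemma intersection_is_initial:
  assumes "strongly2_dependent L M" "type_definable_group L M G"
    "indiscernible_subgroup_family L M G n p a"
  shows "\<exists>k. (\<Inter>j. solutions M n (plug (a j) ` p)) = (\<Inter>j<k. solutions M n (plug (a j) ` p))"
proof -
  obtain k where k: "\<And>F q. finite F \<Longrightarrow> k \<le> card F \<Longrightarrow> (\<And>j. j \<in> F \<Longrightarrow> j < q) \<Longrightarrow>
      (\<Inter>j\<in>F. solutions M n (plug (a j) ` p)) \<subseteq> solutions M n (plug (a q) ` p)"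
    using intersection_stabilizes[OF assms] by metis
  have "(\<Inter>j<k. solutions M n (plug (a j) ` p)) \<subseteq> solutions M n (plug (a q) ` p)" for q
  proof (cases "q < k")
    case False
    then show ?thesis by (intro k) auto
  qed auto
  then show ?thesis by (intro exI[of _ k]) auto
qed

text \<open>
  A finite set of indices is built up in increasing order; once \<open>k\<close> indices have been collected, all
  later ones are redundant.
\<close>

lemma property_A_of_strongly2_dependent:
  assumes "strongly2_dependent L M"
  shows "property_A L M"
  unfolding property_A_def
proof (intro allI impI)
  fix G n p a
  assume "type_definable_group L M G" "indiscernible_subgroup_family L M G n p a"
  then obtain k where k: "0 < k" "\<And>F q. finite F \<Longrightarrow> k \<le> card F \<Longrightarrow> (\<And>j. j \<in> F \<Longrightarrow> j < q) \<Longrightarrow>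
      (\<Inter>j\<in>F. solutions M n (plug (a j) ` p)) \<subseteq> solutions M n (plug (a q) ` p)"
    using intersection_stabilizes[OF assms] by metis
  let ?S = "\<lambda>i. solutions M n (plug (a i) ` p)"
  have "\<exists>v'\<subseteq>v. card v' \<le> k \<and> (\<Inter>i\<in>v. ?S i) = (\<Inter>i\<in>v'. ?S i)" if "finite v" for v
    using that
  proof (induction v rule: finite_linorder_max_induct)
    case (insert b v)
    then obtain v' where v': "v' \<subseteq> v" "card v' \<le> k" "(\<Inter>i\<in>v. ?S i) = (\<Inter>i\<in>v'. ?S i)" by auto
    show ?case
    proof (cases "card v' = k")
      case True
      have "(\<Inter>i\<in>v'. ?S i) \<subseteq> ?S b"
        by (rule k(2)) (use True v'(1) insert.hyps finite_subset in auto)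
      then have "(\<Inter>i\<in>insert b v. ?S i) = (\<Inter>i\<in>v'. ?S i)" using v'(3) by auto
      then show ?thesis using v'(1,2) by (intro exI[of _ v']) auto
    next
      case False
      have "card (insert b v') \<le> Suc (card v')" by (rule card_insert_le_m1) auto
      then have "card (insert b v') \<le> k" using False v'(2) by simp
      moreover have "(\<Inter>i\<in>insert b v. ?S i) = (\<Inter>i\<in>insert b v'. ?S i)" using v'(3) by simp
      ultimately show ?thesis using v'(1) by (intro exI[of _ "insert b v'"]) auto
    qed
  qed auto
  then show "\<exists>k. \<forall>v. finite v \<longrightarrow> (\<exists>v'\<subseteq>v. card v' \<le> k \<and> (\<Inter>i\<in>v. ?S i) = (\<Inter>i\<in>v'. ?S i))" by blast
qed

text \<open>
  Without a finite subfamily there are \<open>c\<^sub>k\<close> in \<open>C\<close> and elements \<open>x\<^sub>k\<close> in the subgroups of all earlier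
  \<open>c\<^sub>j\<close>, but not in the one of \<open>c\<^sub>k\<close>. Elements satisfying \<open>\<phi>(\<cdot>, c\<^sub>k)\<close> lie in a subgroup,
  so \<open>\<phi>\<close> is its own modulus, and \<open>no_strict_chain\<close> applies.
\<close>

lemma definable_family_finite_intersection:
  assumes strong: "strongly2_dependent L M" and grp: "type_definable_group L M G"
    and fam: "definable_subgroup_family L M G n \<phi> C"
  shows "\<exists>C\<^sub>0. finite C\<^sub>0 \<and> C\<^sub>0 \<subseteq> C \<and> (\<Inter>c\<in>C. solutions M n {plug c \<phi>}) = (\<Inter>c\<in>C\<^sub>0. solutions M n {plug c \<phi>})"
proof (rule ccontr)
  assume neg: "\<not> ?thesis"
  define S where "S c = solutions M n {plug c \<phi>}" for c
  have proper: "\<exists>c\<in>C. \<not> (\<Inter>d\<in>D. S d) \<subseteq> S c" if "finite D" "D \<subseteq> C" for D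
  proof (rule ccontr)
    assume "\<not> ?thesis"
    then have "(\<Inter>c\<in>C. S c) = (\<Inter>c\<in>D. S c)" using that(2) by blast
    then show False using neg that unfolding S_def by blast
  qed
  obtain c0 where c0: "c0 \<in> C" using proper[of "{}"] by auto
  \<comment> \<open>Pairs of a finite subfamily, never empty, and a member of \<open>C\<close> whose subgroup does not contain the
    intersection of the subfamily.\<close>
  define ok where "ok x \<longleftrightarrow> finite (fst x) \<and> fst x \<subseteq> C \<and> fst x \<noteq> {} \<and> snd x \<in> C \<and> \<not> (\<Inter>d\<in>fst x. S d) \<subseteq> S (snd x)"
    for x :: "'m list set \<times> 'm list"
  have ok_ex: "\<exists>c. ok (D, c)" if "finite D" "D \<subseteq> C" "D \<noteq> {}" for D
    using proper[OF that(1,2)] that by (auto simp: ok_def)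
  have "\<exists>f. \<forall>k. ok (f k) \<and> fst (f (Suc k)) = insert (snd (f k)) (fst (f k))"
  proof (rule dependent_nat_choice)
    show "\<exists>x. ok x" using ok_ex[of "{c0}"] c0 by auto
    show "\<exists>y. ok y \<and> fst y = insert (snd x) (fst x)" if "ok x" for x and k :: nat
      using ok_ex[of "insert (snd x) (fst x)"] that by (auto simp: ok_def)
  qed
  then obtain f where f: "\<And>k. ok (f k)" "\<And>k. fst (f (Suc k)) = insert (snd (f k)) (fst (f k))" by auto
  define c where "c k = snd (f k)" for k
  have cC: "c k \<in> C" for k using f(1)[of k] by (simp add: ok_def c_def)
  have c_in: "c j \<in> fst (f k)" if "j < k" for j k
    using that by (induction k) (auto simp: f(2) less_Suc_eq c_def)
  have "\<not> (\<Inter>d\<in>fst (f k). S d) \<subseteq> S (c k)" for k using f(1)[of k] by (simp add: ok_def c_def)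
  then have "\<forall>k. \<exists>x. x \<in> (\<Inter>d\<in>fst (f k). S d) \<and> x \<notin> S (c k)" by (meson subsetI)
  then obtain x where x: "\<And>k. x k \<in> (\<Inter>d\<in>fst (f k). S d)" "\<And>k. x k \<notin> S (c k)" by metis
  obtain m where \<phi>: "pformula_over L (n + m) UNIV \<phi>" and lenC: "\<And>d. d \<in> C \<Longrightarrow> length d = m"
    and sub: "\<And>d. d \<in> C \<Longrightarrow> subgroup (S d) G"
    using fam unfolding definable_subgroup_family_def S_def by auto
  have x_len: "length (x k) = n" for k
    using x(1)[of k] f(1)[of k] by (auto simp: ok_def S_def solutions_def)
  obtain n' A \<Sigma> \<nu> e where G: "group G" and A: "small A" and \<Sigma>: "type_over L n' A \<Sigma>"
    and \<nu>: "pformula_over L (n' + n' + n') A (\<nu>, e)" and carrier: "carrier G = solutions M n' \<Sigma>"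
    and op: "\<And>x y z. x \<in> carrier G \<Longrightarrow> y \<in> carrier G \<Longrightarrow> z \<in> carrier G \<Longrightarrow>
      x \<otimes>\<^bsub>G\<^esub> y = z \<longleftrightarrow> holds M \<nu> (x @ y @ z @ e)"
    using grp unfolding type_definable_group_def by auto
  interpret G: group G by (rule G)
  have "\<one>\<^bsub>G\<^esub> \<in> S c0" by (rule subgroup.one_closed[OF sub[OF c0]])
  then have len_one: "length \<one>\<^bsub>G\<^esub> = n" by (simp add: S_def solutions_def)
  have n': "n' = n" using len_one G.one_closed by (simp add: carrier solutions_def)
  define B where "B = A \<union> set (e @ snd \<phi> @ \<one>\<^bsub>G\<^esub>)"
  have B: "small B" unfolding B_def by (intro small_Un A countable_finite) simp
  define \<Theta> where "\<Theta> = conj_closure \<Sigma>"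
  define \<nu>' where "\<nu>' z = holds M \<nu> (z @ e)" for z
  have carrier_\<Theta>: "carrier G = {x. length x = n \<and> (\<forall>\<theta>\<in>\<Theta>. \<theta> x)}"
    unfolding carrier \<Theta>_def n'
    by (rule Set.set_eqI) (simp only: mem_Collect_eq solutions_iff_conj_closure realizes_def)
  have \<Theta>_def': "definable_on B n \<theta>" if "\<theta> \<in> \<Theta>" for \<theta>
    by (rule definable_on_mono[OF conj_closure_definable[OF \<Sigma>[unfolded n']]])
      (use that in \<open>simp_all add: \<Theta>_def B_def\<close>)
  have \<Theta>_ne: "\<Theta> \<noteq> {}" unfolding \<Theta>_def by (rule conj_closure_nonempty)
  have \<Theta>_dir: "\<exists>\<eta>\<in>\<Theta>. \<forall>x. \<eta> x \<longrightarrow> \<theta> x \<and> \<theta>' x" if "\<theta> \<in> \<Theta>" "\<theta>' \<in> \<Theta>" for \<theta> \<theta>'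
    using that unfolding \<Theta>_def by (rule conj_closure_directed)
  have \<nu>_B: "definable_on B (n + n + n) \<nu>'"
  proof -
    have "pformula_over L (n + n + n) B (\<nu>, e)"
      using \<nu> by (auto simp: pformula_over_def n' B_def)
    from definable_on_holds[OF this] show ?thesis by (simp add: \<nu>'_def[abs_def])
  qed
  have \<nu>_op: "\<nu>' (x @ y @ z) \<longleftrightarrow> x \<otimes>\<^bsub>G\<^esub> y = z" if "x \<in> carrier G" "y \<in> carrier G" "z \<in> carrier G" for x y z
    using op[OF that] by (simp add: \<nu>'_def)
  interpret D: definable_group L M G B n \<Theta> \<nu>'
    by (rule definable_group.intro[OF monster_axioms G
          definable_group_axioms.intro[OF strong B carrier_\<Theta> \<Theta>_def' \<Theta>_ne \<Theta>_dir \<nu>_B \<nu>_op]])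
  from D.right_division obtain \<theta>0 where \<theta>0: "\<theta>0 \<in> \<Theta>" "\<forall>g\<in>carrier G. \<forall>y\<in>carrier G. \<forall>z. length z = n \<longrightarrow>
      \<theta>0 z \<longrightarrow> \<nu>' (z @ g @ y) \<longrightarrow> z = y \<otimes>\<^bsub>G\<^esub> inv\<^bsub>G\<^esub> g" by (rule bexE)
  define \<Phi> where "\<Phi> z = holds M (fst \<phi>) (z @ snd \<phi>)" for z
  have S_iff: "y \<in> S d \<longleftrightarrow> length y = n \<and> \<Phi> (y @ d)" for y d
    by (simp add: S_def solutions_def plug_def \<Phi>_def)
  have \<Phi>_B: "definable_on B (n + m) \<Phi>"
  proof -
    have "pformula_over L (n + m) B \<phi>" using \<phi> by (auto simp: pformula_over_def B_def)
    from definable_on_holds[OF this] show ?thesis by (simp add: \<Phi>_def[abs_def])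
  qed
  define P where "P = restrict_to n \<Theta> {\<Phi>}"
  have P_def': "definable_on B (n + m) \<psi>" if "\<psi> \<in> P" for \<psi>
    by (rule restrict_to_definable) (use that \<Phi>_B \<Theta>_def' in \<open>auto simp: P_def\<close>)
  have P_ne: "P \<noteq> {}" unfolding P_def by (rule restrict_to_nonempty[OF insert_not_empty \<Theta>_ne])
  have P_dir: "\<exists>\<eta>\<in>P. \<forall>x. \<eta> x \<longrightarrow> \<psi> x \<and> \<psi>' x" if "\<psi> \<in> P" "\<psi>' \<in> P" for \<psi> \<psi>'
    using that unfolding P_def
    by (rule restrict_to_directed[rotated 2]) (simp, rule \<Theta>_dir, assumption+)
  have P_entails: "\<exists>\<psi>\<in>P. \<forall>x \<alpha>. length x = n \<longrightarrow> length \<alpha> = m \<longrightarrow> \<psi> (x @ \<alpha>) \<longrightarrow> \<theta> x" if "\<theta> \<in> \<Theta>" for \<theta>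
    unfolding P_def by (rule restrict_to_entails[OF insert_not_empty that])
  have one_B: "set \<one>\<^bsub>G\<^esub> \<subseteq> B" by (auto simp: B_def)
  interpret D: uniform_subgroups L M G B n \<Theta> \<nu>' m P "\<lambda>\<eta>. \<eta>" "\<lambda>_. \<theta>0"
    by (rule uniform_subgroups.intro[OF D.definable_group_axioms uniform_subgroups_axioms.intro
          [OF P_def' P_ne P_dir P_entails _ \<theta>0(1) one_B]])
  have S_realizes: "realizes (y @ d) P" if y: "y \<in> S d" and d: "d \<in> C" for y d
  proof -
    have "y \<in> carrier G" using subgroup.subset[OF sub[OF d]] y by auto
    then have "realizes y \<Theta>" by (intro realizesI) (rule D.carrier_\<Theta>)
    moreover have "realizes (y @ d) {\<Phi>}" using y unfolding S_iff realizes_def by simp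
    ultimately show ?thesis
      using y unfolding P_def S_iff by (simp add: realizes_restrict_to \<Theta>_ne)
  qed
  have P_S: "y \<in> S d" if "\<psi> \<in> P" "\<psi> (y @ d)" "length y = n" for \<psi> y d
  proof -
    obtain \<chi> \<theta> where \<psi>: "\<psi> = (\<lambda>z. \<chi> z \<and> \<theta> (take n z))" "\<chi> \<in> {\<Phi>}" "\<theta> \<in> \<Theta>"
      using \<open>\<psi> \<in> P\<close> unfolding P_def by (rule restrict_toE)
    show ?thesis using \<psi>(2) that(2,3) unfolding \<psi>(1) S_iff by simp
  qed
  have good: "D.good d" if d: "d \<in> C" for d
    unfolding D.good_def
  proof (intro conjI ballI)
    show "realizes (\<one>\<^bsub>G\<^esub> @ d) P" by (intro S_realizes d subgroup.one_closed[OF sub[OF d]])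
    fix \<eta> assume \<eta>: "\<eta> \<in> P"
    show "D.controlled \<eta> d"
    proof (rule D.controlledI)
      fix y f z assume len: "length y = n" "length f = n" "length z = n"
        and y: "\<eta> (y @ d)" and f: "\<eta> (f @ d)" and z: "\<theta>0 z" "\<nu>' (z @ f @ y)"
      have yf: "y \<in> S d" "f \<in> S d" using P_S[OF \<eta>] len y f by auto
      then have "y \<in> carrier G" "f \<in> carrier G" using subgroup.subset[OF sub[OF d]] by auto
      then have "z = y \<otimes>\<^bsub>G\<^esub> inv\<^bsub>G\<^esub> f" using \<theta>0(2) len z by simp
      also have "\<dots> \<in> S d"
        using yf subgroup.m_closed[OF sub[OF d]] subgroup.m_inv_closed[OF sub[OF d]] by simp
      finally show "\<eta> (z @ d)" using S_realizes[OF _ d] realizesD[OF _ \<eta>] by simp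
    qed
  qed (rule lenC[OF d])
  obtain \<psi>0 where \<psi>0: "\<psi>0 \<in> P" using P_ne by (auto simp: ex_in_conv[symmetric])
  show False
  proof (rule D.no_strict_chain[of c \<psi>0 x])
    show "x k \<in> D.H (c j)" if "j < k" for j k
      using x(1)[of k] c_in[OF that] S_realizes[OF _ cC] x_len by (auto simp: D.H_def)
    show "\<not> \<psi>0 (x k @ c k)" for k using P_S[OF \<psi>0 _ x_len] x(2) by auto
  qed (use good cC \<psi>0 x_len in auto)
qed

end

text \<open>
  There are infinitely many formulas, so a universe of larger cardinality is uncountable.
\<close>

lemma monster_of_monster_model:
  fixes M :: "('f, 'r, 'm) fo_struct"
  assumes "monster_model L T M"
  shows "monster L M"
proof
  show "saturated L M" using assms by (simp add: monster_model_def)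
  show "uncountable (UNIV :: 'm set)"
  proof
    assume "countable (UNIV :: 'm set)"
    then have "(UNIV :: 'm set) \<lesssim> (UNIV :: nat set)" by (auto simp: countable_def lepoll_def)
    also have "(UNIV :: nat set) \<lesssim> {\<phi> :: ('f, 'r) fo_formula. formula_of L \<phi>}"
      unfolding lepoll_def by (intro exI[of _ "\<lambda>i. Equal (Var i) (Var i)"]) (auto simp: inj_on_def)
    also have "\<dots> \<prec> (UNIV :: 'm set)" using assms by (simp add: monster_model_def)
    finally show False by simp
  qed
qed

theorem corollary2p8:
  fixes L :: "('f, 'r) language"
    and T :: "('f, 'r) fo_formula set"
    and M :: "('f, 'r, 'm) fo_struct"
    and G :: "'m list monoid"
  assumes "complete_theory L T"
    and "monster_model L T M"
    and "strongly2_dependent L M"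
    and "type_definable_group L M G"
  shows "(\<forall>n p a. indiscernible_subgroup_family L M G n p a \<longrightarrow>
            (\<exists>k. (\<Inter>j. solutions M n (plug (a j) ` p)) = (\<Inter>j<k. solutions M n (plug (a j) ` p))))
       \<and> property_A L M
       \<and> (\<forall>n \<phi> C. definable_subgroup_family L M G n \<phi> C \<longrightarrow>
            (\<exists>C\<^sub>0. finite C\<^sub>0 \<and> C\<^sub>0 \<subseteq> C \<and>
               (\<Inter>c\<in>C. solutions M n {plug c \<phi>}) = (\<Inter>c\<in>C\<^sub>0. solutions M n {plug c \<phi>})))"
proof -
  interpret monster L M by (rule monster_of_monster_model[OF assms(2)])
  show ?thesis
    using intersection_is_initial[OF assms(3,4)] property_A_of_strongly2_dependent[OF assms(3)]
      definable_family_finite_intersection[OF assms(3,4)] by blast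
qed

end
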